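(* Let $d\ge 3$, and let the random surface $X^{\mathfrak W}_n$ (the harness process on $\mathbb Z^d$ with transition matrix $\mathcal P$, noise variables distributed as $\varepsilon$, and exclusion by the random wall ${\mathfrak W}$ with i.i.d. heights distributed as $W$) be as defined in the context. Let $F_\varepsilon$ and $F_W$ be the distribution functions of $\varepsilon$ and of $W$, and suppose $F_\varepsilon\in\mathcal L_\alpha$ and $F_W\in\mathcal L_\theta$. For $n\ge 3$ set $$A_n=\begin{cases}(\log n)^{\frac1\alpha\vee\frac{2}{2+d}}, & \text{if }\alpha\neq 1+\frac d2,\\ (\log n)^{\frac{2}{2+d}}(\log\log n)^{\frac{d}{d+2}}, & \text{if }\alpha=1+\frac d2.\end{cases}$$ Then the following hold, where $\mathbb E$ is expectation with respect to both the noise and the wall variables. (Lower bound) If $\alpha>0$ and $\theta>0$, there exists a constant $c>0$ such that for all $n\ge 3$ $$\mathbb E\,X^{\mathfrak W}_n(0)\ \ge\ c\,(\log n)^{\frac1\alpha\vee\frac1\theta}.$$ (Upper bound) If $\alpha>1$ and $\theta>0$, there exists a constant $C<\infty$ such that for all $n\ge 3$ $$\mathbb E\,X^{\mathfrak W}_n(0)\ \le\ C\big(A_n+(\log n)^{\frac1\theta}\big).$$ The constants $c,C$ do not depend on $n$.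
   Context: Transition matrix. For $i,j\in\mathbb Z^d$, $|i-j|$ is the number of edges in a minimal nearest-neighbour path from $i$ to $j$. $\mathcal P=\{p(i,j)\}_{i,j\in\mathbb Z^d}$ is a symmetric stochastic matrix that is homogeneous, $p(i,j)=p(0,j-i)=:p(j-i)=p(i-j)$; of finite range, i.e. $p(j)=0$ for all $|j|>v$ for some $v$; and truly $d$-dimensional, i.e. $\{j\in\mathbb Z^d: p(j)\ne 0\}$ generates $\mathbb Z^d$. For $x:\mathbb Z^d\to\mathbb R$, $\mathcal P x(i)=\sum_{j}p(i,j)x(j)$. Noise. $\{\varepsilon,\varepsilon_n(i): i\in\mathbb Z^d,n\in\mathbb Z\}$ are i.i.d. integrable symmetric real random variables with unbounded support. Wall. ${\mathfrak W}=\{W(i)\}_{i\in\mathbb Z^d}$ are i.i.d. random variables with values in $[-\infty,\infty)$ (the value $-\infty$ may be taken with positive probability), independent of the noise; $W$ denotes a generic copy. Process. Given ${\mathfrak W}$, $X^{\mathfrak W}_0(i)=0\vee W(i)$, and for $n\ge 1$ $$X^{\mathfrak W}_n(i)=W(i)+\big(\mathcal P X^{\mathfrak W}_{n-1}(i)+\varepsilon_n(i)-W(i)\big)^+ ,$$ which is interpreted as $\mathcal P X^{\mathfrak W}_{n-1}(i)+\varepsilon_n(i)$ when $W(i)=-\infty$. (Here $a^+=\max(a,0)$ and $a\vee b=\max(a,b)$.) Tail classes. For a distribution function $F$ let $\bar F=1-F$. For $\alpha>0$, $\mathcal L_\alpha=\mathcal L_\alpha^-\cap\mathcal L_\alpha^+$,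 where $\mathcal L_\alpha^-$ is the set of $F$ for which there are constants $c,c'>0$ with $\bar F(x)\le c e^{-c'x^\alpha}$ for all $x>0$, and $\mathcal L_\alpha^+$ is the set of $F$ for which there are constants $c,c'>0$ with $\bar F(x)\ge c e^{-c'x^\alpha}$ for all $x>0$. *)

theory Defs
  imports "HOL-Probability.Probability" "HOL-Computational_Algebra.Group_Closure"
begin

section \<open>The transition matrix\<close>

text \<open>The lattice \<open>\<int>\<^sup>d\<close> is the type \<open>int ^ 'd\<close> with \<open>d = CARD('d)\<close>.\<close>

definition nn_edges :: "((int ^ 'd) \<times> (int ^ 'd)) set" where
  "nn_edges = {(i, j). \<exists>k. j = i + axis k 1 \<or> j = i - axis k 1}"

definition lattice_dist :: "int ^ 'd \<Rightarrow> int ^ 'd \<Rightarrow> nat" where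
  "lattice_dist i j = (LEAST n. (i, j) \<in> nn_edges ^^ n)"

locale harness_matrix =
  fixes p :: "int ^ 'd \<Rightarrow> int ^ 'd \<Rightarrow> real"
  assumes nonneg: "0 \<le> p i j"
    and stochastic: "(p i has_sum 1) UNIV"
    and symmetric: "p i j = p j i"
    and homogeneous: "p i j = p 0 (j - i)"
    and finite_range: "\<exists>v. \<forall>j. lattice_dist 0 j > v \<longrightarrow> p 0 j = 0"
    and truly_d_dimensional: "group_closure {j. p 0 j \<noteq> 0} = UNIV"

definition matrix_apply :: "(int ^ 'd \<Rightarrow> int ^ 'd \<Rightarrow> real) \<Rightarrow> (int ^ 'd \<Rightarrow> real) \<Rightarrow> int ^ 'd \<Rightarrow> real" where
  "matrix_apply p x i = (\<Sum>\<^sub>\<infinity>j. p i j * x j)"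


section \<open>The harness process above a wall\<close>

text \<open>
  For a fixed wall \<open>w\<close> and a fixed realisation \<open>e\<close> of the noise. Wall heights lie in
  \<open>[-\<infinity>, \<infinity>)\<close>, represented in \<^typ>\<open>ereal\<close>; the value \<open>\<infinity>\<close> is excluded in
  \<open>harness_process\<close> below.
\<close>

fun harness ::
  "(int ^ 'd \<Rightarrow> int ^ 'd \<Rightarrow> real) \<Rightarrow> (int ^ 'd \<Rightarrow> ereal) \<Rightarrow> (int \<Rightarrow> int ^ 'd \<Rightarrow> real) \<Rightarrow>
   nat \<Rightarrow> int ^ 'd \<Rightarrow> real" where
  "harness p w e 0 i = real_of_ereal (max 0 (w i))"
| "harness p w e (Suc n) i =
     (let y = matrix_apply p (harness p w e n) i + e (int (Suc n)) i
      in if w i = -\<infinity> then y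
         else real_of_ereal (w i) + max 0 (y - real_of_ereal (w i)))"

definition law_support :: "real measure \<Rightarrow> real set" where
  "law_support \<mu> = {x. \<forall>U. open U \<and> x \<in> U \<longrightarrow> measure \<mu> U > 0}"

text \<open>
  \<open>\<mu>\<close> is the law of \<open>\<epsilon>\<close> and \<open>\<nu>\<close> the law of \<open>W\<close>. All variables live on one probability
  space \<open>M\<close>, so that integration over \<open>M\<close> averages over both the noise and the wall.
\<close>

locale harness_process = prob_space M + harness_matrix p
  for M :: "'a measure" and p :: "int ^ 'd \<Rightarrow> int ^ 'd \<Rightarrow> real" +
  fixes \<mu> :: "real measure" and \<nu> :: "ereal measure"
    and eps :: "int \<Rightarrow> int ^ 'd \<Rightarrow> 'a \<Rightarrow> real"
    and W :: "int ^ 'd \<Rightarrow> 'a \<Rightarrow> ereal"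
  assumes noise_indep: "indep_vars (\<lambda>_. borel) (\<lambda>(n, i). eps n i) UNIV"
    and noise_law: "distr M borel (eps n i) = \<mu>"
    and noise_integrable: "integrable \<mu> (\<lambda>x. x)"
    and noise_symmetric: "distr \<mu> borel uminus = \<mu>"
    and noise_unbounded: "\<not> bounded (law_support \<mu>)"
    and wall_indep: "indep_vars (\<lambda>_. borel) W UNIV"
    and wall_law: "distr M borel (W i) = \<nu>"
    and wall_less_infty: "\<omega> \<in> space M \<Longrightarrow> W i \<omega> < \<infinity>"
    and wall_noise_indep:
      "indep_set
         (sets (vimage_algebra (space M) (\<lambda>\<omega> i. W i \<omega>) (PiM UNIV (\<lambda>_. borel))))
         (sets (vimage_algebra (space M) (\<lambda>\<omega> (n, i). eps n i \<omega>) (PiM UNIV (\<lambda>_. borel))))"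

definition harness_surface ::
  "(int ^ 'd \<Rightarrow> int ^ 'd \<Rightarrow> real) \<Rightarrow> (int \<Rightarrow> int ^ 'd \<Rightarrow> 'a \<Rightarrow> real) \<Rightarrow>
   (int ^ 'd \<Rightarrow> 'a \<Rightarrow> ereal) \<Rightarrow> nat \<Rightarrow> int ^ 'd \<Rightarrow> 'a \<Rightarrow> real" where
  "harness_surface p eps W n i \<omega> = harness p (\<lambda>j. W j \<omega>) (\<lambda>m j. eps m j \<omega>) n i"


section \<open>Tail classes\<close>

text \<open>
  The distribution function of an extended real variable, at real arguments only. It is the
  analogue of \<^const>\<open>cdf\<close>, but need not tend to \<open>0\<close> at \<open>-\<infinity>\<close>.
\<close>

definition ecdf :: "ereal measure \<Rightarrow> real \<Rightarrow> real" where
  "ecdf \<nu> x = measure \<nu> {..ereal x}"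

definition tail_class_upper :: "real \<Rightarrow> (real \<Rightarrow> real) set" ("\<L>\<^sup>-") where
  "\<L>\<^sup>- \<alpha> = {F. \<exists>c>0. \<exists>c'>0. \<forall>x>0. 1 - F x \<le> c * exp (- c' * x powr \<alpha>)}"

definition tail_class_lower :: "real \<Rightarrow> (real \<Rightarrow> real) set" ("\<L>\<^sup>+") where
  "\<L>\<^sup>+ \<alpha> = {F. \<exists>c>0. \<exists>c'>0. \<forall>x>0. 1 - F x \<ge> c * exp (- c' * x powr \<alpha>)}"

definition tail_class :: "real \<Rightarrow> (real \<Rightarrow> real) set" ("\<L>") where
  "\<L> \<alpha> = \<L>\<^sup>- \<alpha> \<inter> \<L>\<^sup>+ \<alpha>"


section \<open>The rate in the upper bound\<close>

definition harness_rate :: "nat \<Rightarrow> real \<Rightarrow> nat \<Rightarrow> real" where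
  "harness_rate d \<alpha> n =
     (if \<alpha> \<noteq> 1 + real d / 2
      then ln (real n) powr max (1 / \<alpha>) (2 / (2 + real d))
      else ln (real n) powr (2 / (2 + real d)) * ln (ln (real n)) powr (real d / (real d + 2)))"

end

theory Submission
  imports Defs
begin

text \<open>
  Let \<open>\<xi>\<close> be the process without wall started from \<open>0\<close>; it is linear in the noise, with the
  transition probabilities \<open>p\<^sub>k\<close> of the random walk as coefficients. If \<open>L\<close> bounds \<open>W\<^sup>+ - \<xi>\<close> on the
  finite space-time region which can influence site \<open>0\<close> at time \<open>n\<close>, then \<open>\<xi> + L\<close> stays above both the
  wall and the surface, so the surface at \<open>0\<close> is at most \<open>\<xi>\<^sub>n(0) + L\<close>. Hence the upper bound reduces
  to expected maxima of polynomially many variables \<open>W\<^sup>+\<close> and \<open>\<bar>\<xi>\<bar>\<close>. These are estimated by exponential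
  moments: \<open>ln E exp (s \<epsilon>)\<close> is of order \<open>s\<^sup>2\<close> for small \<open>s\<close> and \<open>s\<^bsup>\<alpha>/(\<alpha>-1)\<^esup>\<close> for large \<open>s\<close>, and summing
  this over the coefficients with \<open>p\<^sub>k \<le> C k\<^bsup>-d/2\<^esup>\<close> gives the rate.

  The heat kernel bound follows from a Nash-type argument. The increments
  \<open>\<delta>(z) = p\<^sub>2\<^sub>k(0) - p\<^sub>2\<^sub>k(z)\<close> are half the squared \<open>\<ell>\<^sup>2\<close> norms of \<open>p\<^sub>k - p\<^sub>k(\<cdot> + z)\<close>, so \<open>\<surd>\<delta>\<close> is
  subadditive, and averaging over a box with edges along \<open>d\<close> independent steps yields
  \<open>p\<^sub>2\<^sub>k(0) \<le> C r\<^sup>2 (p\<^sub>2\<^sub>k(0) - p\<^sub>2\<^sub>k\<^sub>+\<^sub>2(0)) + r\<^bsup>-d\<^esup>\<close> for every \<open>r\<close>.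

  For the lower bounds, average over the noise with the wall fixed and follow the random walk backwards
  in time. A visit to a site with \<open>W \<ge> h\<close> lifts the mean to \<open>h\<close>, and a visit to a site with
  \<open>W \<ge> 0\<close> gains \<open>h\<close> with probability \<open>P(\<epsilon> \<le> -h)\<close>, because the wall cuts off such a jump. For
  \<open>h\<close> a small multiple of the claimed order these gains have probability at least a small negative
  power of \<open>n\<close>, while the walk visits a larger power of \<open>n\<close> of distinct sites, at which the wall is
  independent.
\<close>

section \<open>The heat kernel\<close>

lemma nn_edges_translate:
  "(i, j) \<in> nn_edges ^^ n \<Longrightarrow> (i + a, j + a) \<in> nn_edges ^^ n"
proof (induction n arbitrary: j)
  case 0
  then show ?case by simp
next
  case (Suc n)
  then obtain k where k: "(i, k) \<in> nn_edges ^^ n" "(k, j) \<in> nn_edges" by auto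
  have "(k + a, j + a) \<in> nn_edges" using k(2) by (auto simp: nn_edges_def algebra_simps)
  with Suc.IH[OF k(1)] show ?case by auto
qed

lemma nn_edges_trans:
  assumes "(i, j) \<in> nn_edges ^^ n" "(j, k) \<in> nn_edges ^^ m"
  shows "(i, k) \<in> nn_edges ^^ (n + m)"
  using assms by (auto simp: relpow_add)

lemma nn_reach_add:
  assumes "\<exists>n. (0, a) \<in> nn_edges ^^ n" "\<exists>n. (0, b) \<in> nn_edges ^^ n"
  shows "\<exists>n. (0, a + b) \<in> nn_edges ^^ n"
proof -
  obtain n m where "(0, a) \<in> nn_edges ^^ n" "(0, b) \<in> nn_edges ^^ m" using assms by auto
  then have "(0, a + b) \<in> nn_edges ^^ (m + n)"
    using nn_edges_translate[of 0 a n b] by (intro nn_edges_trans[of 0 b]) auto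
  then show ?thesis by blast
qed

lemma nn_reach_axis: "\<exists>n. (0, axis k z) \<in> nn_edges ^^ n"
proof -
  have s: "\<exists>n. (0, axis k c) \<in> nn_edges ^^ n" if "c = 1 \<or> c = -1" for c :: int
  proof -
    have "axis k (-1) = - (axis k 1 :: int ^ 'a)" by (simp add: vec_eq_iff axis_def)
    then have "(0 :: int ^ 'a, axis k c) \<in> nn_edges ^^ 1" using that
      by (auto simp: nn_edges_def)
    then show ?thesis by blast
  qed
  have ax: "axis k (x + y) = axis k x + (axis k y :: int ^ 'a)" for x y
    by (simp add: vec_eq_iff axis_def)
  have 0: "\<exists>n. (0, axis k 0 :: int ^ 'a) \<in> nn_edges ^^ n"
    by (rule exI[of _ 0]) (simp add: vec_eq_iff axis_def)
  show ?thesis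
  proof (induction z rule: int_induct[of _ 0])
    case base
    then show ?case by (rule 0)
  next
    case (step1 i)
    then show ?case using nn_reach_add[OF step1(2) s[of 1]] by (simp add: ax)
  next
    case (step2 i)
    then show ?case using nn_reach_add[OF step2(2) s[of "-1"]]
      by (simp flip: ax)
  qed
qed

text \<open>\<open>lattice_dist\<close> is a \<open>LEAST\<close> value, so it says something about
  a point only once some path to that point is known to exist. Summing the coordinate vectors of
  \<open>j\<close> produces one.\<close>

lemma nn_reachable:
  fixes j :: "int ^ 'd"
  shows "\<exists>n. (0, j) \<in> nn_edges ^^ n"
proof -
  have "\<exists>n. (0, \<Sum>k\<in>F. axis k (j $ k)) \<in> nn_edges ^^ n" if "finite F" for F
    using that
  proof induction
    case empty
    then show ?case by (auto intro: exI[of _ 0])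
  next
    case (insert x F)
    then show ?case using nn_reach_add[OF nn_reach_axis insert.IH] by simp
  qed
  moreover have "(\<Sum>k\<in>UNIV. axis k (j $ k)) = j"
    by (simp add: vec_eq_iff axis_def if_distrib[of "\<lambda>f. f _"] sum.delta cong: if_cong)
  ultimately show ?thesis by (metis finite)
qed

lemma finite_nn_ball: "finite {j :: int ^ 'd. (0, j) \<in> nn_edges ^^ n}"
proof (induction n)
  case 0
  then show ?case by simp
next
  case (Suc n)
  have "{j :: int ^ 'd. (0, j) \<in> nn_edges ^^ Suc n} \<subseteq>
     (\<Union>i\<in>{j. (0, j) \<in> nn_edges ^^ n}. (\<lambda>k. i + axis k 1) ` UNIV \<union> (\<lambda>k. i - axis k 1) ` UNIV)"
    by (auto simp: nn_edges_def)
  then show ?case by (rule finite_subset) (use Suc in auto)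
qed

lemma finite_lattice_ball: "finite {j :: int ^ 'd. lattice_dist 0 j \<le> v}"
proof -
  have "{j :: int ^ 'd. lattice_dist 0 j \<le> v} \<subseteq> (\<Union>n\<le>v. {j. (0, j) \<in> nn_edges ^^ n})"
  proof
    fix j :: "int ^ 'd" assume "j \<in> {j. lattice_dist 0 j \<le> v}"
    moreover have "(0, j) \<in> nn_edges ^^ lattice_dist 0 j"
      unfolding lattice_dist_def by (rule LeastI_ex[OF nn_reachable])
    ultimately show "j \<in> (\<Union>n\<le>v. {j. (0, j) \<in> nn_edges ^^ n})" by blast
  qed
  then show ?thesis by (rule finite_subset) (use finite_nn_ball in auto)
qed

text \<open>The supremum norm. It is subadditive and its balls are boxes with an explicit number of
  points, which is the form in which finite range enters the later estimates.\<close>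

definition max_abs :: "int ^ 'd \<Rightarrow> nat" where
  "max_abs j = Max (range (\<lambda>k. nat \<bar>j $ k\<bar>))"

lemma max_abs_le_iff: "max_abs j \<le> n \<longleftrightarrow> (\<forall>k. \<bar>j $ k\<bar> \<le> int n)"
  unfolding max_abs_def by (subst Max_le_iff) (auto simp: nat_le_iff)

lemma max_abs_add: "max_abs (i + j) \<le> max_abs i + max_abs j"
  unfolding max_abs_le_iff
proof
  fix k
  have "\<bar>i $ k\<bar> \<le> int (max_abs i)" "\<bar>j $ k\<bar> \<le> int (max_abs j)"
    using max_abs_le_iff by blast+
  then show "\<bar>(i + j) $ k\<bar> \<le> int (max_abs i + max_abs j)" by auto
qed

lemma max_abs_0 [simp]: "max_abs 0 = 0"
  using max_abs_le_iff[of 0 0] by simp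

lemma
  fixes n :: nat
  shows finite_box: "finite {j :: int ^ 'd. max_abs j \<le> n}"
    and card_box: "card {j :: int ^ 'd. max_abs j \<le> n} = (2 * n + 1) ^ CARD('d)"
proof -
  let ?P = "PiE (UNIV :: 'd set) (\<lambda>_. {- int n..int n})"
  have "bij_betw vec_nth {j :: int ^ 'd. max_abs j \<le> n} ?P"
    by (rule bij_betwI[of _ _ _ vec_lambda]) (auto simp: max_abs_le_iff PiE_iff abs_le_iff minus_le_iff)
  moreover have "finite ?P" by (intro finite_PiE) auto
  moreover have "card ?P = (2 * n + 1) ^ CARD('d)" by (simp add: card_PiE nat_add_distrib nat_mult_distrib)
  ultimately show "finite {j :: int ^ 'd. max_abs j \<le> n}"
      "card {j :: int ^ 'd. max_abs j \<le> n} = (2 * n + 1) ^ CARD('d)"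
    by (auto simp: bij_betw_finite bij_betw_same_card)
qed

section \<open>The random walk and its transition probabilities\<close>

context harness_matrix
begin

definition steps :: "(int ^ 'd) set" where
  "steps = {z. p 0 z \<noteq> 0}"

lemma finite_steps: "finite steps"
proof -
  obtain v where "\<forall>j. lattice_dist 0 j > v \<longrightarrow> p 0 j = 0" using finite_range by auto
  then have "steps \<subseteq> {j. lattice_dist 0 j \<le> v}" unfolding steps_def by (auto simp: not_less[symmetric])
  then show ?thesis by (rule finite_subset[OF _ finite_lattice_ball])
qed

lemma p_minus: "p 0 (- z) = p 0 z"
  using homogeneous[of z 0] symmetric[of z 0] by simp

lemma uminus_steps: "- z \<in> steps \<longleftrightarrow> z \<in> steps"
  by (simp add: steps_def p_minus)

lemma sum_steps: "(\<Sum>z\<in>steps. p 0 z) = 1"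
proof -
  have "(p 0 has_sum 1) steps"
    by (rule iffD1[OF has_sum_cong_neutral stochastic]) (auto simp: steps_def)
  then show ?thesis using finite_steps by (metis has_sum_finite has_sum_unique)
qed

lemma matrix_apply_eq: "matrix_apply p x i = (\<Sum>z\<in>steps. p 0 z * x (i + z))"
proof -
  have *: "p i j = 0" if "j \<notin> (\<lambda>z. i + z) ` steps" for j
  proof -
    have "j - i \<notin> steps" using that by (metis add.commute diff_add_cancel image_eqI)
    then show ?thesis using homogeneous[of i j] by (simp add: steps_def)
  qed
  have "(\<Sum>\<^sub>\<infinity>j. p i j * x j) = (\<Sum>\<^sub>\<infinity>j\<in>(\<lambda>z. i + z) ` steps. p i j * x j)"
    by (rule infsum_cong_neutral) (use * in auto)
  also have "\<dots> = (\<Sum>j\<in>(\<lambda>z. i + z) ` steps. p i j * x j)" using finite_steps by simp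
  also have "\<dots> = (\<Sum>z\<in>steps. p 0 z * x (i + z))"
    by (subst sum.reindex) (use homogeneous[of i] in auto)
  finally show ?thesis unfolding matrix_apply_def .
qed

text \<open>The \<open>Suc\<close> guarantees positivity: distances are later divided by this number
  to count steps.\<close>

definition step_range :: nat where
  "step_range = Suc (Max (max_abs ` steps))"

lemma step_range_pos: "step_range > 0"
  by (simp add: step_range_def)

lemma max_abs_step: "z \<in> steps \<Longrightarrow> max_abs z \<le> step_range"
  unfolding step_range_def using finite_steps by (intro le_SucI Max_ge) auto

text \<open>The probability that the walk started at the origin is at \<open>x\<close> after
  \<open>k\<close> steps.\<close>

fun heat :: "nat \<Rightarrow> int ^ 'd \<Rightarrow> real" where
  "heat 0 x = (if x = 0 then 1 else 0)"
| "heat (Suc k) x = (\<Sum>z\<in>steps. p 0 z * heat k (x - z))"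

lemma heat_nonneg: "heat k x \<ge> 0"
  by (induction k arbitrary: x) (auto intro!: sum_nonneg nonneg mult_nonneg_nonneg)

lemma heat_support: "heat k x \<noteq> 0 \<Longrightarrow> max_abs x \<le> step_range * k"
proof (induction k arbitrary: x)
  case 0
  then show ?case by (auto split: if_splits)
next
  case (Suc k)
  then obtain z where z: "z \<in> steps" "heat k (x - z) \<noteq> 0"
    by (metis (no_types, lifting) heat.simps(2) mult_not_zero sum.not_neutral_contains_not_neutral)
  have "max_abs x \<le> max_abs (x - z) + max_abs z" using max_abs_add[of "x - z" z] by simp
  also have "\<dots> \<le> step_range * k + step_range" using Suc.IH[OF z(2)] max_abs_step[OF z(1)] by simp
  finally show ?case by simp
qed

lemma heat_minus: "heat k (- x) = heat k x"
proof (induction k arbitrary: x)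
  case (Suc k)
  have "heat (Suc k) (- x) = (\<Sum>z\<in>steps. p 0 z * heat k (- (x + z)))" by simp
  also have "\<dots> = (\<Sum>z\<in>steps. p 0 z * heat k (x + z))" by (simp only: Suc)
  also have "\<dots> = (\<Sum>z\<in>steps. p 0 z * heat k (x - z))"
    by (rule sum.reindex_bij_witness[of _ uminus uminus]) (auto simp: uminus_steps p_minus)
  finally show ?case by simp
qed auto

lemma finite_heat: "finite {x. heat k x \<noteq> 0}"
  by (rule finite_subset[OF _ finite_box[of "step_range * k"]]) (use heat_support in auto)

text \<open>Each \<open>heat k\<close> has finite support, so a series weighted by a translate of it
  has only finitely many nonzero terms, whatever the other factor.\<close>

lemma heat_summable: "(\<lambda>x. heat k (x + a) * f x) summable_on UNIV"
proof (rule finite_nonzero_values_imp_summable_on)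
  have "{x. heat k (x + a) \<noteq> 0} = (\<lambda>x. x - a) ` {x. heat k x \<noteq> 0}"
    by (force simp: image_iff)
  then have "finite {x. heat k (x + a) \<noteq> 0}" using finite_heat by simp
  then show "finite {x \<in> UNIV. heat k (x + a) * f x \<noteq> 0}"
    by (rule rev_finite_subset) auto
qed

end

lemma infsum_translate: "(\<Sum>\<^sub>\<infinity>x. f (x + a)) = (\<Sum>\<^sub>\<infinity>x::int ^ 'd. f x)"
  by (rule infsum_reindex_bij_betw) (rule bij_betwI[of _ _ _ "\<lambda>x. x - a"], auto)

lemma infsum_minus: "(\<Sum>\<^sub>\<infinity>x. f (- x)) = (\<Sum>\<^sub>\<infinity>x::int ^ 'd. f x)"
  by (rule infsum_reindex_bij_betw) (rule bij_betwI[of _ _ _ uminus], auto)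

lemma infsum_finite_sum:
  fixes f :: "'b \<Rightarrow> 'a \<Rightarrow> real"
  assumes "\<And>i. i \<in> F \<Longrightarrow> f i summable_on A"
  shows "(\<Sum>\<^sub>\<infinity>x\<in>A. \<Sum>i\<in>F. f i x) = (\<Sum>i\<in>F. \<Sum>\<^sub>\<infinity>x\<in>A. f i x)"
proof -
  have "((\<lambda>x. \<Sum>i\<in>F. f i x) has_sum (\<Sum>i\<in>F. \<Sum>\<^sub>\<infinity>x\<in>A. f i x)) A"
    using assms by (induction F rule: infinite_finite_induct) (auto intro!: has_sum_add)
  then show ?thesis by (rule infsumI)
qed

lemma (in harness_matrix) heat_sum_le_1: "finite F \<Longrightarrow> (\<Sum>x\<in>F. heat k x) \<le> 1"
proof (induction k arbitrary: F)
  case 0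
  then show ?case by (auto simp: sum.delta' cong: if_cong)
next
  case (Suc k)
  have "(\<Sum>x\<in>F. heat (Suc k) x) = (\<Sum>z\<in>steps. p 0 z * (\<Sum>x\<in>F. heat k (x - z)))"
    by (simp add: sum_distrib_left) (rule sum.swap)
  also have "\<dots> = (\<Sum>z\<in>steps. p 0 z * (\<Sum>x\<in>(\<lambda>x. x - z) ` F. heat k x))"
    by (subst sum.reindex) auto
  also have "\<dots> \<le> (\<Sum>z\<in>steps. p 0 z * 1)"
    by (intro sum_mono mult_left_mono Suc nonneg) (use Suc.prems in auto)
  finally show ?case by (simp add: sum_steps)
qed

context harness_matrix
begin

lemma heat_le_1: "heat k x \<le> 1"
  using heat_sum_le_1[of "{x}" k] by simp

text \<open>Chapman-Kolmogorov, by induction on the first time. Translating the summation variable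
  by the first step \<open>s\<close> turns the terms of \<open>heat m\<close> into those of
  \<open>heat (Suc m)\<close>.\<close>

lemma heat_semigroup: "heat (m + k) x = (\<Sum>\<^sub>\<infinity>z. heat m z * heat k (x - z))"
proof (induction m arbitrary: x)
  case 0
  have "(\<Sum>\<^sub>\<infinity>z. heat 0 z * heat k (x - z)) = (\<Sum>\<^sub>\<infinity>z\<in>{0}. heat 0 z * heat k (x - z))"
    by (rule infsum_cong_neutral) auto
  then show ?case by simp
next
  case (Suc m)
  have "heat (Suc m + k) x = (\<Sum>s\<in>steps. p 0 s * (\<Sum>\<^sub>\<infinity>z. heat m z * heat k (x - s - z)))"
    using Suc by simp
  also have "\<dots> = (\<Sum>s\<in>steps. p 0 s * (\<Sum>\<^sub>\<infinity>z. heat m (z + - s) * heat k (x - s - (z + - s))))"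
    by (subst infsum_translate) simp
  also have "\<dots> = (\<Sum>s\<in>steps. \<Sum>\<^sub>\<infinity>z. p 0 s * (heat m (z + - s) * heat k (x - z)))"
    by (simp add: infsum_cmult_right')
  also have "\<dots> = (\<Sum>\<^sub>\<infinity>z. \<Sum>s\<in>steps. p 0 s * (heat m (z + - s) * heat k (x - z)))"
    by (rule infsum_finite_sum[symmetric]) (intro summable_on_cmult_right heat_summable)
  also have "\<dots> = (\<Sum>\<^sub>\<infinity>z. heat (Suc m) z * heat k (x - z))"
    by (simp add: sum_distrib_right mult.assoc)
  finally show ?case .
qed

text \<open>By reflection symmetry the convolution becomes a correlation: the transition probability
  at an even time is the inner product of \<open>heat k\<close> with its translate by
  \<open>z\<close>.\<close>

lemma heat_double: "heat (2 * k) z = (\<Sum>\<^sub>\<infinity>x. heat k x * heat k (x + z))"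
proof -
  have "heat (2 * k) z = (\<Sum>\<^sub>\<infinity>x. heat k x * heat k (z - x))"
    using heat_semigroup[of k k z] by (simp add: mult_2)
  also have "\<dots> = (\<Sum>\<^sub>\<infinity>x. heat k (- x) * heat k (z - - x))"
    by (rule infsum_minus[symmetric])
  also have "\<dots> = (\<Sum>\<^sub>\<infinity>x. heat k x * heat k (x + z))"
    by (simp add: heat_minus add.commute)
  finally show ?thesis .
qed

section \<open>Increments of the transition probabilities at even times\<close>

definition gap :: "nat \<Rightarrow> int ^ 'd \<Rightarrow> real" where
  "gap k z = heat (2 * k) 0 - heat (2 * k) z"

lemma diff_heat_summable:
  "(\<lambda>x. (heat k (x + a) - heat k (x + b))\<^sup>2) summable_on UNIV"
proof -
  have "(\<lambda>x. heat k (x + a) * (heat k (x + a) - heat k (x + b)) +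
      heat k (x + b) * (heat k (x + b) - heat k (x + a))) summable_on UNIV"
    by (intro summable_on_add heat_summable)
  then show ?thesis by (rule summable_on_cong[THEN iffD1, rotated]) (simp add: power2_eq_square algebra_simps)
qed

text \<open>Expanding the square gives two squared norms, equal by translation, and a cross term;
  \<open>heat_double\<close> identifies both.\<close>

lemma gap_eq: "gap k z = (\<Sum>\<^sub>\<infinity>x. (heat k x - heat k (x + z))\<^sup>2) / 2"
proof -
  note s = heat_summable[of k 0, simplified]
  have "(\<Sum>\<^sub>\<infinity>x. (heat k x - heat k (x + z))\<^sup>2) =
     (\<Sum>\<^sub>\<infinity>x. heat k x * heat k x + heat k (x + z) * heat k (x + z) + heat k x * (- 2 * heat k (x + z)))"
    by (rule infsum_cong) (simp add: power2_eq_square algebra_simps)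
  also have "\<dots> = (\<Sum>\<^sub>\<infinity>x. heat k x * heat k x) + (\<Sum>\<^sub>\<infinity>x. heat k (x + z) * heat k (x + z))
      + (\<Sum>\<^sub>\<infinity>x. heat k x * (- 2 * heat k (x + z)))"
    by (subst infsum_add infsum_add, (intro summable_on_add s heat_summable)+)+ simp
  also have "(\<Sum>\<^sub>\<infinity>x. heat k (x + z) * heat k (x + z)) = (\<Sum>\<^sub>\<infinity>x. heat k x * heat k x)"
    by (rule infsum_translate)
  also have "(\<Sum>\<^sub>\<infinity>x. heat k x * heat k x) = heat (2 * k) 0" using heat_double[of k 0] by simp
  also have "(\<Sum>\<^sub>\<infinity>x. heat k x * (- 2 * heat k (x + z))) = - 2 * heat (2 * k) z"
    unfolding heat_double by (subst infsum_cmult_right'[symmetric]) (simp add: mult_ac)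
  finally show ?thesis by (simp add: gap_def)
qed

lemma gap_nonneg: "gap k z \<ge> 0"
  unfolding gap_eq by (simp add: infsum_nonneg)

text \<open>The triangle inequality for the square root of \<open>gap\<close>, in a form free of
  roots and with a parameter to be chosen. At each site the two sides differ by a square divided by
  \<open>t\<close>.\<close>

lemma gap_add:
  assumes t: "t > 0"
  shows "gap k (a + b) \<le> (1 + t) * gap k a + (1 + 1 / t) * gap k b"
proof -
  have pw: "(u - w)\<^sup>2 \<le> (1 + t) * (u - v)\<^sup>2 + (1 + 1 / t) * (v - w)\<^sup>2" for u v w :: real
  proof -
    have "(1 + t) * (u - v)\<^sup>2 + (1 + 1 / t) * (v - w)\<^sup>2 - (u - w)\<^sup>2 = (t * (u - v) - (v - w))\<^sup>2 / t"
      using t by (simp add: field_simps power2_eq_square)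
    also have "\<dots> \<ge> 0" using t by simp
    finally show ?thesis by simp
  qed
  note s0 = diff_heat_summable[of k 0, simplified]
  have "(\<Sum>\<^sub>\<infinity>x. (heat k x - heat k (x + (a + b)))\<^sup>2) \<le>
     (\<Sum>\<^sub>\<infinity>x. (1 + t) * (heat k x - heat k (x + a))\<^sup>2 + (1 + 1 / t) * (heat k (x + a) - heat k (x + (a + b)))\<^sup>2)"
    by (rule infsum_mono) (intro s0 summable_on_add summable_on_cmult_right diff_heat_summable pw)+
  also have "\<dots> = (1 + t) * (\<Sum>\<^sub>\<infinity>x. (heat k x - heat k (x + a))\<^sup>2) +
     (1 + 1 / t) * (\<Sum>\<^sub>\<infinity>x. (heat k (x + a) - heat k (x + (a + b)))\<^sup>2)"
    by (subst infsum_add) (intro s0 summable_on_cmult_right diff_heat_summable | simp add: infsum_cmult_right')+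
  also have "(\<Sum>\<^sub>\<infinity>x. (heat k (x + a) - heat k (x + (a + b)))\<^sup>2) = (\<Sum>\<^sub>\<infinity>x. (heat k x - heat k (x + b))\<^sup>2)"
    using infsum_translate[of "\<lambda>x. (heat k x - heat k (x + b))\<^sup>2" a] by (simp add: add.assoc)
  finally show ?thesis unfolding gap_eq by (simp add: field_simps)
qed

lemma gap_0 [simp]: "gap k 0 = 0"
  by (simp add: gap_def)

lemma gap_mult: "gap k (int n *s y) \<le> (real n)\<^sup>2 * gap k y"
proof (induction n)
  case 0
  then show ?case by simp
next
  case (Suc n)
  show ?case
  proof (cases "n = 0")
    case False
    have "gap k (int (Suc n) *s y) = gap k (int n *s y + y)"
      by (rule arg_cong[of _ _ "gap k"]) (simp add: vec_eq_iff algebra_simps)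
    \<comment> \<open>With \<open>t = 1 / n\<close> the induction hypothesis contributes
      \<open>n^2 + n\<close> and the new summand \<open>n + 1\<close>, in total
      \<open>(n + 1)^2\<close>.\<close>
    also have "\<dots> \<le> (1 + 1 / real n) * gap k (int n *s y) + (1 + 1 / (1 / real n)) * gap k y"
      by (rule gap_add) (use False in simp)
    also have "\<dots> \<le> (1 + 1 / real n) * ((real n)\<^sup>2 * gap k y) + (1 + 1 / (1 / real n)) * gap k y"
      by (intro add_right_mono mult_left_mono Suc) auto
    also have "\<dots> = (real (Suc n))\<^sup>2 * gap k y"
      using False by (simp add: field_simps power2_eq_square)
    finally show ?thesis .
  qed simp
qed

lemma gap_sum:
  assumes "finite F"
  shows "gap k (\<Sum>y\<in>F. f y) \<le> real (card F) * (\<Sum>y\<in>F. gap k (f y))"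
  using assms
proof induction
  case empty
  then show ?case by simp
next
  case (insert x F)
  show ?case
  proof (cases "F = {}")
    case False
    then have c: "real (card F) > 0" using insert by (simp add: card_gt_0_iff)
    \<comment> \<open>Taking \<open>t = card F\<close> gives both terms the common factor
      \<open>card F + 1\<close>.\<close>
    have "gap k (f x + (\<Sum>y\<in>F. f y)) \<le> (1 + real (card F)) * gap k (f x) +
        (1 + 1 / real (card F)) * gap k (\<Sum>y\<in>F. f y)"
      by (rule gap_add) (rule c)
    also have "\<dots> \<le> (1 + real (card F)) * gap k (f x) +
        (1 + 1 / real (card F)) * (real (card F) * (\<Sum>y\<in>F. gap k (f y)))"
      by (intro add_left_mono mult_left_mono insert) auto
    also have "\<dots> = real (card (insert x F)) * (\<Sum>y\<in>insert x F. gap k (f y))"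
      using c insert by (simp add: field_simps)
    finally show ?thesis using insert by simp
  qed simp
qed

text \<open>After embedding the lattice in \<open>real ^ 'd\<close>, generation as a group becomes
  spanning, so the steps contain a basis. Its linear independence over the reals is used only for
  integer coefficients, to make the points of a box distinct.\<close>

lemma steps_basis:
  obtains B where "B \<subseteq> steps" "finite B" "card B = CARD('d)"
    "\<And>c c'. (\<Sum>y\<in>B. c y *s y) = (\<Sum>y\<in>B. c' y *s y) \<Longrightarrow> \<forall>y\<in>B. c y = (c' y :: int)"
proof -
  define e :: "int ^ 'd \<Rightarrow> real ^ 'd" where "e z = (\<chi> k. real_of_int (z $ k))" for z
  have inj: "inj e" by (auto simp: inj_def e_def vec_eq_iff)
  have "e z \<in> span (e ` steps)" if "z \<in> group_closure steps" for z
    using that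
  proof induction
    case (base s)
    have "e 0 = 0" by (simp add: e_def vec_eq_iff)
    with base show ?case by (auto intro: span_base span_zero)
  next
    case (diff s t)
    have "e (s - t) = e s - e t" by (simp add: e_def vec_eq_iff)
    with diff show ?case by (simp add: span_diff)
  qed
  then have "e z \<in> span (e ` steps)" for z
    using truly_d_dimensional unfolding steps_def by blast
  moreover have "axis k 1 = e (axis k 1)" for k by (simp add: e_def vec_eq_iff axis_def)
  ultimately have "Basis \<subseteq> span (e ` steps)" by (auto simp: Basis_vec_def)
  then have "span Basis \<subseteq> span (e ` steps)" by (metis span_minimal subspace_span)
  then have "span (e ` steps) = UNIV" by auto
  then have dim: "dim (e ` steps) = CARD('d)" by (metis dim_span dim_UNIV DIM_cart DIM_real mult.right_neutral)
  obtain B' where B': "B' \<subseteq> e ` steps" "independent B'" "card B' = dim (e ` steps)"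
    using basis_exists by metis
  define B where "B = e -` B'"
  have eB: "e ` B = B'" using B'(1) by (auto simp: B_def)
  have "B \<subseteq> steps" using B'(1) inj by (auto simp: B_def inj_def)
  moreover have fin: "finite B" using calculation finite_steps finite_subset by blast
  moreover have "card B = CARD('d)" using eB B'(3) dim card_image[of e B] inj
    by (metis inj_on_subset subset_UNIV)
  moreover have "\<forall>y\<in>B. c y = c' y"
    if eq: "(\<Sum>y\<in>B. c y *s y) = (\<Sum>y\<in>B. c' y *s y)" for c c' :: "int ^ 'd \<Rightarrow> int"
  proof -
    have fc: "e (\<Sum>y\<in>B. c y *s y) = (\<Sum>y\<in>B. real_of_int (c y) *\<^sub>R e y)" for c
      by (simp add: e_def vec_eq_iff)
    have "(\<Sum>v\<in>B'. real_of_int (c (the_inv e v) - c' (the_inv e v)) *\<^sub>R v) =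
       (\<Sum>y\<in>B. real_of_int (c y - c' y) *\<^sub>R e y)"
      unfolding eB[symmetric]
      by (subst sum.reindex) (use inj in \<open>auto simp: the_inv_f_f intro: inj_on_subset\<close>)
    also have "\<dots> = 0" using fc[of c] fc[of c'] eq by (simp add: algebra_simps sum_subtractf)
    finally have "(\<Sum>v\<in>B'. real_of_int (c (the_inv e v) - c' (the_inv e v)) *\<^sub>R v) = 0" .
    moreover have "finite B'" using fin eB by blast
    ultimately have *: "real_of_int (c (the_inv e v) - c' (the_inv e v)) = 0" if "v \<in> B'" for v
      using independentD[OF B'(2) _ subset_refl,
          where u = "\<lambda>v. real_of_int (c (the_inv e v) - c' (the_inv e v))"] that by blast
    show ?thesis
    proof
      fix y assume "y \<in> B"
      then have "e y \<in> B'" using eB by blast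
      from *[OF this] show "c y = c' y" using inj by (simp add: the_inv_f_f)
    qed
  qed
  ultimately show ?thesis by (rule that)
qed

text \<open>Two more steps replace the return probability by the average of
  \<open>heat (2 * k)\<close> over the displacements \<open>z + z'\<close>. The weights sum to one,
  so the loss is an average of gaps.\<close>

lemma heat_Suc_Suc:
  "heat (2 * k) 0 - heat (2 * Suc k) 0 = (\<Sum>z\<in>steps. \<Sum>z'\<in>steps. p 0 z * p 0 z' * gap k (z + z'))"
proof -
  have "heat (2 * Suc k) 0 = (\<Sum>z\<in>steps. \<Sum>z'\<in>steps. p 0 z * p 0 z' * heat (2 * k) (- (z + z')))"
    by (simp add: sum_distrib_left mult.assoc)
  also have "\<dots> = (\<Sum>z\<in>steps. \<Sum>z'\<in>steps. p 0 z * p 0 z' * heat (2 * k) (z + z'))"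
    by (simp only: heat_minus)
  moreover have "heat (2 * k) 0 = (\<Sum>z\<in>steps. \<Sum>z'\<in>steps. p 0 z * p 0 z' * heat (2 * k) 0)"
    by (simp add: sum_distrib_right[symmetric] sum_distrib_left[symmetric] sum_steps)
  ultimately show ?thesis unfolding gap_def
    by (simp add: right_diff_distrib sum_subtractf)
qed

text \<open>All terms of the average are nonnegative, and only the one with both steps equal to
  \<open>y\<close> is kept. Doubled steps suit periodic walks, for which \<open>gap k y\<close> at a
  single step can be as large as the return probability itself.\<close>

lemma heat_decrement:
  assumes "y \<in> steps"
  shows "(p 0 y)\<^sup>2 * gap k (y + y) \<le> heat (2 * k) 0 - heat (2 * Suc k) 0"
proof -
  have "p 0 y * p 0 y * gap k (y + y) \<le> (\<Sum>z'\<in>steps. p 0 y * p 0 z' * gap k (y + z'))"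
    by (rule member_le_sum[OF assms]) (auto simp: nonneg gap_nonneg finite_steps)
  also have "\<dots> \<le> (\<Sum>z\<in>steps. \<Sum>z'\<in>steps. p 0 z * p 0 z' * gap k (z + z'))"
    by (rule member_le_sum[OF assms, of "\<lambda>z. \<Sum>z'\<in>steps. p 0 z * p 0 z' * gap k (z + z')"])
      (auto simp: nonneg gap_nonneg finite_steps intro!: sum_nonneg)
  finally show ?thesis unfolding heat_Suc_Suc by (simp add: power2_eq_square)
qed

text \<open>A step \<open>y\<close> followed by \<open>- y\<close> leads back to the origin with
  positive probability.\<close>

lemma heat_even_pos: "heat (2 * k) 0 > 0"
proof (induction k)
  case (Suc k)
  obtain y where y: "y \<in> steps" using sum_steps by fastforce
  have "heat (2 * Suc k) 0 = (\<Sum>z\<in>steps. p 0 z * (\<Sum>z'\<in>steps. p 0 z' * heat (2 * k) (- z - z')))"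
    by simp
  also have "\<dots> \<ge> p 0 y * (\<Sum>z'\<in>steps. p 0 z' * heat (2 * k) (- y - z'))"
    by (rule member_le_sum[OF y, of "\<lambda>z. p 0 z * (\<Sum>z'\<in>steps. p 0 z' * heat (2 * k) (- z - z'))"])
      (auto simp: nonneg heat_nonneg finite_steps intro!: sum_nonneg mult_nonneg_nonneg)
  also have "(\<Sum>z'\<in>steps. p 0 z' * heat (2 * k) (- y - z')) \<ge> p 0 (- y) * heat (2 * k) (- y - (- y))"
    by (rule member_le_sum) (use y in \<open>auto simp: uminus_steps nonneg heat_nonneg finite_steps\<close>)
  moreover have "p 0 y > 0" using y nonneg[of 0 y] by (auto simp: steps_def)
  ultimately show ?case using Suc p_minus[of y] nonneg
    by (smt (verit, best) cancel_comm_monoid_add_class.diff_cancel mult_left_mono mult_pos_pos)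
qed simp

text \<open>At each of the \<open>r ^ d\<close> points of a box the return probability is the sum of
  a gap and a transition probability; average this over the box. The transition probabilities sum to
  at most one, whence \<open>1 / r ^ d\<close>. The gaps cost \<open>r^2\<close> for the length of
  an edge (\<open>gap_mult\<close>) and \<open>d^2\<close> for the number of directions
  (\<open>gap_sum\<close>).\<close>

lemma heat_averaged:
  obtains C where "C > 0"
    "\<And>k r. r \<ge> 1 \<Longrightarrow> heat (2 * k) 0 \<le>
       C * (real r)\<^sup>2 * (heat (2 * k) 0 - heat (2 * Suc k) 0) + 1 / real r ^ CARD('d)"
proof -
  obtain B where B: "B \<subseteq> steps" "finite B" "card B = CARD('d)"
    "\<And>c c'. (\<Sum>y\<in>B. c y *s y) = (\<Sum>y\<in>B. c' y *s y) \<Longrightarrow> \<forall>y\<in>B. c y = (c' y :: int)"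
    using steps_basis by blast
  define d where "d = real CARD('d)"
  \<comment> \<open>The least squared step probability over \<open>B\<close>, so that one bound
    \<open>D\<close> serves all basis steps.\<close>
  define c where "c = Min ((\<lambda>y. (p 0 y)\<^sup>2) ` B)"
  have "B \<noteq> {}" using B(3) by auto
  then have "c \<in> (\<lambda>y. (p 0 y)\<^sup>2) ` B" unfolding c_def using B(2) by (intro Min_in) auto
  then have c: "c > 0" using B(1) by (auto simp: steps_def)
  have c_le: "c \<le> (p 0 y)\<^sup>2" if "y \<in> B" for y using that B(2) by (simp add: c_def)
  have "heat (2 * k) 0 \<le> (d\<^sup>2 / c) * (real r)\<^sup>2 * (heat (2 * k) 0 - heat (2 * Suc k) 0) + 1 / real r ^ CARD('d)"
    if r: "r \<ge> 1" for k r :: nat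
  proof -
    define D where "D = (heat (2 * k) 0 - heat (2 * Suc k) 0) / c"
    have D: "gap k (y + y) \<le> D" if "y \<in> B" for y
    proof -
      have "c * gap k (y + y) \<le> (p 0 y)\<^sup>2 * gap k (y + y)"
        by (intro mult_right_mono c_le that gap_nonneg)
      also have "\<dots> \<le> heat (2 * k) 0 - heat (2 * Suc k) 0"
        by (rule heat_decrement) (use that B in auto)
      finally show ?thesis using c by (simp add: D_def pos_le_divide_eq mult.commute)
    qed
    define Q where "Q = PiE B (\<lambda>_. {..<r})"
    \<comment> \<open>The edges are doubled steps because \<open>heat_decrement\<close> controls
      exactly these.\<close>
    define P where "P n = (\<Sum>y\<in>B. int (n y) *s (y + y))" for n
    have Q: "finite Q" "card Q = r ^ CARD('d)"
      using B by (auto simp: Q_def card_PiE finite_PiE)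
    have "inj_on P Q"
    proof (rule inj_onI)
      fix n n' assume *: "n \<in> Q" "n' \<in> Q" "P n = P n'"
      have P': "P n = (\<Sum>y\<in>B. (2 * int (n y)) *s y)" for n
        unfolding P_def by (rule sum.cong) (auto simp: vec_eq_iff algebra_simps)
      have "\<forall>y\<in>B. 2 * int (n y) = 2 * int (n' y)" using *(3) unfolding P' by (rule B(4))
      then show "n = n'" using * unfolding Q_def by (intro PiE_ext[OF *(1,2)[unfolded Q_def]]) auto
    qed
    then have heat_le: "(\<Sum>n\<in>Q. heat (2 * k) (P n)) \<le> 1"
      using heat_sum_le_1[of "P ` Q" "2 * k"] Q by (simp add: sum.reindex)
    have gap_le: "gap k (P n) \<le> d\<^sup>2 * (real r)\<^sup>2 * D" if "n \<in> Q" for n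
    proof -
      have "gap k (P n) \<le> d * (\<Sum>y\<in>B. gap k (int (n y) *s (y + y)))"
        unfolding P_def d_def B(3)[symmetric] by (rule gap_sum) (rule B)
      also have "\<dots> \<le> d * (\<Sum>y\<in>B. (real r)\<^sup>2 * D)"
      proof (intro mult_left_mono sum_mono)
        fix y assume y: "y \<in> B"
        have "gap k (int (n y) *s (y + y)) \<le> (real (n y))\<^sup>2 * gap k (y + y)" by (rule gap_mult)
        also have "\<dots> \<le> (real r)\<^sup>2 * D"
          using that y D[OF y] by (intro mult_mono gap_nonneg power_mono) (auto simp: Q_def PiE_iff)
        finally show "gap k (int (n y) *s (y + y)) \<le> (real r)\<^sup>2 * D" .
      qed (simp add: d_def)
      finally show ?thesis using B(3) by (simp add: d_def power2_eq_square mult.assoc)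
    qed
    have "real r ^ CARD('d) * heat (2 * k) 0 = (\<Sum>n\<in>Q. gap k (P n) + heat (2 * k) (P n))"
      using Q by (simp add: gap_def)
    also have "\<dots> \<le> (\<Sum>n\<in>Q. d\<^sup>2 * (real r)\<^sup>2 * D) + 1"
      unfolding sum.distrib by (intro add_mono sum_mono gap_le heat_le)
    also have "\<dots> = real r ^ CARD('d) * (d\<^sup>2 * (real r)\<^sup>2 * D) + 1"
      using Q by simp
    finally have "real r ^ CARD('d) * heat (2 * k) 0 \<le> real r ^ CARD('d) * (d\<^sup>2 * (real r)\<^sup>2 * D) + 1" .
    moreover have rp: "real r ^ CARD('d) > 0" using r by simp
    ultimately have "heat (2 * k) 0 \<le> d\<^sup>2 * (real r)\<^sup>2 * D + 1 / real r ^ CARD('d)"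
      by (simp add: field_simps)
    then show ?thesis by (simp add: D_def)
  qed
  then show ?thesis using c by (intro that[of "d\<^sup>2 / c"]) (auto simp: d_def)
qed

end

text \<open>A discrete version of the differential inequality u' \<le> - c u^(1+a), which makes
  u^(-a) grow at least linearly. A Bernoulli inequality for the exponent \<open>- a\<close> shows
  growth by at least \<open>a * c\<close> per step; the cap 1 in \<open>m\<close> covers the start,
  where u^(-a) is only known to be at least 1.\<close>

lemma decay_of_decrement:
  fixes u :: "nat \<Rightarrow> real"
  assumes c: "c > 0" and a: "a > 0"
    and pos: "\<And>k. u k > 0" and le1: "\<And>k. u k \<le> 1"
    and dec: "\<And>k. u k - u (Suc k) \<ge> c * u k powr (1 + a)"
  obtains C where "C > 0" "\<And>k. u k \<le> C * real (Suc k) powr (- 1 / a)"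
proof -
  define m where "m = min 1 (a * c)"
  have m: "m > 0" using a c by (simp add: m_def)
  have inv: "u k powr (- a) \<ge> m * real (Suc k)" for k
  proof (induction k)
    case 0
    have "u 0 powr (- a) \<ge> 1" using pos[of 0] le1[of 0] a
      by (simp add: powr_minus powr_le1 one_le_inverse_iff)
    then show ?case by (simp add: m_def min.coboundedI1)
  next
    case (Suc k)
    define t where "t = c * u k powr a"
    have "u (Suc k) \<le> u k - c * u k powr (1 + a)" using dec[of k] by simp
    also have "\<dots> = u k * (1 - t)" using pos[of k] by (simp add: t_def powr_add algebra_simps)
    finally have le: "u (Suc k) \<le> u k * (1 - t)" .
    have t0: "t \<ge> 0" using c by (simp add: t_def)
    \<comment> \<open>Positivity of the next term keeps the relative decrement \<open>t\<close>
      below one, so that \<open>ln (1 - t)\<close> makes sense.\<close>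
    have t1: "t < 1" using le pos[of "Suc k"] pos[of k]
      by (metis diff_gt_0_iff_gt order_less_le_trans zero_less_mult_pos)
    have "1 + a * t \<le> 1 + - a * ln (1 - t)"
      using mult_left_mono[OF ln_le_minus_one[of "1 - t"], of a] t1 a by simp
    also have "\<dots> \<le> exp (- a * ln (1 - t))" using exp_ge_add_one_self by blast
    also have "\<dots> = (1 - t) powr (- a)" using t1 by (simp add: powr_def)
    finally have "1 + a * t \<le> (1 - t) powr (- a)" .
    then have "u k powr (- a) * (1 + a * t) \<le> u k powr (- a) * (1 - t) powr (- a)"
      by (intro mult_left_mono) auto
    also have "\<dots> = (u k * (1 - t)) powr (- a)" using t1 pos[of k] by (simp add: powr_mult)
    also have "\<dots> \<le> u (Suc k) powr (- a)" using le pos[of "Suc k"] a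
      by (intro powr_mono2') auto
    finally have "u (Suc k) powr (- a) \<ge> u k powr (- a) + a * c * (u k powr (- a) * u k powr a)"
      by (simp add: t_def algebra_simps)
    moreover have "u k powr (- a) * u k powr a = 1" using pos[of k] by (simp add: powr_add[symmetric])
    moreover have "m \<le> a * c" by (simp add: m_def)
    ultimately show ?case using Suc by (simp add: algebra_simps)
  qed
  have "u k \<le> m powr (- 1 / a) * real (Suc k) powr (- 1 / a)" for k
  proof -
    have "u k = (u k powr (- a)) powr (- 1 / a)" using pos[of k] a by (simp add: powr_powr)
    also have "\<dots> \<le> (m * real (Suc k)) powr (- 1 / a)"
      using inv[of k] m a by (intro powr_mono2') auto
    also have "\<dots> = m powr (- 1 / a) * real (Suc k) powr (- 1 / a)" using m by (simp add: powr_mult)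
    finally show ?thesis .
  qed
  then show ?thesis using that[of "m powr (- 1 / a)"] m by simp
qed

context harness_matrix
begin

lemma heat_le_even: "heat (2 * k) x \<le> heat (2 * k) 0"
  using gap_nonneg[of k x] by (simp add: gap_def)

text \<open>If \<open>r ^ d\<close> is about \<open>2 / u k\<close>, the remainder in
  \<open>heat_averaged\<close> is at most half of \<open>u k\<close>. The decrement is then at least
  of order \<open>u k powr (1 + 2 / d)\<close>, and \<open>decay_of_decrement\<close> with
  \<open>a = 2 / d\<close> gives the decay at even times. Averaging over one more step extends it to
  odd times.\<close>

lemma heat_kernel_bound:
  obtains C where "C \<ge> 1" "\<And>k x. heat k x \<le> C * real (Suc k) powr (- real CARD('d) / 2)"
proof -
  define d where "d = real CARD('d)"
  have d: "d > 0" by (simp add: d_def)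
  define u where "u k = heat (2 * k) 0" for k
  have pos: "u k > 0" for k using heat_even_pos by (simp add: u_def)
  have le1: "u k \<le> 1" for k by (simp add: u_def heat_le_1)
  obtain K where K: "K > 0" "\<And>k r. r \<ge> 1 \<Longrightarrow> u k \<le>
       K * (real r)\<^sup>2 * (u k - u (Suc k)) + 1 / real r ^ CARD('d)"
    using heat_averaged unfolding u_def by metis
  define c where "c = 1 / (8 * K * 2 powr (2 / d))"
  have c: "c > 0" using K by (simp add: c_def)
  have dec: "u k - u (Suc k) \<ge> c * u k powr (1 + 2 / d)" for k
  proof -
    define s where "s = (2 / u k) powr (1 / d)"
    have s1: "s \<ge> 1" using pos[of k] le1[of k] d unfolding s_def
      by (intro ge_one_powr_ge_zero) (auto simp: field_simps)
    define r where "r = nat \<lceil>s\<rceil>"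
    have r: "r \<ge> 1" "real r \<ge> s" "real r \<le> 2 * s" using s1 unfolding r_def by linarith+
    have "2 / u k = s powr d" using pos[of k] d by (simp add: s_def powr_powr)
    also have "\<dots> = s ^ CARD('d)" using s1 by (simp add: d_def powr_realpow)
    also have "\<dots> \<le> real r ^ CARD('d)" using r s1 by (intro power_mono) auto
    finally have "1 / real r ^ CARD('d) \<le> u k / 2" using pos[of k] r by (simp add: field_simps)
    with K(2)[OF r(1), of k] have "u k / 2 \<le> K * (real r)\<^sup>2 * (u k - u (Suc k))" by linarith
    also have "\<dots> \<le> K * (2 * s)\<^sup>2 * (u k - u (Suc k))"
    proof (intro mult_right_mono mult_left_mono power_mono)
      have "0 \<le> (\<Sum>z\<in>steps. \<Sum>z'\<in>steps. p 0 z * p 0 z' * gap k (z + z'))"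
        by (intro sum_nonneg mult_nonneg_nonneg nonneg gap_nonneg)
      then show "0 \<le> u k - u (Suc k)" unfolding u_def heat_Suc_Suc .
    qed (use r K in auto)
    also have "(2 * s)\<^sup>2 = 4 * (2 powr (2 / d) * u k powr (- 2 / d))"
    proof -
      have "s\<^sup>2 = s powr 2" using s1 by simp
      also have "\<dots> = (2 / u k) powr (2 / d)" by (simp add: s_def powr_powr)
      also have "\<dots> = 2 powr (2 / d) * u k powr (- 2 / d)"
        using pos[of k] by (simp add: powr_divide powr_minus field_simps)
      finally show ?thesis by (simp add: power_mult_distrib)
    qed
    finally have "u k / 2 * u k powr (2 / d) \<le>
        K * (4 * (2 powr (2 / d) * u k powr (- 2 / d))) * (u k - u (Suc k)) * u k powr (2 / d)"
      by (rule mult_right_mono) simp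
    also have "\<dots> = K * (4 * 2 powr (2 / d)) * (u k - u (Suc k)) * (u k powr (- 2 / d) * u k powr (2 / d))"
      by (simp add: mult_ac)
    also have "u k powr (- 2 / d) * u k powr (2 / d) = 1"
      using pos[of k] by (simp add: powr_add[symmetric])
    also have "u k / 2 * u k powr (2 / d) = u k powr (1 + 2 / d) / 2"
      using pos[of k] by (simp add: powr_add)
    finally show ?thesis using K by (simp add: c_def field_simps)
  qed
  obtain C where C: "C > 0" "\<And>k. u k \<le> C * real (Suc k) powr (- 1 / (2 / d))"
    using decay_of_decrement[of c "2 / d" u, OF c _ pos le1 dec] d by auto
  \<comment> \<open>The factor \<open>2 powr (d / 2)\<close> pays for passing from
    \<open>k div 2\<close> to \<open>k\<close>.\<close>
  define C' where "C' = max 1 (C * 2 powr (d / 2))"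
  have "heat k x \<le> C' * real (Suc k) powr (- d / 2)" for k x
  proof -
    define j where "j = k div 2"
    have "heat k x \<le> u j"
    proof (cases "even k")
      case True
      then show ?thesis using heat_le_even[of j x] by (simp add: j_def u_def)
    next
      case False
      then have k: "k = Suc (2 * j)" by (simp add: j_def)
      have "heat k x \<le> (\<Sum>z\<in>steps. p 0 z * u j)" unfolding k heat.simps u_def
        by (intro sum_mono mult_left_mono heat_le_even nonneg)
      then show ?thesis by (simp add: sum_distrib_right[symmetric] sum_steps)
    qed
    also have "\<dots> \<le> C * real (Suc j) powr (- d / 2)" using C(2)[of j] by simp
    also have "\<dots> \<le> C * (real (Suc k) / 2) powr (- d / 2)"
    proof (intro mult_left_mono powr_mono2')
      have "Suc k \<le> 2 * Suc j" unfolding j_def by presburger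
      then have "real (Suc k) \<le> real (2 * Suc j)" by (rule of_nat_mono)
      then show "real (Suc k) / 2 \<le> real (Suc j)" by simp
    qed (use C d in auto)
    also have "\<dots> = C * 2 powr (d / 2) * real (Suc k) powr (- d / 2)"
      by (simp add: powr_divide powr_minus field_simps)
    also have "\<dots> \<le> C' * real (Suc k) powr (- d / 2)"
      by (intro mult_right_mono) (auto simp: C'_def)
    finally show ?thesis .
  qed
  then show ?thesis using that[of C'] by (simp add: C'_def d_def)
qed

end

section \<open>Power sums of the heat kernel\<close>

text \<open>Stands in for the comparison of a sum with an integral, since the right side telescopes.
  Division by \<open>real (Suc k) powr r\<close> reduces the claim to weighted arithmetic and
  geometric means of \<open>k / (k + 1)\<close> and 1.\<close>

lemma powr_diff_ge:
  fixes r :: real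
  assumes "0 < r" "r \<le> 1"
  shows "r * real (Suc k) powr (r - 1) \<le> real (Suc k) powr r - real k powr r"
proof (cases "k = 0")
  case True
  then show ?thesis using assms by simp
next
  case False
  then have k: "real k > 0" by simp
  define u where "u = real k / real (Suc k)"
  have u: "u > 0" "u = 1 - 1 / real (Suc k)" using k by (auto simp: u_def field_simps)
  have "u powr r * 1 powr (1 - r) \<le> r * u + (1 - r) * 1"
    by (rule Youngs_inequality_0) (use assms u in auto)
  then have "u powr r \<le> 1 - r / real (Suc k)" by (simp add: u(2) algebra_simps)
  then have "real (Suc k) powr r * u powr r \<le> real (Suc k) powr r * (1 - r / real (Suc k))"
    by (intro mult_left_mono) auto
  moreover have "real (Suc k) powr r * u powr r = real k powr r"
    using k by (simp add: u_def powr_mult[symmetric])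
  moreover have "real (Suc k) powr (r - 1) = real (Suc k) powr r / real (Suc k)"
    by (simp add: powr_diff)
  ultimately show ?thesis by (simp add: algebra_simps)
qed

text \<open>The counterpart for decreasing powers, from \<open>ln u \<le> u - 1\<close> and
  \<open>1 + x \<le> exp x\<close>. The case \<open>k = 0\<close> has to be excluded because
  \<open>0 powr (- r)\<close> is 0.\<close>

lemma powr_diff_ge_neg:
  fixes r :: real
  assumes "0 < r" "k > 0"
  shows "r * real (Suc k) powr (- r - 1) \<le> real k powr (- r) - real (Suc k) powr (- r)"
proof -
  have k: "real k > 0" using assms by simp
  define u where "u = real k / real (Suc k)"
  have u: "u > 0" "u = 1 - 1 / real (Suc k)" using k by (auto simp: u_def field_simps)
  have "1 + r / real (Suc k) \<le> 1 + - r * ln u"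
    using mult_left_mono[OF ln_le_minus_one[OF u(1)], of r] assms u(2) by simp
  also have "\<dots> \<le> u powr (- r)" using u exp_ge_add_one_self[of "- r * ln u"] by (simp add: powr_def)
  finally have "real (Suc k) powr (- r) * (1 + r / real (Suc k)) \<le> real (Suc k) powr (- r) * u powr (- r)"
    by (intro mult_left_mono) auto
  moreover have "real (Suc k) powr (- r) * u powr (- r) = real k powr (- r)"
    using k by (simp add: u_def powr_mult[symmetric])
  moreover have "real (Suc k) powr (- r - 1) = real (Suc k) powr (- r) / real (Suc k)"
    by (simp add: powr_diff)
  ultimately show ?thesis by (simp add: algebra_simps)
qed

lemma sum_powr_head:
  assumes "0 \<le> s" "s < 1"
  shows "(\<Sum>k<N. real (Suc k) powr (- s)) \<le> real N powr (1 - s) / (1 - s)"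
proof (induction N)
  case (Suc N)
  have "(1 - s) * real (Suc N) powr ((1 - s) - 1) \<le> real (Suc N) powr (1 - s) - real N powr (1 - s)"
    by (rule powr_diff_ge) (use assms in auto)
  then have "real (Suc N) powr (- s) \<le> (real (Suc N) powr (1 - s) - real N powr (1 - s)) / (1 - s)"
    using assms by (simp add: pos_le_divide_eq mult.commute)
  with Suc show ?case by (simp add: diff_divide_distrib)
qed (use assms in auto)

lemma sum_powr_tail:
  assumes "s > 1" "N > 0"
  shows "(\<Sum>k\<in>{N..<m}. real (Suc k) powr (- s)) \<le> real N powr (1 - s) / (s - 1)"
proof (cases "N \<le> m")
  case True
  have "(\<Sum>k\<in>{N..<m}. real (Suc k) powr (- s)) \<le>
     (\<Sum>k\<in>{N..<m}. (real k powr (1 - s) - real (Suc k) powr (1 - s)) / (s - 1))"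
  proof (rule sum_mono)
    fix k assume "k \<in> {N..<m}"
    then have "(s - 1) * real (Suc k) powr (- (s - 1) - 1) \<le> real k powr (- (s - 1)) - real (Suc k) powr (- (s - 1))"
      by (intro powr_diff_ge_neg) (use assms in auto)
    then show "real (Suc k) powr (- s) \<le> (real k powr (1 - s) - real (Suc k) powr (1 - s)) / (s - 1)"
      using assms by (simp add: pos_le_divide_eq mult.commute)
  qed
  also have "\<dots> = (real N powr (1 - s) - real m powr (1 - s)) / (s - 1)"
    using sum_Suc_diff'[OF True, of "\<lambda>k. - (real k powr (1 - s))"]
    by (simp add: sum_divide_distrib[symmetric])
  also have "\<dots> \<le> real N powr (1 - s) / (s - 1)"
    using assms by (intro divide_right_mono) auto
  finally show ?thesis .
qed (use assms in auto)

text \<open>For \<open>s \<ge> 0\<close> this is the smaller of the two powers if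
  \<open>\<beta> \<le> 2\<close> and the larger one if \<open>\<beta> > 2\<close>. In the first case
  either power is an upper bound; in general their sum is.\<close>

definition mgf_exponent :: "real \<Rightarrow> real \<Rightarrow> real" where
  "mgf_exponent \<beta> s = (if s \<le> 1 then s\<^sup>2 else s powr \<beta>)"

lemma mgf_exponent_nonneg: "mgf_exponent \<beta> s \<ge> 0"
  by (simp add: mgf_exponent_def)

lemma mgf_exponent_le_powr:
  assumes "\<beta> \<le> 2" "s \<ge> 0"
  shows "mgf_exponent \<beta> s \<le> s powr \<beta>"
proof (cases "s = 0 \<or> s > 1")
  case False
  then have "s powr 2 \<le> s powr \<beta>" using assms by (intro powr_mono') auto
  with False show ?thesis using assms by (simp add: mgf_exponent_def)
qed (use assms in \<open>auto simp: mgf_exponent_def\<close>)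

lemma mgf_exponent_le_square:
  assumes "\<beta> \<le> 2" "s \<ge> 0"
  shows "mgf_exponent \<beta> s \<le> s powr 2"
proof (cases "s \<le> 1")
  case False
  then have "s powr \<beta> \<le> s powr 2" using assms by (intro powr_mono) auto
  with False show ?thesis using assms by (simp add: mgf_exponent_def)
qed (use assms in \<open>auto simp: mgf_exponent_def\<close>)

lemma mgf_exponent_le_add:
  assumes "s \<ge> 0"
  shows "mgf_exponent \<beta> s \<le> s powr 2 + s powr \<beta>"
  using assms by (simp add: mgf_exponent_def)

text \<open>The reason for \<open>n \<ge> 3\<close>: since 3 exceeds e, \<open>ln n\<close> exceeds
  1 and \<open>ln (ln n)\<close> is positive.\<close>

lemma ln_gt_1: "n \<ge> 3 \<Longrightarrow> ln (real n) > 1"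
proof -
  assume n: "n \<ge> 3"
  have "exp 1 < real n" using e_less_272 n by simp
  then have "ln (exp 1) < ln (real n)" using n by (subst ln_less_cancel_iff) auto
  then show ?thesis by simp
qed

context harness_matrix
begin

text \<open>One factor \<open>heat k x\<close> is kept and summed to at most one; the remaining
  power \<open>\<gamma> - 1\<close> is bounded by the heat kernel estimate.\<close>

lemma heat_powr_sum:
  assumes C: "C \<ge> 1" "\<And>k x. heat k x \<le> C * real (Suc k) powr (- real CARD('d) / 2)"
    and \<gamma>: "\<gamma> \<ge> 1" and F: "finite F" and t: "t \<ge> 0"
  shows "(\<Sum>x\<in>F. (t * heat k x) powr \<gamma>) \<le>
     t powr \<gamma> * (C powr (\<gamma> - 1) * real (Suc k) powr (- (real CARD('d) / 2 * (\<gamma> - 1))))"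
proof -
  define h where "h = C * real (Suc k) powr (- real CARD('d) / 2)"
  have "(\<Sum>x\<in>F. (t * heat k x) powr \<gamma>) \<le> (\<Sum>x\<in>F. t powr \<gamma> * (h powr (\<gamma> - 1) * heat k x))"
  proof (rule sum_mono)
    fix x
    have "heat k x powr \<gamma> = heat k x powr (\<gamma> - 1) * heat k x"
      using heat_nonneg[of k x] powr_mult_base[of "heat k x" "\<gamma> - 1"] by (simp add: mult.commute)
    also have "\<dots> \<le> h powr (\<gamma> - 1) * heat k x"
      using heat_nonneg[of k x] C(2)[of k x] \<gamma> by (intro mult_right_mono powr_mono2) (auto simp: h_def)
    finally show "(t * heat k x) powr \<gamma> \<le> t powr \<gamma> * (h powr (\<gamma> - 1) * heat k x)"
      using t heat_nonneg[of k x] by (simp add: powr_mult mult_left_mono)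
  qed
  also have "\<dots> = t powr \<gamma> * (h powr (\<gamma> - 1) * (\<Sum>x\<in>F. heat k x))"
    by (simp add: sum_distrib_left)
  also have "\<dots> \<le> t powr \<gamma> * (h powr (\<gamma> - 1) * 1)"
    by (intro mult_left_mono heat_sum_le_1 F) auto
  also have "h powr (\<gamma> - 1) = C powr (\<gamma> - 1) * real (Suc k) powr (- (real CARD('d) / 2 * (\<gamma> - 1)))"
    using C(1) by (simp add: h_def powr_mult powr_powr)
  finally show ?thesis by simp
qed

text \<open>The second condition on \<open>\<gamma>\<close> makes the powers of \<open>k\<close>
  summable, so \<open>D\<close> depends neither on \<open>m\<close> nor on the finite sets.\<close>

lemma heat_powr_double_sum:
  assumes C: "C \<ge> 1" "\<And>k x. heat k x \<le> C * real (Suc k) powr (- real CARD('d) / 2)"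
    and \<gamma>: "\<gamma> \<ge> 1" "real CARD('d) / 2 * (\<gamma> - 1) > 1"
  obtains D where "D \<ge> 0" "\<And>t m F. t \<ge> 0 \<Longrightarrow> (\<And>k. finite (F k)) \<Longrightarrow>
     (\<Sum>k<m. \<Sum>x\<in>F k. (t * heat k x) powr \<gamma>) \<le> D * t powr \<gamma>"
proof -
  define s where "s = real CARD('d) / 2 * (\<gamma> - 1)"
  have s: "s > 1" using \<gamma> by (simp add: s_def)
  define D where "D = C powr (\<gamma> - 1) * (1 + 1 / (s - 1))"
  have S: "(\<Sum>k<m. real (Suc k) powr (- s)) \<le> 1 + 1 / (s - 1)" for m
  proof (cases "m = 0")
    case False
    then have "{..<m} = insert 0 {1..<m}" by auto
    then have "(\<Sum>k<m. real (Suc k) powr (- s)) = 1 + (\<Sum>k\<in>{1..<m}. real (Suc k) powr (- s))" by simp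
    also have "\<dots> \<le> 1 + real 1 powr (1 - s) / (s - 1)"
      by (intro add_left_mono sum_powr_tail s) auto
    finally show ?thesis by simp
  qed (use s in auto)
  have "(\<Sum>k<m. \<Sum>x\<in>F k. (t * heat k x) powr \<gamma>) \<le> D * t powr \<gamma>"
    if "t \<ge> 0" "\<And>k. finite (F k)" for t m F
  proof -
    have "(\<Sum>k<m. \<Sum>x\<in>F k. (t * heat k x) powr \<gamma>) \<le>
      (\<Sum>k<m. t powr \<gamma> * (C powr (\<gamma> - 1) * real (Suc k) powr (- s)))"
      unfolding s_def by (intro sum_mono heat_powr_sum C \<gamma> that)
    also have "\<dots> = t powr \<gamma> * C powr (\<gamma> - 1) * (\<Sum>k<m. real (Suc k) powr (- s))"
      by (simp add: sum_distrib_left mult.assoc)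
    also have "\<dots> \<le> t powr \<gamma> * C powr (\<gamma> - 1) * (1 + 1 / (s - 1))"
      by (intro mult_left_mono S) auto
    finally show ?thesis by (simp add: D_def mult_ac)
  qed
  moreover have "D \<ge> 0" using s by (simp add: D_def)
  ultimately show ?thesis using that by blast
qed

text \<open>Times \<open>k < t\<^bsup>2/d\<^esup>\<close> are controlled by the exponent \<open>\<beta>\<close>, later times by the exponent \<open>2\<close>.\<close>

lemma heat_split_sum:
  assumes C: "C \<ge> 1" "\<And>k x. heat k x \<le> C * real (Suc k) powr (- real CARD('d) / 2)"
    and dim: "CARD('d) \<ge> 3" and \<beta>: "1 < \<beta>" "\<beta> \<le> 2"
  obtains D where "D \<ge> 0" "\<And>t m F. t \<ge> 1 \<Longrightarrow> (\<And>k. finite (F k)) \<Longrightarrow>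
     (\<Sum>k<m. \<Sum>x\<in>F k. mgf_exponent \<beta> (t * heat k x)) \<le>
       D * t powr \<beta> * (\<Sum>k<nat \<lfloor>t powr (2 / real CARD('d))\<rfloor>. real (Suc k) powr (- (real CARD('d) / 2 * (\<beta> - 1))))
       + D * t powr (1 + 2 / real CARD('d))"
proof -
  define d where "d = real CARD('d)"
  have d: "d \<ge> 3" using dim by (simp add: d_def)
  define s where "s = d / 2 * (\<beta> - 1)"
  \<comment> \<open>The entries serve the early and the late times. The factor
    \<open>2 powr (d / 2 - 1)\<close> is the loss from rounding, by
    \<open>N \<ge> T / 2\<close>.\<close>
  define D where "D = max (C powr (\<beta> - 1)) (C * (2 powr (d / 2 - 1) / (d / 2 - 1)))"
  have D: "D \<ge> 0" by (simp add: D_def max.coboundedI1)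
  have "(\<Sum>k<m. \<Sum>x\<in>F k. mgf_exponent \<beta> (t * heat k x)) \<le>
       D * t powr \<beta> * (\<Sum>k<nat \<lfloor>t powr (2 / d)\<rfloor>. real (Suc k) powr (- s)) + D * t powr (1 + 2 / d)"
    if l: "t \<ge> 1" and F: "\<And>k. finite (F k)" for t m and F :: "nat \<Rightarrow> (int ^ 'd) set"
  proof -
    \<comment> \<open>Around this time the bound for \<open>t * heat k x\<close> falls to order one,
      where the quadratic regime begins.\<close>
    define T where "T = t powr (2 / d)"
    define N where "N = nat \<lfloor>T\<rfloor>"
    have T1: "T \<ge> 1" using l d unfolding T_def by (intro ge_one_powr_ge_zero) auto
    have fl: "\<lfloor>T\<rfloor> \<ge> 1" using T1 by linarith
    then have "real N = real_of_int \<lfloor>T\<rfloor>" "N > 0" unfolding N_def by auto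
    then have N: "N > 0" "real N \<ge> T / 2" using fl by linarith+
    let ?f = "\<lambda>k. \<Sum>x\<in>F k. mgf_exponent \<beta> (t * heat k x)"
    have f0: "?f k \<ge> 0" for k by (intro sum_nonneg mgf_exponent_nonneg)
    have "(\<Sum>k<m. ?f k) \<le> (\<Sum>k\<in>{..<N} \<union> {N..<m}. ?f k)"
      by (rule sum_mono2) (auto intro: f0)
    also have "\<dots> = (\<Sum>k<N. ?f k) + (\<Sum>k\<in>{N..<m}. ?f k)"
      by (rule sum.union_disjoint) auto
    also have "(\<Sum>k<N. ?f k) \<le> (\<Sum>k<N. D * t powr \<beta> * real (Suc k) powr (- s))"
    proof (rule sum_mono)
      fix k
      have "?f k \<le> (\<Sum>x\<in>F k. (t * heat k x) powr \<beta>)"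
        by (intro sum_mono mgf_exponent_le_powr \<beta>) (use l heat_nonneg in auto)
      also have "\<dots> \<le> t powr \<beta> * (C powr (\<beta> - 1) * real (Suc k) powr (- s))"
        unfolding s_def d_def by (rule heat_powr_sum[OF C]) (use F l \<beta> in auto)
      also have "\<dots> \<le> t powr \<beta> * (D * real (Suc k) powr (- s))"
        by (intro mult_left_mono mult_right_mono) (auto simp: D_def)
      finally show "?f k \<le> D * t powr \<beta> * real (Suc k) powr (- s)" by (simp add: mult_ac)
    qed
    also have "\<dots> = D * t powr \<beta> * (\<Sum>k<N. real (Suc k) powr (- s))"
      by (simp add: sum_distrib_left)
    also have "(\<Sum>k\<in>{N..<m}. ?f k) \<le> (\<Sum>k\<in>{N..<m}. t\<^sup>2 * C * real (Suc k) powr (- (d / 2)))"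
    proof (rule sum_mono)
      fix k
      have "?f k \<le> (\<Sum>x\<in>F k. (t * heat k x) powr 2)"
        by (intro sum_mono mgf_exponent_le_square \<beta>) (use l heat_nonneg in auto)
      also have "\<dots> \<le> t powr 2 * (C powr (2 - 1) * real (Suc k) powr (- (real CARD('d) / 2 * (2 - 1))))"
        by (rule heat_powr_sum[OF C]) (use F l in auto)
      finally show "?f k \<le> t\<^sup>2 * C * real (Suc k) powr (- (d / 2))" using l C(1) by (simp add: d_def)
    qed
    also have "\<dots> = t\<^sup>2 * C * (\<Sum>k\<in>{N..<m}. real (Suc k) powr (- (d / 2)))"
      by (simp add: sum_distrib_left)
    also have "\<dots> \<le> t\<^sup>2 * C * (real N powr (1 - d / 2) / (d / 2 - 1))"
      by (intro mult_left_mono sum_powr_tail N) (use d C(1) in auto)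
    also have "\<dots> \<le> t\<^sup>2 * C * ((T / 2) powr (1 - d / 2) / (d / 2 - 1))"
      by (intro mult_left_mono divide_right_mono powr_mono2') (use d C(1) N T1 in auto)
    also have "\<dots> = (C * (2 powr (d / 2 - 1) / (d / 2 - 1))) * (t\<^sup>2 * T powr (1 - d / 2))"
    proof -
      have "2 powr (d / 2 - 1) = 1 / 2 powr (1 - d / 2)"
        by (simp add: powr_minus_divide[symmetric])
      then show ?thesis using T1 by (simp add: powr_divide)
    qed
    also have "t\<^sup>2 * T powr (1 - d / 2) = t powr (1 + 2 / d)"
    proof -
      have e: "2 / d * (1 - d / 2) = 2 / d - 1" using d by (simp add: field_simps)
      have "t\<^sup>2 * T powr (1 - d / 2) = t powr 2 * t powr (2 / d * (1 - d / 2))"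
        using l by (simp add: T_def powr_powr)
      also have "\<dots> = t powr (1 + 2 / d)" unfolding e powr_add[symmetric] by (simp add: add.commute)
      finally show ?thesis .
    qed
    also have "(C * (2 powr (d / 2 - 1) / (d / 2 - 1))) * t powr (1 + 2 / d) \<le> D * t powr (1 + 2 / d)"
      by (intro mult_right_mono) (auto simp: D_def)
    finally show ?thesis by (simp add: N_def T_def)
  qed
  then show ?thesis using that[OF D] unfolding s_def d_def by blast
qed

text \<open>At \<open>t = ln n / harness_rate\<close> the summed exponent is of order
  \<open>ln n\<close>. The cases compare \<open>d / 2 * (\<beta> - 1)\<close>, the decay exponent in
  \<open>k\<close> of the \<beta>-th power sums, with 1. If it is larger, the time sums converge and
  \<open>t powr \<beta> = ln n\<close>. If it is smaller, early and late times both yield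
  \<open>t powr (1 + 2 / d) = ln n\<close>. If it equals 1, the early sum is harmonic, and the
  \<open>ln (ln n)\<close> factor of the rate compensates its logarithm.\<close>

lemma mgf_exponent_sum_le:
  assumes dim: "CARD('d) \<ge> 3" and \<alpha>: "\<alpha> > 1"
  obtains C where "C \<ge> 0"
    "\<And>n. n \<ge> 3 \<Longrightarrow> ln (real n) / harness_rate CARD('d) \<alpha> n \<ge> 1"
    "\<And>n m F. n \<ge> 3 \<Longrightarrow> (\<And>k. finite (F k)) \<Longrightarrow>
       (\<Sum>k<m. \<Sum>x\<in>F k. mgf_exponent (\<alpha> / (\<alpha> - 1)) (ln (real n) / harness_rate CARD('d) \<alpha> n * heat k x))
         \<le> C * ln (real n)"
proof -
  define d where "d = real CARD('d)"
  have d: "d \<ge> 3" using dim by (simp add: d_def)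
  \<comment> \<open>Turns \<open>t = ln n powr (d / (2 + d))\<close> into
    \<open>t powr (1 + 2 / d) = ln n\<close>.\<close>
  have dd: "d / (2 + d) * (1 + 2 / d) = 1"
  proof -
    have "1 + 2 / d = (2 + d) / d" using d by (simp add: field_simps)
    then show ?thesis using d by simp
  qed
  define \<beta> where "\<beta> = \<alpha> / (\<alpha> - 1)"
  have \<beta>: "\<beta> > 1" "\<beta> - 1 = 1 / (\<alpha> - 1)" using \<alpha> by (auto simp: \<beta>_def field_simps)
  have ln3: "ln (real 3) > 1" using ln_gt_1[of 3] by simp
  have l: "ln (real n) \<ge> ln (real 3)" "ln (real n) > 1" if "n \<ge> 3" for n
  proof -
    show "ln (real n) \<ge> ln (real 3)" using that by simp
    with ln3 show "ln (real n) > 1" by linarith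
  qed
  define t where "t n = ln (real n) / harness_rate CARD('d) \<alpha> n" for n
  obtain C0 where C0: "C0 \<ge> 1" "\<And>k x. heat k x \<le> C0 * real (Suc k) powr (- real CARD('d) / 2)"
    using heat_kernel_bound by blast
  consider (light) "\<alpha> < 1 + d / 2" | (heavy) "\<alpha> > 1 + d / 2" | (critical) "\<alpha> = 1 + d / 2" by linarith
  then show ?thesis
  proof cases
    case light
    have s: "real CARD('d) / 2 * (\<beta> - 1) > 1" "real CARD('d) / 2 * (2 - 1) > 1"
      using light \<alpha> d unfolding \<beta>(2) d_def[symmetric] by (auto simp: field_simps)
    obtain D1 where D1: "D1 \<ge> 0" "\<And>t m F. t \<ge> 0 \<Longrightarrow> (\<And>k. finite (F k)) \<Longrightarrow>
       (\<Sum>k<m. \<Sum>x\<in>F k. (t * heat k x) powr \<beta>) \<le> D1 * t powr \<beta>"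
      using heat_powr_double_sum[OF C0 less_imp_le[OF \<beta>(1)] s(1)] by blast
    obtain D2 where D2: "D2 \<ge> 0" "\<And>t m F. t \<ge> 0 \<Longrightarrow> (\<And>k. finite (F k)) \<Longrightarrow>
       (\<Sum>k<m. \<Sum>x\<in>F k. (t * heat k x) powr 2) \<le> D2 * t powr 2"
      using heat_powr_double_sum[OF C0 one_le_numeral s(2)] by blast
    have t: "t n = ln (real n) powr (1 / \<beta>)" if "n \<ge> 3" for n
    proof -
      have "max (1 / \<alpha>) (2 / (2 + d)) = 1 / \<alpha>" using light \<alpha> d by (simp add: field_simps max_def)
      then have "t n = ln (real n) / ln (real n) powr (1 / \<alpha>)"
        using light by (simp add: t_def harness_rate_def d_def)
      also have "\<dots> = ln (real n) powr (1 - 1 / \<alpha>)"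
        using l[OF that] by (simp add: powr_diff)
      also have "1 - 1 / \<alpha> = 1 / \<beta>" using \<alpha> by (simp add: \<beta>_def field_simps)
      finally show ?thesis .
    qed
    have t1: "t n \<ge> 1" if "n \<ge> 3" for n
      unfolding t[OF that] using l[OF that] \<beta> by (intro ge_one_powr_ge_zero) auto
    have "(\<Sum>k<m. \<Sum>x\<in>F k. mgf_exponent \<beta> (t n * heat k x)) \<le> (D1 + D2) * ln (real n)"
      if n: "n \<ge> 3" and F: "\<And>k. finite (F k)" for n m and F :: "nat \<Rightarrow> (int ^ 'd) set"
    proof -
      have pos: "t n * heat k x \<ge> 0" for k x using t1[OF n] heat_nonneg by auto
      have tb: "t n powr \<beta> = ln (real n)" unfolding t[OF n] using \<beta> l[OF n] by (simp add: powr_powr)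
      show ?thesis
      proof (cases "\<beta> \<le> 2")
        case True
        have "(\<Sum>k<m. \<Sum>x\<in>F k. mgf_exponent \<beta> (t n * heat k x)) \<le> (\<Sum>k<m. \<Sum>x\<in>F k. (t n * heat k x) powr \<beta>)"
          by (intro sum_mono mgf_exponent_le_powr True pos)
        also have "\<dots> \<le> D1 * t n powr \<beta>" by (rule D1) (use t1[OF n] F in auto)
        also have "\<dots> \<le> (D1 + D2) * ln (real n)"
          unfolding tb using D2(1) l[OF n] by (intro mult_right_mono) auto
        finally show ?thesis .
      next
        case False
        \<comment> \<open>Here \<open>\<beta> > 2\<close>, that is \<open>\<alpha> < 2\<close>: both
          powers are summed, and \<open>t n \<ge> 1\<close> absorbs the square into the \<beta>-th
          power.\<close>
        have "(\<Sum>k<m. \<Sum>x\<in>F k. mgf_exponent \<beta> (t n * heat k x)) \<le>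
            (\<Sum>k<m. \<Sum>x\<in>F k. (t n * heat k x) powr 2 + (t n * heat k x) powr \<beta>)"
          by (intro sum_mono mgf_exponent_le_add pos)
        also have "\<dots> \<le> D2 * t n powr 2 + D1 * t n powr \<beta>"
          unfolding sum.distrib by (intro add_mono D1 D2) (use t1[OF n] F in auto)
        also have "\<dots> \<le> D2 * t n powr \<beta> + D1 * t n powr \<beta>"
          using False t1[OF n] D2(1) by (intro add_right_mono mult_left_mono powr_mono) auto
        finally show ?thesis by (simp add: tb algebra_simps)
      qed
    qed
    then show ?thesis using that[of "D1 + D2"] D1(1) D2(1) t1 unfolding t_def \<beta>_def by simp
  next
    case heavy
    define s where "s = d / 2 * (\<beta> - 1)"
    have s: "0 \<le> s" "s < 1" using heavy \<alpha> d unfolding s_def \<beta>(2) by (auto simp: field_simps)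
    have "1 / (\<alpha> - 1) \<le> 1" using heavy d by simp
    then have b2: "\<beta> \<le> 2" using \<beta>(2) by linarith
    obtain D where D: "D \<ge> 0" "\<And>t m F. t \<ge> 1 \<Longrightarrow> (\<And>k. finite (F k)) \<Longrightarrow>
     (\<Sum>k<m. \<Sum>x\<in>F k. mgf_exponent \<beta> (t * heat k x)) \<le>
       D * t powr \<beta> * (\<Sum>k<nat \<lfloor>t powr (2 / d)\<rfloor>. real (Suc k) powr (- s)) + D * t powr (1 + 2 / d)"
      using heat_split_sum[OF C0 dim \<beta>(1) b2] unfolding d_def s_def by blast
    have t: "t n = ln (real n) powr (d / (2 + d))" if "n \<ge> 3" for n
    proof -
      have "max (1 / \<alpha>) (2 / (2 + d)) = 2 / (2 + d)" using heavy \<alpha> d by (simp add: field_simps max_def)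
      then have "t n = ln (real n) / ln (real n) powr (2 / (2 + d))"
        using heavy by (simp add: t_def harness_rate_def d_def)
      also have "\<dots> = ln (real n) powr (1 - 2 / (2 + d))"
        using l[OF that] by (simp add: powr_diff)
      also have "1 - 2 / (2 + d) = d / (2 + d)" using d by (simp add: field_simps)
      finally show ?thesis .
    qed
    have t1: "t n \<ge> 1" if "n \<ge> 3" for n
      unfolding t[OF that] using l[OF that] d by (intro ge_one_powr_ge_zero) auto
    have "(\<Sum>k<m. \<Sum>x\<in>F k. mgf_exponent \<beta> (t n * heat k x)) \<le> (D / (1 - s) + D) * ln (real n)"
      if n: "n \<ge> 3" and F: "\<And>k. finite (F k)" for n m and F :: "nat \<Rightarrow> (int ^ 'd) set"
    proof -
      define N where "N = nat \<lfloor>t n powr (2 / d)\<rfloor>"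
      have N: "real N \<le> t n powr (2 / d)" unfolding N_def by (simp add: of_nat_nat)
      have tb: "t n powr (1 + 2 / d) = ln (real n)"
        unfolding t[OF n] powr_powr dd using l[OF n] by simp
      have "(\<Sum>k<N. real (Suc k) powr (- s)) \<le> real N powr (1 - s) / (1 - s)"
        by (rule sum_powr_head[OF s])
      also have "\<dots> \<le> (t n powr (2 / d)) powr (1 - s) / (1 - s)"
        using s N by (intro divide_right_mono powr_mono2) auto
      finally have "D * t n powr \<beta> * (\<Sum>k<N. real (Suc k) powr (- s)) \<le>
         D * t n powr \<beta> * ((t n powr (2 / d)) powr (1 - s) / (1 - s))"
        using D(1) by (intro mult_left_mono) auto
      also have "\<dots> = D / (1 - s) * (t n powr (\<beta> + 2 / d * (1 - s)))"
        by (simp add: powr_powr powr_add)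
      \<comment> \<open>By the value of \<open>s\<close> the early times carry the same power of
        \<open>t\<close> as the late ones.\<close>
      also have "\<beta> + 2 / d * (1 - s) = 1 + 2 / d" using d by (simp add: s_def field_simps)
      finally have "D * t n powr \<beta> * (\<Sum>k<N. real (Suc k) powr (- s)) \<le> D / (1 - s) * ln (real n)"
        by (simp add: tb)
      moreover have "(\<Sum>k<m. \<Sum>x\<in>F k. mgf_exponent \<beta> (t n * heat k x)) \<le>
         D * t n powr \<beta> * (\<Sum>k<N. real (Suc k) powr (- s)) + D * t n powr (1 + 2 / d)"
        unfolding N_def by (rule D(2)[OF t1[OF n] F])
      ultimately show ?thesis by (simp add: tb algebra_simps)
    qed
    then show ?thesis using that[of "D / (1 - s) + D"] D(1) s t1 unfolding t_def \<beta>_def by simp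
  next
    case critical
    have \<beta>_eq: "\<beta> = 1 + 2 / d" using \<beta>(2) critical d by simp
    have s: "d / 2 * (\<beta> - 1) = 1" using d by (simp add: \<beta>_eq)
    have b2: "\<beta> \<le> 2" using d by (simp add: \<beta>_eq field_simps)
    obtain D where D: "D \<ge> 0" "\<And>t m F. t \<ge> 1 \<Longrightarrow> (\<And>k. finite (F k)) \<Longrightarrow>
     (\<Sum>k<m. \<Sum>x\<in>F k. mgf_exponent \<beta> (t * heat k x)) \<le>
       D * t powr \<beta> * (\<Sum>k<nat \<lfloor>t powr (2 / d)\<rfloor>. real (Suc k) powr (- 1)) + D * t powr (1 + 2 / d)"
      using heat_split_sum[OF C0 dim \<beta>(1) b2] unfolding d_def[symmetric] s by blast
    have ll: "ln (ln (real n)) > 0" "ln (ln (real n)) \<ge> ln (ln (real 3))" "ln (ln (real n)) \<le> ln (real n)"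
      if "n \<ge> 3" for n
    proof -
      show "ln (ln (real n)) > 0" using l[OF that] by simp
      show "ln (ln (real n)) \<ge> ln (ln (real 3))" using l[OF that] ln3 by (subst ln_le_cancel_iff) auto
      show "ln (ln (real n)) \<le> ln (real n)" using ln_le_minus_one[of "ln (real n)"] l[OF that] by linarith
    qed
    define e where "e = d / (2 + d)"
    have e: "e > 0" using d by (simp add: e_def)
    have t: "t n = (ln (real n) / ln (ln (real n))) powr e" if "n \<ge> 3" for n
    proof -
      have "t n = ln (real n) / (ln (real n) powr (2 / (2 + d)) * ln (ln (real n)) powr e)"
        using critical by (simp add: t_def harness_rate_def d_def e_def add.commute)
      also have "\<dots> = ln (real n) powr (1 - 2 / (2 + d)) / ln (ln (real n)) powr e"
        using l[OF that] by (simp add: powr_diff)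
      also have "1 - 2 / (2 + d) = e" using d by (simp add: e_def field_simps)
      also have "ln (real n) powr e / ln (ln (real n)) powr e = (ln (real n) / ln (ln (real n))) powr e"
        using l[OF that] ll[OF that] by (simp add: powr_divide)
      finally show ?thesis .
    qed
    have t1: "t n \<ge> 1" if "n \<ge> 3" for n
      unfolding t[OF that] using ll[OF that] e by (intro ge_one_powr_ge_zero) (auto simp: pos_le_divide_eq)
    \<comment> \<open>\<open>ln (ln n)\<close> is smallest at \<open>n = 3\<close>, so
      \<open>c\<close> bounds its reciprocal uniformly.\<close>
    define c where "c = 1 / ln (ln (real 3))"
    have c: "c > 0" "1 / ln (ln (real n)) \<le> c" if "n \<ge> 3" for n
      using ll[OF that] ll[of 3] unfolding c_def by (auto intro!: divide_left_mono)
    have c0: "c > 0" using c[of 3] by simp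
    have "(\<Sum>k<m. \<Sum>x\<in>F k. mgf_exponent \<beta> (t n * heat k x)) \<le> (D * (c * c + c + 1)) * ln (real n)"
      if n: "n \<ge> 3" and F: "\<And>k. finite (F k)" for n m and F :: "nat \<Rightarrow> (int ^ 'd) set"
    proof -
      define N where "N = nat \<lfloor>t n powr (2 / d)\<rfloor>"
      have N: "real N \<le> t n powr (2 / d)" unfolding N_def by (simp add: of_nat_nat)
      have t2: "t n powr (2 / d) \<ge> 1" using t1[OF n] d by (intro ge_one_powr_ge_zero) auto
      have ne: "ln (ln (real n)) \<noteq> 0" using ll(1)[OF n] by linarith
      have tb: "t n powr (1 + 2 / d) = ln (real n) / ln (ln (real n))"
        unfolding t[OF n] powr_powr e_def dd using l[OF n] ll[OF n] by simp
      have "t n powr (2 / d) \<le> t n powr (1 + 2 / d)" using t1[OF n] by (intro powr_mono) auto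
      also have "\<dots> \<le> c * ln (real n)"
        unfolding tb using mult_right_mono[OF c(2)[OF n], of "ln (real n)"] l[OF n] by simp
      finally have t3: "t n powr (2 / d) \<le> c * ln (real n)" .
      have "(\<Sum>k<N. real (Suc k) powr (- 1)) \<le> ln (t n powr (2 / d)) + 1"
      proof (cases "N = 0")
        case False
        have "(\<Sum>k<N. real (Suc k) powr (- 1)) = harm N"
          by (simp add: harm_def powr_minus sum.atLeast1_atMost_eq)
        \<comment> \<open>The difference of \<open>harm\<close> and \<open>ln\<close> decreases and
          equals 1 at its first term; the library sequence starts at 1, hence the index
          \<open>N - 1\<close>.\<close>
        also have "\<dots> \<le> ln (real N) + 1"
          using decseqD[OF decseq_harm_diff_ln, of 0 "N - 1"] False by (simp add: harm_def)
        also have "\<dots> \<le> ln (t n powr (2 / d)) + 1"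
          by (intro add_right_mono ln_mono) (use False N in auto)
        finally show ?thesis .
      qed (use ln_ge_zero[OF t2] in \<open>simp del: ln_powr\<close>)
      also have "\<dots> \<le> ln (c * ln (real n)) + 1"
        by (intro add_right_mono ln_mono) (use t2 t3 in auto)
      also have "\<dots> = ln c + ln (ln (real n)) + 1" using c0 l[OF n] by (subst ln_mult) auto
      also have "\<dots> \<le> c + ln (ln (real n))" using ln_le_minus_one[OF c0] by simp
      finally have "D * t n powr \<beta> * (\<Sum>k<N. real (Suc k) powr (- 1)) \<le>
         D * t n powr \<beta> * (c + ln (ln (real n)))"
        using D(1) by (intro mult_left_mono) auto
      also have "\<dots> = D * ln (real n) * (c * (1 / ln (ln (real n))) + 1)"
        unfolding \<beta>_eq tb using ne by (simp add: field_simps)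
      also have "\<dots> \<le> D * ln (real n) * (c * c + 1)"
        using D(1) l[OF n] c0 c(2)[OF n] by (intro mult_left_mono add_right_mono) auto
      finally have "D * t n powr \<beta> * (\<Sum>k<N. real (Suc k) powr (- 1)) \<le> D * ln (real n) * (c * c + 1)" .
      moreover have "D * t n powr (1 + 2 / d) \<le> D * (c * ln (real n))"
        unfolding tb using mult_right_mono[OF c(2)[OF n], of "ln (real n)"] l[OF n] D(1)
        by (intro mult_left_mono) auto
      moreover have "(\<Sum>k<m. \<Sum>x\<in>F k. mgf_exponent \<beta> (t n * heat k x)) \<le>
         D * t n powr \<beta> * (\<Sum>k<N. real (Suc k) powr (- 1)) + D * t n powr (1 + 2 / d)"
        unfolding N_def by (rule D(2)[OF t1[OF n] F])
      ultimately show ?thesis by (simp add: algebra_simps)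
    qed
    then show ?thesis using that[of "D * (c * c + c + 1)"] D(1) c0 t1 unfolding t_def \<beta>_def by simp
  qed
qed

end

section \<open>Exponential moments of the noise\<close>

text \<open>Cut the range of \<open>Y\<close> above 1 into unit layers. On the layer from
  \<open>k + 1\<close> to \<open>k + 2\<close> the exponential at half the tail rate, times the tail
  bound, is \<open>c * exp (- \<kappa> * k / 2)\<close>, which is summable.\<close>

lemma (in prob_space) nn_integral_exp_of_tail:
  fixes Y :: "'a \<Rightarrow> real"
  assumes Y [measurable]: "Y \<in> borel_measurable M" and c: "c \<ge> 0" and \<kappa>: "\<kappa> > 0"
    and tail: "\<And>t. t > 0 \<Longrightarrow> prob {\<omega> \<in> space M. Y \<omega> > t} \<le> c * exp (- \<kappa> * t)"
  shows "(\<integral>\<^sup>+\<omega>. ennreal (exp (\<kappa> / 2 * Y \<omega>)) \<partial>M) < \<infinity>"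
proof -
  define A where "A k = {\<omega> \<in> space M. Y \<omega> > real (Suc k)}" for k :: nat
  have A [measurable]: "A k \<in> sets M" for k unfolding A_def by measurable
  define g where "g k = exp (\<kappa> / 2 * (real k + 2))" for k :: nat
  have pw: "ennreal (exp (\<kappa> / 2 * Y \<omega>)) \<le> ennreal (exp (\<kappa> / 2)) + (\<Sum>k. ennreal (g k) * indicator (A k) \<omega>)"
    if \<omega>: "\<omega> \<in> space M" for \<omega>
  proof (cases "Y \<omega> \<le> 1")
    case True
    then have "ennreal (exp (\<kappa> / 2 * Y \<omega>)) \<le> ennreal (exp (\<kappa> / 2))" using \<kappa> by (intro ennreal_leI) auto
    then show ?thesis by (simp add: add_increasing2)
  next
    case False
    \<comment> \<open>Rounding up puts \<open>Y \<omega>\<close> strictly above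
      \<open>k + 1\<close>, matching the strict inequality in \<open>A k\<close>, and at most at
      \<open>k + 2\<close>.\<close>
    define k where "k = nat (\<lceil>Y \<omega>\<rceil> - 2)"
    have k: "Y \<omega> > real (Suc k)" "Y \<omega> \<le> real k + 2" using False unfolding k_def by linarith+
    have "ennreal (exp (\<kappa> / 2 * Y \<omega>)) \<le> ennreal (g k)"
      using k \<kappa> unfolding g_def by (intro ennreal_leI) auto
    also have "\<dots> = (\<Sum>k\<in>{k}. ennreal (g k) * indicator (A k) \<omega>)" using k \<omega> by (simp add: A_def)
    also have "\<dots> \<le> (\<Sum>k. ennreal (g k) * indicator (A k) \<omega>)" by (rule sum_le_suminf) auto
    finally show ?thesis by (simp add: add_increasing)
  qed
  define q where "q = exp (- \<kappa> / 2)"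
  have q: "0 < q" "q < 1" using \<kappa> by (auto simp: q_def)
  have gk: "ennreal (g k) * emeasure M (A k) \<le> ennreal (c * q ^ k)" for k
  proof -
    have "g k * prob (A k) \<le> g k * (c * exp (- \<kappa> * real (Suc k)))"
      unfolding A_def by (intro mult_left_mono tail) (auto simp: g_def)
    also have "\<dots> = c * exp (\<kappa> / 2 * (real k + 2) + - \<kappa> * real (Suc k))"
      unfolding g_def exp_add by simp
    also have "\<kappa> / 2 * (real k + 2) + - \<kappa> * real (Suc k) = real k * (- \<kappa> / 2)"
      by (simp add: field_simps)
    also have "exp (real k * (- \<kappa> / 2)) = q ^ k" unfolding q_def by (rule exp_of_nat_mult)
    finally show ?thesis by (simp add: emeasure_eq_measure ennreal_mult[symmetric] g_def ennreal_leI)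
  qed
  have "(\<integral>\<^sup>+\<omega>. ennreal (exp (\<kappa> / 2 * Y \<omega>)) \<partial>M) \<le>
    (\<integral>\<^sup>+\<omega>. ennreal (exp (\<kappa> / 2)) + (\<Sum>k. ennreal (g k) * indicator (A k) \<omega>) \<partial>M)"
    by (rule nn_integral_mono) (rule pw)
  also have "\<dots> = (\<integral>\<^sup>+\<omega>. ennreal (exp (\<kappa> / 2)) \<partial>M) + (\<Sum>k. \<integral>\<^sup>+\<omega>. ennreal (g k) * indicator (A k) \<omega> \<partial>M)"
    by (simp add: nn_integral_add nn_integral_suminf)
  also have "(\<Sum>k. \<integral>\<^sup>+\<omega>. ennreal (g k) * indicator (A k) \<omega> \<partial>M) = (\<Sum>k. ennreal (g k) * emeasure M (A k))"
    by (simp add: nn_integral_cmult_indicator)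
  also have "\<dots> \<le> (\<Sum>k. ennreal (c * q ^ k))" by (intro suminf_le gk) auto
  also have "\<dots> = ennreal (\<Sum>k. c * q ^ k)"
    using q c by (intro suminf_ennreal2 summable_mult summable_geometric) auto
  finally show ?thesis using emeasure_space_1
    by (auto simp: less_top[symmetric] top_unique)
qed

lemma sinh_bounds_nonneg:
  fixes u :: real
  assumes "u \<ge> 0"
  shows "u \<le> sinh u" "sinh u \<le> u * cosh u"
proof -
  have *: "u \<le> sinh u \<and> sinh u \<le> u * cosh u"
  proof (cases "u = 0")
    case False
    then have u: "0 < u" using assms by simp
    have "\<exists>z>0. z < u \<and> sinh u - sinh 0 = (u - 0) * cosh z"
      by (rule MVT2[OF u]) (auto intro!: derivative_eq_intros)
    then obtain z where z: "0 < z" "z < u" "sinh u = u * cosh z" by auto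
    have "1 \<le> cosh z" by (rule cosh_real_ge_1)
    moreover have "cosh z \<le> cosh u" using z by (subst cosh_real_nonneg_le_iff) auto
    ultimately show ?thesis using u z(3) by simp
  qed simp
  then show "u \<le> sinh u" "sinh u \<le> u * cosh u" by auto
qed

text \<open>Gives quadratic behaviour in \<open>s\<close> with a coefficient whose mean is finite as
  soon as the exponential moment at 2 is. It uses \<open>cosh (2 * u) - 1 = 2 * (sinh u)^2\<close>
  with \<open>u = s * x / 2\<close>, then \<open>sinh u \<le> u * cosh u\<close> and
  \<open>x^2 / 2 \<le> cosh x\<close>.\<close>

lemma cosh_scaled_le:
  fixes s x :: real
  assumes "0 \<le> s" "s \<le> 1"
  shows "cosh (s * x) \<le> 1 + s\<^sup>2 * cosh (2 * x)"
proof -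
  have *: "cosh (s * x) \<le> 1 + s\<^sup>2 * cosh (2 * x)" if x: "x \<ge> 0" for x
  proof -
    define u where "u = s * x / 2"
    have u: "u \<ge> 0" using assms x by (simp add: u_def)
    have "cosh (s * x) = 1 + 2 * (sinh u)\<^sup>2"
      using cosh_double_cosh[of u] cosh_square_eq[of u] by (simp add: u_def)
    also have "(sinh u)\<^sup>2 \<le> (u * cosh u)\<^sup>2"
      using sinh_bounds_nonneg[OF u] u by (intro power_mono) auto
    also have "(u * cosh u)\<^sup>2 \<le> u\<^sup>2 * cosh x"
    proof -
      have "(cosh u)\<^sup>2 = (cosh (2 * u) + 1) / 2" using cosh_double_cosh[of u] by simp
      also have "\<dots> \<le> cosh (2 * u)" using cosh_real_ge_1[of "2 * u"] by simp
      also have "\<dots> \<le> cosh x" using u assms x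
        by (subst cosh_real_nonneg_le_iff) (auto simp: u_def mult_left_le_one_le)
      finally show ?thesis by (simp add: power_mult_distrib mult_left_mono)
    qed
    also have "1 + 2 * (u\<^sup>2 * cosh x) = 1 + s\<^sup>2 * (x\<^sup>2 / 2 * cosh x)"
      by (simp add: u_def power_mult_distrib power_divide)
    also have "x\<^sup>2 / 2 * cosh x \<le> cosh x * cosh x"
    proof (intro mult_right_mono)
      have "(x / 2)\<^sup>2 \<le> (sinh (x / 2))\<^sup>2"
        using sinh_bounds_nonneg[of "x / 2"] x by (intro power_mono) auto
      then show "x\<^sup>2 / 2 \<le> cosh x"
        using cosh_double_cosh[of "x / 2"] cosh_square_eq[of "x / 2"] by (simp add: power_divide)
    qed simp
    also have "cosh x * cosh x \<le> cosh (2 * x)"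
      using cosh_double_cosh[of x] cosh_real_ge_1[of x] one_le_power[of "cosh x" 2]
      by (simp add: power2_eq_square)
    finally show ?thesis by (simp add: mult_left_mono)
  qed
  have "cosh (s * x) = cosh (s * \<bar>x\<bar>)"
    using cosh_real_abs[of "s * x"] assms by (simp add: abs_mult)
  also have "\<dots> \<le> 1 + s\<^sup>2 * cosh (2 * \<bar>x\<bar>)" by (rule *) simp
  also have "cosh (2 * \<bar>x\<bar>) = cosh (2 * x)" using cosh_real_abs[of "2 * x"] by (simp add: abs_mult)
  finally show ?thesis .
qed

text \<open>A Young inequality with an arbitrary weight \<delta> on \<open>x powr \<alpha>\<close>,
  so that \<delta> can be chosen below the tail rate. One of the two terms alone already dominates,
  according to whether \<open>s\<close> is below
  \<open>\<delta> * x powr (\<alpha> - 1)\<close>.\<close>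

lemma mult_le_powr_conjugate:
  fixes x s \<alpha> \<delta> :: real
  assumes "\<alpha> > 1" "\<delta> > 0" "x \<ge> 0" "s \<ge> 0"
  shows "s * x \<le> \<delta> * x powr \<alpha> + (1 / \<delta>) powr (1 / (\<alpha> - 1)) * s powr (\<alpha> / (\<alpha> - 1))"
proof (cases "s \<le> \<delta> * x powr (\<alpha> - 1)")
  case True
  have "s * x \<le> \<delta> * (x * x powr (\<alpha> - 1))" using mult_right_mono[OF True assms(3)] by (simp add: mult_ac)
  also have "x * x powr (\<alpha> - 1) = x powr \<alpha>" using powr_mult_base[OF assms(3), of "\<alpha> - 1"] by simp
  finally show ?thesis by (simp add: add_increasing2)
next
  case False
  have "x = (x powr (\<alpha> - 1)) powr (1 / (\<alpha> - 1))" using assms by (simp add: powr_powr)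
  also have "\<dots> \<le> (s / \<delta>) powr (1 / (\<alpha> - 1))"
    using False assms by (intro powr_mono2) (auto simp: pos_le_divide_eq mult.commute)
  finally have "s * x \<le> s * (s / \<delta>) powr (1 / (\<alpha> - 1))" using assms by (intro mult_left_mono)
  also have "\<dots> = (1 / \<delta>) powr (1 / (\<alpha> - 1)) * (s * s powr (1 / (\<alpha> - 1)))"
    using powr_mult[of s "1 / \<delta>" "1 / (\<alpha> - 1)"] assms by simp
  also have "s * s powr (1 / (\<alpha> - 1)) = s powr (1 + 1 / (\<alpha> - 1))"
    using assms by (rule_tac powr_mult_base)
  also have "1 + 1 / (\<alpha> - 1) = \<alpha> / (\<alpha> - 1)" using assms by (simp add: field_simps)
  finally show ?thesis using assms by (simp add: add_increasing)
qed

text \<open>For \<bar>s\<bar> \<le> 1, symmetry replaces the exponential by \<open>cosh\<close>,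
  which has no linear term, and \<open>cosh_scaled_le\<close> gives the square. For larger
  \<bar>s\<bar>, the Young inequality separates \<open>s\<close> from \<open>x\<close> and leaves
  the finite moment \<open>K\<close>.\<close>

lemma symmetric_mgf_bound:
  fixes \<mu> :: "real measure"
  assumes \<mu>: "prob_space \<mu>" "sets \<mu> = sets borel" and sym: "distr \<mu> borel uminus = \<mu>"
    and tail: "cdf \<mu> \<in> \<L>\<^sup>- \<alpha>" and \<alpha>: "\<alpha> > 1"
  obtains C where "C \<ge> 0"
    "\<And>s. (\<integral>\<^sup>+x. ennreal (exp (s * x)) \<partial>\<mu>) \<le> ennreal (exp (C * mgf_exponent (\<alpha> / (\<alpha> - 1)) \<bar>s\<bar>))"
proof -
  interpret prob_space \<mu> by fact
  note [measurable_cong] = \<mu>(2)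
  have space: "space \<mu> = UNIV" using sets_eq_imp_space_eq[OF \<mu>(2)] by simp
  have swap: "(\<integral>\<^sup>+x. f (- x) \<partial>\<mu>) = (\<integral>\<^sup>+x. f x \<partial>\<mu>)" if [measurable]: "f \<in> borel_measurable borel" for f :: "real \<Rightarrow> ennreal"
    by (subst (2) sym[symmetric], subst nn_integral_distr) auto
  have [measurable]: "(cosh :: real \<Rightarrow> real) \<in> borel_measurable borel"
    by (intro borel_measurable_continuous_onI continuous_intros)
  have int_cosh: "(\<integral>\<^sup>+x. ennreal (cosh (s * x)) \<partial>\<mu>) = (\<integral>\<^sup>+x. ennreal (exp (s * x)) \<partial>\<mu>)" for s
  proof -
    have "2 * (\<integral>\<^sup>+x. ennreal (cosh (s * x)) \<partial>\<mu>) = (\<integral>\<^sup>+x. 2 * ennreal (cosh (s * x)) \<partial>\<mu>)"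
      by (rule nn_integral_cmult[symmetric]) simp
    also have "\<dots> = (\<integral>\<^sup>+x. ennreal (exp (s * x)) + ennreal (exp (s * - x)) \<partial>\<mu>)"
    proof (rule nn_integral_cong)
      fix x
      have "2 * ennreal (cosh (s * x)) = ennreal (2 * cosh (s * x))"
        by (simp add: ennreal_mult)
      also have "2 * cosh (s * x) = exp (s * x) + exp (s * - x)" by (simp add: cosh_def)
      finally show "2 * ennreal (cosh (s * x)) = ennreal (exp (s * x)) + ennreal (exp (s * - x))"
        by simp
    qed
    also have "\<dots> = (\<integral>\<^sup>+x. ennreal (exp (s * x)) \<partial>\<mu>) + (\<integral>\<^sup>+x. ennreal (exp (s * - x)) \<partial>\<mu>)"
      by (rule nn_integral_add) auto
    also have "\<dots> = 2 * (\<integral>\<^sup>+x. ennreal (exp (s * x)) \<partial>\<mu>)"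
      using swap[of "\<lambda>x. ennreal (exp (s * x))"] by (simp add: mult_2)
    finally show ?thesis by (simp add: ennreal_mult_cancel_left)
  qed
  obtain c c' where c: "c > 0" "c' > 0" "\<And>x. x > 0 \<Longrightarrow> 1 - cdf \<mu> x \<le> c * exp (- c' * x powr \<alpha>)"
    using tail unfolding tail_class_upper_def by blast
  have right: "prob {u<..} \<le> c * exp (- c' * u powr \<alpha>)" if "u > 0" for u
  proof -
    have "prob {u<..} = prob (space \<mu> - {..u})" by (rule arg_cong[of _ _ prob]) (auto simp: space)
    also have "\<dots> = 1 - cdf \<mu> u" unfolding cdf_def by (rule prob_compl) auto
    finally show ?thesis using c(3)[OF that] by simp
  qed
  have left: "prob {..<-u} = prob {u<..}" for u
  proof -
    have "prob {u<..} = measure (distr \<mu> borel uminus) {u<..}" by (simp add: sym)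
    also have "\<dots> = prob (uminus -` {u<..} \<inter> space \<mu>)" by (rule measure_distr) auto
    also have "uminus -` {u<..} \<inter> space \<mu> = {..<-u}" by (auto simp: space)
    finally show ?thesis by simp
  qed
  define K where "K = (\<integral>\<^sup>+x. ennreal (exp (c' / 2 * \<bar>x\<bar> powr \<alpha>)) \<partial>\<mu>)"
  have "K < \<infinity>" unfolding K_def
  proof (rule nn_integral_exp_of_tail[of _ "2 * c"])
    fix t :: real assume t: "t > 0"
    define u where "u = t powr (1 / \<alpha>)"
    have u: "u > 0" "u powr \<alpha> = t" using t \<alpha> by (auto simp: u_def powr_powr)
    have sub: "{x \<in> space \<mu>. \<bar>x\<bar> powr \<alpha> > t} \<subseteq> {u<..} \<union> {..<-u}"
    proof
      fix x assume x: "x \<in> {x \<in> space \<mu>. \<bar>x\<bar> powr \<alpha> > t}"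
      have "\<bar>x\<bar> > u"
      proof (rule ccontr)
        assume "\<not> u < \<bar>x\<bar>"
        then have "\<bar>x\<bar> powr \<alpha> \<le> u powr \<alpha>" using \<alpha> by (intro powr_mono2) auto
        then show False using x u by simp
      qed
      then show "x \<in> {u<..} \<union> {..<-u}" by auto
    qed
    have "prob {x \<in> space \<mu>. \<bar>x\<bar> powr \<alpha> > t} \<le> prob ({u<..} \<union> {..<-u})"
      by (rule finite_measure_mono[OF sub]) simp
    also have "\<dots> \<le> prob {u<..} + prob {..<-u}" by (rule measure_Un_le) auto
    also have "\<dots> \<le> 2 * c * exp (- c' * t)" using right[OF u(1)] unfolding left u by simp
    finally show "prob {x \<in> space \<mu>. \<bar>x\<bar> powr \<alpha> > t} \<le> 2 * c * exp (- c' * t)" .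
  qed (use c in auto)
  then obtain k where k: "k \<ge> 0" "K = ennreal k" by (cases K) auto
  have "1 = (\<integral>\<^sup>+x. 1 \<partial>\<mu>)" using emeasure_space_1 by simp
  also have "\<dots> \<le> K" unfolding K_def using c
    by (intro nn_integral_mono) (simp add: ennreal_leI)
  finally have k1: "k \<ge> 1" using k by simp
  define \<beta> where "\<beta> = \<alpha> / (\<alpha> - 1)"
  define C1 where "C1 = (1 / (c' / 2)) powr (1 / (\<alpha> - 1))"
  have C1: "C1 \<ge> 0" by (simp add: C1_def)
  have big: "(\<integral>\<^sup>+x. ennreal (exp (s * x)) \<partial>\<mu>) \<le> ennreal (k * exp (C1 * \<bar>s\<bar> powr \<beta>))" for s
  proof -
    have "(\<integral>\<^sup>+x. ennreal (exp (s * x)) \<partial>\<mu>) \<le>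
      (\<integral>\<^sup>+x. ennreal (exp (C1 * \<bar>s\<bar> powr \<beta>)) * ennreal (exp (c' / 2 * \<bar>x\<bar> powr \<alpha>)) \<partial>\<mu>)"
    proof (rule nn_integral_mono)
      fix x
      have "s * x \<le> \<bar>s\<bar> * \<bar>x\<bar>" by (metis abs_ge_self abs_mult)
      also have "\<dots> \<le> c' / 2 * \<bar>x\<bar> powr \<alpha> + C1 * \<bar>s\<bar> powr \<beta>"
        unfolding C1_def \<beta>_def by (rule mult_le_powr_conjugate) (use \<alpha> c in auto)
      finally have "exp (s * x) \<le> exp (C1 * \<bar>s\<bar> powr \<beta>) * exp (c' / 2 * \<bar>x\<bar> powr \<alpha>)"
        by (simp add: exp_add[symmetric] add.commute)
      then show "ennreal (exp (s * x)) \<le> ennreal (exp (C1 * \<bar>s\<bar> powr \<beta>)) * ennreal (exp (c' / 2 * \<bar>x\<bar> powr \<alpha>))"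
        by (simp add: ennreal_mult[symmetric] ennreal_leI)
    qed
    also have "\<dots> = ennreal (exp (C1 * \<bar>s\<bar> powr \<beta>)) * K" unfolding K_def
      by (rule nn_integral_cmult) simp
    also have "\<dots> = ennreal (k * exp (C1 * \<bar>s\<bar> powr \<beta>))"
      using k by (simp add: ennreal_mult mult.commute)
    finally show ?thesis .
  qed
  define m where "m = k * exp (C1 * 2 powr \<beta>)"
  have m: "m \<ge> 0" using k by (simp add: m_def)
  have cosh2: "(\<integral>\<^sup>+x. ennreal (cosh (2 * x)) \<partial>\<mu>) \<le> ennreal m"
    using big[of 2] by (simp add: int_cosh m_def)
  have small: "(\<integral>\<^sup>+x. ennreal (exp (s * x)) \<partial>\<mu>) \<le> ennreal (exp (m * s\<^sup>2))" if s: "\<bar>s\<bar> \<le> 1" for s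
  proof -
    have "(\<integral>\<^sup>+x. ennreal (exp (s * x)) \<partial>\<mu>) = (\<integral>\<^sup>+x. ennreal (cosh (s * x)) \<partial>\<mu>)"
      by (rule int_cosh[symmetric])
    also have "\<dots> \<le> (\<integral>\<^sup>+x. 1 + ennreal (s\<^sup>2) * ennreal (cosh (2 * x)) \<partial>\<mu>)"
    proof (rule nn_integral_mono)
      fix x
      have "cosh (s * x) = cosh (\<bar>s\<bar> * x)"
        using cosh_real_abs[of "s * x"] cosh_real_abs[of "\<bar>s\<bar> * x"] by (simp add: abs_mult)
      also have "\<dots> \<le> 1 + \<bar>s\<bar>\<^sup>2 * cosh (2 * x)" by (rule cosh_scaled_le) (use s in auto)
      finally have "ennreal (cosh (s * x)) \<le> ennreal (1 + s\<^sup>2 * cosh (2 * x))" by (intro ennreal_leI) simp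
      then show "ennreal (cosh (s * x)) \<le> 1 + ennreal (s\<^sup>2) * ennreal (cosh (2 * x))"
        by (simp add: ennreal_mult)
    qed
    also have "\<dots> = 1 + ennreal (s\<^sup>2) * (\<integral>\<^sup>+x. ennreal (cosh (2 * x)) \<partial>\<mu>)"
      using emeasure_space_1 by (simp add: nn_integral_add nn_integral_cmult)
    also have "\<dots> \<le> 1 + ennreal (s\<^sup>2) * ennreal m"
      by (intro add_left_mono mult_left_mono cosh2) auto
    also have "\<dots> = ennreal (1 + m * s\<^sup>2)" using m by (simp add: ennreal_mult mult.commute)
    also have "\<dots> \<le> ennreal (exp (m * s\<^sup>2))" by (intro ennreal_leI exp_ge_add_one_self)
    finally show ?thesis .
  qed
  \<comment> \<open>\<open>m\<close> serves \<bar>s\<bar> \<le> 1. For larger \<bar>s\<bar> the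
    prefactor \<open>k \<ge> 1\<close> enters the exponent as \<open>ln k \<ge> 0\<close>, where it
    may be multiplied by a power that is at least one.\<close>
  define C where "C = max m (C1 + ln k)"
  have "(\<integral>\<^sup>+x. ennreal (exp (s * x)) \<partial>\<mu>) \<le> ennreal (exp (C * mgf_exponent \<beta> \<bar>s\<bar>))" for s
  proof (cases "\<bar>s\<bar> \<le> 1")
    case True
    have "exp (m * s\<^sup>2) \<le> exp (C * s\<^sup>2)" by (simp add: C_def mult_right_mono)
    with small[OF True] True show ?thesis
      by (auto simp: mgf_exponent_def intro: order_trans ennreal_leI)
  next
    case False
    have b0: "\<beta> \<ge> 0" using \<alpha> by (simp add: \<beta>_def)
    have "\<bar>s\<bar> powr \<beta> \<ge> 1" using False b0 by (intro ge_one_powr_ge_zero) auto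
    then have "ln k \<le> ln k * \<bar>s\<bar> powr \<beta>"
      using k1 mult_left_mono[of 1 "\<bar>s\<bar> powr \<beta>" "ln k"] by simp
    then have "C1 * \<bar>s\<bar> powr \<beta> + ln k \<le> (C1 + ln k) * \<bar>s\<bar> powr \<beta>" by (simp add: algebra_simps)
    also have "\<dots> \<le> C * \<bar>s\<bar> powr \<beta>" by (intro mult_right_mono) (auto simp: C_def)
    finally have "exp (C1 * \<bar>s\<bar> powr \<beta> + ln k) \<le> exp (C * \<bar>s\<bar> powr \<beta>)" by simp
    then have "k * exp (C1 * \<bar>s\<bar> powr \<beta>) \<le> exp (C * \<bar>s\<bar> powr \<beta>)"
      using k1 by (simp add: exp_add mult.commute)
    with big[of s] False show ?thesis
      by (auto simp: mgf_exponent_def intro: order_trans ennreal_leI)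
  qed
  moreover have "C \<ge> 0" using m by (simp add: C_def)
  ultimately show ?thesis using that unfolding \<beta>_def by blast
qed

section \<open>The upper bound\<close>

fun free_harness ::
  "(int ^ 'd \<Rightarrow> int ^ 'd \<Rightarrow> real) \<Rightarrow> (int \<Rightarrow> int ^ 'd \<Rightarrow> real) \<Rightarrow> nat \<Rightarrow> int ^ 'd \<Rightarrow> real" where
  "free_harness p e 0 i = 0"
| "free_harness p e (Suc n) i = matrix_apply p (free_harness p e n) i + e (int (Suc n)) i"

context harness_matrix
begin

text \<open>A finite box containing the support of \<open>heat k\<close>; it acts as the backward
  light cone of a site.\<close>

definition reach :: "nat \<Rightarrow> (int ^ 'd) set" where
  "reach k = {z. max_abs z \<le> step_range * k}"

lemma finite_reach [simp]: "finite (reach k)"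
  unfolding reach_def by (rule finite_box)

lemma card_reach_le: "real (card (reach k)) \<le> (2 * real step_range * real k + 1) ^ CARD('d)"
  unfolding reach_def by (simp add: card_box algebra_simps)

lemma reach_step: "s \<in> steps \<Longrightarrow> z \<in> reach k \<Longrightarrow> s + z \<in> reach (Suc k)"
  using max_abs_add[of s z] max_abs_step[of s] by (auto simp: reach_def)

lemma reach_mono: "k \<le> l \<Longrightarrow> reach k \<subseteq> reach l"
  unfolding reach_def using mult_le_mono2 order_trans by blast

text \<open>Decomposition by the first step of the walk: extending the inner sum to
  \<open>reach (Suc k)\<close> adds only zeros, by \<open>heat_support\<close>. It drives the
  inductions in \<open>free_harness_eq\<close> and \<open>expected_survival_le\<close>.\<close>

lemma heat_step:
  "(\<Sum>s\<in>steps. p 0 s * (\<Sum>z\<in>reach k. heat k z * g (s + z))) = (\<Sum>z\<in>reach (Suc k). heat (Suc k) z * g z)"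
proof -
  have "(\<Sum>z\<in>reach k. heat k z * g (s + z)) = (\<Sum>z\<in>reach (Suc k). heat k (z - s) * g z)" if s: "s \<in> steps" for s
  proof -
    have "(\<Sum>z\<in>reach k. heat k z * g (s + z)) = (\<Sum>z\<in>(\<lambda>z. s + z) ` reach k. heat k (z - s) * g z)"
      by (subst sum.reindex) auto
    also have "\<dots> = (\<Sum>z\<in>reach (Suc k). heat k (z - s) * g z)"
    proof (rule sum.mono_neutral_left)
      show "(\<lambda>z. s + z) ` reach k \<subseteq> reach (Suc k)" using reach_step[OF s] by auto
      show "\<forall>z\<in>reach (Suc k) - (\<lambda>z. s + z) ` reach k. heat k (z - s) * g z = 0"
      proof
        fix z assume "z \<in> reach (Suc k) - (\<lambda>z. s + z) ` reach k"
        then have "z - s \<notin> reach k" by (metis DiffD2 add.commute diff_add_cancel image_eqI)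
        then show "heat k (z - s) * g z = 0" using heat_support[of k "z - s"] by (auto simp: reach_def)
      qed
    qed simp
    finally show ?thesis .
  qed
  then have "(\<Sum>s\<in>steps. p 0 s * (\<Sum>z\<in>reach k. heat k z * g (s + z))) =
     (\<Sum>s\<in>steps. \<Sum>z\<in>reach (Suc k). p 0 s * heat k (z - s) * g z)"
    by (simp add: sum_distrib_left mult.assoc)
  also have "\<dots> = (\<Sum>z\<in>reach (Suc k). \<Sum>s\<in>steps. p 0 s * heat k (z - s) * g z)" by (rule sum.swap)
  finally show ?thesis by (simp add: sum_distrib_right)
qed

lemma sum_heat_0: "(\<Sum>z\<in>reach 0. heat 0 z * g z) = g 0"
proof -
  have "(\<Sum>z\<in>reach 0. heat 0 z * g z) = (\<Sum>z\<in>{0}. heat 0 z * g z)"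
    by (rule sum.mono_neutral_right[OF finite_reach]) (auto simp: reach_def)
  then show ?thesis by simp
qed

text \<open>Unrolling the linear recursion: noise of age \<open>k\<close>, at displacement
  \<open>z\<close>, arrives with weight \<open>heat k z\<close>.\<close>

lemma free_harness_eq:
  "free_harness p e n i = (\<Sum>k<n. \<Sum>z\<in>reach k. heat k z * e (int (n - k)) (i + z))"
proof (induction n arbitrary: i)
  case (Suc n)
  have "matrix_apply p (free_harness p e n) i =
      (\<Sum>k<n. \<Sum>s\<in>steps. p 0 s * (\<Sum>z\<in>reach k. heat k z * e (int (n - k)) (i + (s + z))))"
    unfolding matrix_apply_eq Suc sum_distrib_left by (subst sum.swap) (simp add: add.assoc)
  also have "\<dots> = (\<Sum>k<n. \<Sum>z\<in>reach (Suc k). heat (Suc k) z * e (int (n - k)) (i + z))"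
    by (intro sum.cong refl heat_step[where g = "\<lambda>z. e _ (i + z)"])
  finally show ?case
    using sum_heat_0[of "\<lambda>z. e (int (Suc n)) (i + z)"]
    by (simp add: sum.lessThan_Suc_shift del: sum.lessThan_Suc heat.simps)
qed simp

text \<open>Induction on time inside the cone \<open>reach (n - m)\<close>, which shrinks by one
  step length per unit of time, so \<open>L\<close> has to work only on a finite region. Averaging
  preserves the bound because constants are invariant, and lifting by the wall preserves it by the
  choice of \<open>L\<close>. The positive part of the wall covers the initial surface as
  well.\<close>

lemma harness_le_free:
  assumes w: "\<And>j. w j \<noteq> \<infinity>"
    and L: "\<And>m j. m \<le> n \<Longrightarrow> j \<in> reach n \<Longrightarrow> real_of_ereal (max 0 (w j)) \<le> free_harness p e m j + L"
    and "m \<le> n" "i \<in> reach (n - m)"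
  shows "harness p w e m i \<le> free_harness p e m i + L"
  using assms(3,4)
proof (induction m arbitrary: i)
  case 0
  then show ?case using L[of 0 i] by simp
next
  case (Suc m)
  define y where "y = matrix_apply p (harness p w e m) i + e (int (Suc m)) i"
  have "matrix_apply p (harness p w e m) i \<le> (\<Sum>s\<in>steps. p 0 s * (free_harness p e m (i + s) + L))"
    unfolding matrix_apply_eq
  proof (intro sum_mono mult_left_mono nonneg Suc.IH)
    fix s assume "s \<in> steps"
    moreover have "n - m = Suc (n - Suc m)" using Suc.prems by simp
    ultimately show "i + s \<in> reach (n - m)"
      using reach_step[of s i "n - Suc m"] Suc.prems by (simp add: add.commute)
  qed (use Suc.prems in auto)
  also have "\<dots> = matrix_apply p (free_harness p e m) i + L"
    by (simp add: matrix_apply_eq distrib_left sum.distrib sum_distrib_right[symmetric] sum_steps)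
  finally have y: "y \<le> free_harness p e (Suc m) i + L" by (simp add: y_def)
  have "i \<in> reach n" using Suc.prems reach_mono[of "n - Suc m" n] by auto
  then have Wi: "real_of_ereal (max 0 (w i)) \<le> free_harness p e (Suc m) i + L"
    using L[of "Suc m" i] Suc.prems by simp
  show ?case
  proof (cases "w i = -\<infinity>")
    case True
    then show ?thesis using y by (simp add: y_def)
  next
    case False
    then obtain r where r: "w i = ereal r" using w[of i] by (cases "w i") auto
    have "harness p w e (Suc m) i = r + max 0 (y - r)" using r by (simp add: y_def Let_def)
    also have "\<dots> = max r y" by simp
    also have "r \<le> real_of_ereal (max 0 (w i))" using r by (simp add: max_def zero_ereal_def)
    finally show ?thesis using y Wi by linarith
  qed
qed

end

lemma prod_mono_ennreal:
  fixes f g :: "'b \<Rightarrow> ennreal"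
  assumes "\<And>i. i \<in> A \<Longrightarrow> f i \<le> g i"
  shows "prod f A \<le> prod g A"
  using assms by (induction A rule: infinite_finite_induct) (auto intro!: mult_mono)

section \<open>Exponential moments of the free process and of the wall\<close>

context harness_process
begin

lemma eps_measurable [measurable]: "eps n i \<in> borel_measurable M"
  using noise_indep unfolding indep_vars_def2 by auto

lemma W_measurable [measurable]: "W i \<in> borel_measurable M"
  using wall_indep unfolding indep_vars_def2 by auto

lemma noise_prob_space: "prob_space \<mu>"
  using prob_space_distr[OF eps_measurable[of 0 0]] by (simp add: noise_law)

lemma sets_noise [measurable_cong, simp]: "sets \<mu> = sets borel"
  using sets_distr[of M borel "eps 0 0"] by (simp add: noise_law)

lemma sets_wall [measurable_cong, simp]: "sets \<nu> = sets borel"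
  using sets_distr[of M borel "W 0"] by (simp add: wall_law)

text \<open>The free process is a finite linear combination of independent noise variables, so its
  exponential moment is a product of exponential moments, each bounded by \<open>C\<close>.\<close>

lemma free_mgf_le:
  assumes C: "\<And>s. (\<integral>\<^sup>+x. ennreal (exp (s * x)) \<partial>\<mu>) \<le> ennreal (exp (C * mgf_exponent \<beta> \<bar>s\<bar>))"
  shows "(\<integral>\<^sup>+\<omega>. ennreal (exp (t * free_harness p (\<lambda>n j. eps n j \<omega>) m i)) \<partial>M) \<le>
    ennreal (exp (C * (\<Sum>k<m. \<Sum>z\<in>reach k. mgf_exponent \<beta> (\<bar>t\<bar> * heat k z))))"
proof -
  define I where "I = Sigma {..<m} reach"
  have I: "finite I" by (auto simp: I_def)
  define f where "f y = (int (m - fst y), i + snd y)" for y :: "nat \<times> (int ^ 'd)"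
  define a where "a y = t * heat (fst y) (snd y)" for y :: "nat \<times> (int ^ 'd)"
  have inj: "inj_on f I" by (auto simp: inj_on_def f_def I_def)
  \<comment> \<open>Coefficients are indexed by age and displacement, noise variables by time and
    site; \<open>b\<close> carries the former over along the injection \<open>f\<close>.\<close>
  define b where "b x = a (inv_into I f x)" for x
  have b: "b (f y) = a y" if "y \<in> I" for y using inj that by (simp add: b_def)
  let ?X = "\<lambda>(n, i). eps n i"
  have "t * free_harness p (\<lambda>n j. eps n j \<omega>) m i = (\<Sum>y\<in>I. a y * ?X (f y) \<omega>)" for \<omega>
    unfolding free_harness_eq I_def
    by (subst sum.Sigma)
      (auto simp: sum_distrib_left a_def f_def mult.assoc intro!: sum.cong simp del: of_nat_diff)
  also have "(\<Sum>y\<in>I. a y * ?X (f y) \<omega>) = (\<Sum>x\<in>f ` I. b x * ?X x \<omega>)" for \<omega>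
    by (subst sum.reindex[OF inj]) (auto intro!: sum.cong simp: b)
  finally have e: "ennreal (exp (t * free_harness p (\<lambda>n j. eps n j \<omega>) m i)) =
      (\<Prod>x\<in>f ` I. ennreal (exp (b x * ?X x \<omega>)))" for \<omega>
    using I by (simp add: exp_sum prod_ennreal)
  have ind: "indep_vars (\<lambda>_. borel) (\<lambda>x \<omega>. ennreal (exp (b x * ?X x \<omega>))) (f ` I)"
    by (rule indep_vars_compose2[OF indep_vars_subset[OF noise_indep], where Y = "\<lambda>x v. ennreal (exp (b x * v))"]) auto
  have "(\<integral>\<^sup>+\<omega>. ennreal (exp (t * free_harness p (\<lambda>n j. eps n j \<omega>) m i)) \<partial>M) =
      (\<Prod>x\<in>f ` I. \<integral>\<^sup>+\<omega>. ennreal (exp (b x * ?X x \<omega>)) \<partial>M)"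
    unfolding e by (rule indep_vars_nn_integral[OF _ ind]) (use I in auto)
  also have "\<dots> \<le> (\<Prod>x\<in>f ` I. ennreal (exp (C * mgf_exponent \<beta> \<bar>b x\<bar>)))"
  proof (rule prod_mono_ennreal)
    fix x :: "int \<times> (int ^ 'd)"
    obtain n j where x: "x = (n, j)" by (cases x)
    have "(\<integral>\<^sup>+\<omega>. ennreal (exp (b x * ?X x \<omega>)) \<partial>M) = (\<integral>\<^sup>+v. ennreal (exp (b x * v)) \<partial>distr M borel (eps n j))"
      by (subst nn_integral_distr) (auto simp: x)
    also have "\<dots> \<le> ennreal (exp (C * mgf_exponent \<beta> \<bar>b x\<bar>))" unfolding noise_law by (rule C)
    finally show "(\<integral>\<^sup>+\<omega>. ennreal (exp (b x * ?X x \<omega>)) \<partial>M) \<le> \<dots>" .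
  qed
  also have "\<dots> = ennreal (exp (\<Sum>x\<in>f ` I. C * mgf_exponent \<beta> \<bar>b x\<bar>))"
    using I by (simp add: prod_ennreal exp_sum)
  also have "(\<Sum>x\<in>f ` I. C * mgf_exponent \<beta> \<bar>b x\<bar>) = (\<Sum>y\<in>I. C * mgf_exponent \<beta> (\<bar>t\<bar> * heat (fst y) (snd y)))"
    by (subst sum.reindex[OF inj]) (auto intro!: sum.cong simp: b a_def abs_mult heat_nonneg)
  also have "\<dots> = C * (\<Sum>k<m. \<Sum>z\<in>reach k. mgf_exponent \<beta> (\<bar>t\<bar> * heat k z))"
    unfolding I_def by (simp add: sum_distrib_left sum.Sigma split_beta)
  finally show ?thesis .
qed

text \<open>The \<theta>-th power of the positive part has an exponential tail, so half its rate is
  an admissible exponent. Equal laws give one \<open>K\<close> for all sites.\<close>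

lemma wall_mgf_bound:
  assumes tail: "ecdf \<nu> \<in> \<L>\<^sup>- \<theta>" and \<theta>: "\<theta> > 0"
  obtains \<kappa> K where "\<kappa> > 0" "K \<ge> 0"
    "\<And>j. (\<integral>\<^sup>+\<omega>. ennreal (exp (\<kappa> * real_of_ereal (max 0 (W j \<omega>)) powr \<theta>)) \<partial>M) \<le> ennreal K"
proof -
  obtain c c' where c: "c > 0" "c' > 0" "\<And>x. x > 0 \<Longrightarrow> 1 - ecdf \<nu> x \<le> c * exp (- c' * x powr \<theta>)"
    using tail unfolding tail_class_upper_def by blast
  let ?Y = "\<lambda>w. real_of_ereal (max 0 w) powr \<theta>"
  have fin: "(\<integral>\<^sup>+\<omega>. ennreal (exp (c' / 2 * ?Y (W j \<omega>))) \<partial>M) < \<infinity>" for j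
  proof (rule nn_integral_exp_of_tail[of _ c])
    fix t :: real assume t: "t > 0"
    define u where "u = t powr (1 / \<theta>)"
    have u: "u > 0" "u powr \<theta> = t" using t \<theta> by (auto simp: u_def powr_powr)
    have "{\<omega> \<in> space M. t < ?Y (W j \<omega>)} \<subseteq> space M - (W j -` {..ereal u} \<inter> space M)"
    proof safe
      fix \<omega> assume *: "t < ?Y (W j \<omega>)" "W j \<omega> \<le> ereal u"
      then have "real_of_ereal (max 0 (W j \<omega>)) \<le> u"
        using u(1) by (cases "W j \<omega>") (auto simp: max_def zero_ereal_def)
      then have "?Y (W j \<omega>) \<le> u powr \<theta>" using \<theta> by (intro powr_mono2 real_of_ereal_pos) auto
      then show False using * u by simp
    qed
    then have "prob {\<omega> \<in> space M. t < ?Y (W j \<omega>)} \<le> prob (space M - (W j -` {..ereal u} \<inter> space M))"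
      by (rule finite_measure_mono) measurable
    also have "\<dots> = 1 - prob (W j -` {..ereal u} \<inter> space M)"
      by (rule prob_compl) measurable
    also have "prob (W j -` {..ereal u} \<inter> space M) = measure (distr M borel (W j)) {..ereal u}"
      by (rule measure_distr[symmetric]) auto
    also have "\<dots> = ecdf \<nu> u" by (simp add: wall_law ecdf_def)
    also have "1 - ecdf \<nu> u \<le> c * exp (- c' * t)" using c(3)[OF u(1)] u by simp
    finally show "prob {\<omega> \<in> space M. t < ?Y (W j \<omega>)} \<le> c * exp (- c' * t)" .
  qed (use c in auto)
  have eq: "(\<integral>\<^sup>+\<omega>. ennreal (exp (c' / 2 * ?Y (W j \<omega>))) \<partial>M) = (\<integral>\<^sup>+w. ennreal (exp (c' / 2 * ?Y w)) \<partial>\<nu>)" for j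
    unfolding wall_law[of j, symmetric] by (subst nn_integral_distr) auto
  obtain K where K: "K \<ge> 0" "(\<integral>\<^sup>+w. ennreal (exp (c' / 2 * ?Y w)) \<partial>\<nu>) = ennreal K"
    using fin[of 0] unfolding eq by (cases "\<integral>\<^sup>+w. ennreal (exp (c' / 2 * ?Y w)) \<partial>\<nu>") auto
  show ?thesis by (rule that[of "c' / 2" K]) (use c K eq in auto)
qed

lemma free_measurable [measurable]:
  "(\<lambda>\<omega>. free_harness p (\<lambda>n j. eps n j \<omega>) m i) \<in> borel_measurable M"
  unfolding free_harness_eq by measurable

lemma free_abs_mgf_le:
  assumes C: "\<And>s. (\<integral>\<^sup>+x. ennreal (exp (s * x)) \<partial>\<mu>) \<le> ennreal (exp (C * mgf_exponent \<beta> \<bar>s\<bar>))"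
    and t: "t \<ge> 0" and D: "C * (\<Sum>k<m. \<Sum>z\<in>reach k. mgf_exponent \<beta> (t * heat k z)) \<le> D"
  shows "(\<integral>\<^sup>+\<omega>. ennreal (exp (t * \<bar>free_harness p (\<lambda>n j. eps n j \<omega>) m i\<bar>)) \<partial>M) \<le> ennreal (2 * exp D)"
proof -
  let ?\<xi> = "\<lambda>\<omega>. free_harness p (\<lambda>n j. eps n j \<omega>) m i"
  have "(\<integral>\<^sup>+\<omega>. ennreal (exp (t * \<bar>?\<xi> \<omega>\<bar>)) \<partial>M) \<le>
     (\<integral>\<^sup>+\<omega>. ennreal (exp (t * ?\<xi> \<omega>)) + ennreal (exp ((- t) * ?\<xi> \<omega>)) \<partial>M)"
  proof (rule nn_integral_mono)
    fix \<omega>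
    have "exp (t * \<bar>?\<xi> \<omega>\<bar>) \<le> exp (t * ?\<xi> \<omega>) + exp ((- t) * ?\<xi> \<omega>)"
      by (cases "?\<xi> \<omega> \<ge> 0") (auto simp: abs_if)
    then show "ennreal (exp (t * \<bar>?\<xi> \<omega>\<bar>)) \<le> ennreal (exp (t * ?\<xi> \<omega>)) + ennreal (exp ((- t) * ?\<xi> \<omega>))"
      by (simp add: ennreal_leI flip: ennreal_plus)
  qed
  also have "\<dots> = (\<integral>\<^sup>+\<omega>. ennreal (exp (t * ?\<xi> \<omega>)) \<partial>M) + (\<integral>\<^sup>+\<omega>. ennreal (exp ((- t) * ?\<xi> \<omega>)) \<partial>M)"
    by (rule nn_integral_add) auto
  also have "\<dots> \<le> ennreal (exp D) + ennreal (exp D)"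
  proof (intro add_mono)
    have *: "\<bar>t\<bar> = t" "\<bar>- t\<bar> = t" using t by auto
    show "(\<integral>\<^sup>+\<omega>. ennreal (exp (t * ?\<xi> \<omega>)) \<partial>M) \<le> ennreal (exp D)"
      using free_mgf_le[OF C, of t m i] D unfolding * by (meson ennreal_leI exp_le_cancel_iff order_trans)
    show "(\<integral>\<^sup>+\<omega>. ennreal (exp ((- t) * ?\<xi> \<omega>)) \<partial>M) \<le> ennreal (exp D)"
      using free_mgf_le[OF C, of "- t" m i] D unfolding * by (meson ennreal_leI exp_le_cancel_iff order_trans)
  qed
  also have "\<dots> = ennreal (2 * exp D)" by (simp flip: ennreal_plus)
  finally show ?thesis .
qed

end

text \<open>Serves to recover a height from its \<theta>-th power, with
  \<open>r = 1 / \<theta>\<close>. Below \<open>2 * L\<close> the first term suffices; above it,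
  \<open>y / 2 \<le> y - L\<close>, and the power is dominated through \<open>x \<le> exp x\<close>
  at \<open>x = \<kappa> * y / (2 * r)\<close>.\<close>

lemma powr_le_add_exp:
  fixes y L \<kappa> r :: real
  assumes "y \<ge> 0" "L \<ge> 0" "\<kappa> > 0" "r > 0"
  shows "y powr r \<le> 2 powr r * L powr r + (2 * r / \<kappa>) powr r * exp (\<kappa> * (y - L))"
proof (cases "y \<le> 2 * L")
  case True
  then have "y powr r \<le> (2 * L) powr r" using assms by (intro powr_mono2) auto
  also have "\<dots> = 2 powr r * L powr r" using assms by (simp add: powr_mult)
  finally show ?thesis by (simp add: add_increasing2)
next
  case False
  define x where "x = \<kappa> * y / (2 * r)"
  have x: "x \<ge> 0" using assms by (simp add: x_def)
  have "y powr r = (2 * r / \<kappa> * x) powr r" using assms by (simp add: x_def)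
  also have "\<dots> = (2 * r / \<kappa>) powr r * x powr r" using assms x by (intro powr_mult)
  also have "x powr r \<le> exp x powr r"
    using x assms exp_ge_add_one_self[of x] by (intro powr_mono2) linarith+
  also have "exp x powr r = exp (\<kappa> * (y / 2))" using assms by (simp add: powr_def x_def)
  also have "\<dots> \<le> exp (\<kappa> * (y - L))" using False assms by simp
  finally show ?thesis using assms by (simp add: mult_left_mono add_increasing)
qed

lemma le_add_exp:
  fixes x A t :: real
  assumes "t > 0"
  shows "x \<le> A + exp (t * x - t * A) / t"
proof -
  have "t * (x - A) \<le> exp (t * x - t * A)"
    using exp_ge_add_one_self[of "t * x - t * A"] unfolding right_diff_distrib by linarith
  then show ?thesis using assms by (simp add: field_simps)
qed

context harness_process
begin

text \<open>Each maximum over the region of influence is replaced, pathwise, by a threshold plus the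
  sum of all exponential excesses over it: \<open>A\<close> for the free process, \<open>H\<close>
  for the \<theta>-th power of the wall. The free part counts twice, once in the shift and once for
  the free process at the end point.\<close>

lemma harness_surface_le:
  assumes t: "t > 0" and \<kappa>: "\<kappa> > 0" and \<theta>: "\<theta> > 0" and H: "H \<ge> 0" and \<omega>: "\<omega> \<in> space M"
  shows "harness_surface p eps W n 0 \<omega> \<le>
    2 * (A + (\<Sum>m\<le>n. \<Sum>j\<in>reach n. exp (t * \<bar>free_harness p (\<lambda>n j. eps n j \<omega>) m j\<bar> - t * A) / t))
    + (2 powr (1 / \<theta>) * H powr (1 / \<theta>) + (\<Sum>j\<in>reach n. (2 * (1 / \<theta>) / \<kappa>) powr (1 / \<theta>) *
         exp (\<kappa> * real_of_ereal (max 0 (W j \<omega>)) powr \<theta> - \<kappa> * H)))"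
proof -
  let ?\<xi> = "\<lambda>m j. free_harness p (\<lambda>n j. eps n j \<omega>) m j"
  let ?w = "\<lambda>j. real_of_ereal (max 0 (W j \<omega>))"
  define L1 where "L1 = A + (\<Sum>m\<le>n. \<Sum>j\<in>reach n. exp (t * \<bar>?\<xi> m j\<bar> - t * A) / t)"
  define g where "g j = (2 * (1 / \<theta>) / \<kappa>) powr (1 / \<theta>) * exp (\<kappa> * ?w j powr \<theta> - \<kappa> * H)" for j
  define L2 where "L2 = 2 powr (1 / \<theta>) * H powr (1 / \<theta>) + (\<Sum>j\<in>reach n. g j)"
  have free: "\<bar>?\<xi> m j\<bar> \<le> L1" if "m \<le> n" "j \<in> reach n" for m j
  proof -
    have "\<bar>?\<xi> m j\<bar> \<le> A + exp (t * \<bar>?\<xi> m j\<bar> - t * A) / t" by (rule le_add_exp[OF t])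
    also have "exp (t * \<bar>?\<xi> m j\<bar> - t * A) / t \<le> (\<Sum>j\<in>reach n. exp (t * \<bar>?\<xi> m j\<bar> - t * A) / t)"
      by (rule member_le_sum) (use t that in auto)
    also have "\<dots> \<le> (\<Sum>m\<le>n. \<Sum>j\<in>reach n. exp (t * \<bar>?\<xi> m j\<bar> - t * A) / t)"
      by (rule member_le_sum[of m _ "\<lambda>m. \<Sum>j\<in>reach n. exp (t * \<bar>?\<xi> m j\<bar> - t * A) / t"])
        (use t that in \<open>auto intro!: sum_nonneg\<close>)
    finally show ?thesis by (simp add: L1_def)
  qed
  have wall: "?w j \<le> L2" if "j \<in> reach n" for j
  proof -
    have w0: "?w j \<ge> 0" by (intro real_of_ereal_pos) simp
    have "?w j = (?w j powr \<theta>) powr (1 / \<theta>)" using \<theta> w0 by (simp add: powr_powr)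
    also have "\<dots> \<le> 2 powr (1 / \<theta>) * H powr (1 / \<theta>) + (2 * (1 / \<theta>) / \<kappa>) powr (1 / \<theta>) * exp (\<kappa> * (?w j powr \<theta> - H))"
      by (rule powr_le_add_exp) (use \<theta> \<kappa> H in auto)
    also have "(2 * (1 / \<theta>) / \<kappa>) powr (1 / \<theta>) * exp (\<kappa> * (?w j powr \<theta> - H)) = g j"
      by (simp add: g_def right_diff_distrib)
    also have "g j \<le> (\<Sum>j\<in>reach n. g j)"
      by (rule member_le_sum) (use that in \<open>auto simp: g_def\<close>)
    finally show ?thesis by (simp add: L2_def)
  qed
  have 0: "0 \<in> reach n" by (simp add: reach_def)
  have "harness_surface p eps W n 0 \<omega> \<le> ?\<xi> n 0 + (L1 + L2)"
    unfolding harness_surface_def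
  proof (rule harness_le_free[of "\<lambda>j. W j \<omega>" n])
    show "W j \<omega> \<noteq> \<infinity>" for j using wall_less_infty[OF \<omega>, of j] by auto
    show "?w j \<le> ?\<xi> m j + (L1 + L2)" if "m \<le> n" "j \<in> reach n" for m j
      using free[OF that] wall[OF that(2)] by linarith
  qed (auto simp: reach_def)
  also have "?\<xi> n 0 \<le> L1" using free[of n 0] 0 by simp
  finally have "harness_surface p eps W n 0 \<omega> \<le> 2 * L1 + L2" by simp
  then show ?thesis unfolding L1_def L2_def g_def .
qed

text \<open>The number of space-time points that contribute excesses. Its logarithm, of order
  \<open>(d + 1) * ln n\<close>, determines the thresholds.\<close>

lemma card_reach_poly:
  obtains c where "c \<ge> 0" "\<And>n. n \<ge> 1 \<Longrightarrow> real (Suc n) * real (card (reach n)) \<le> c * real n powr (real CARD('d) + 1)"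
proof -
  define c where "c = 2 * (2 * real step_range + 1) ^ CARD('d)"
  have "real (Suc n) * real (card (reach n)) \<le> c * real n powr (real CARD('d) + 1)" if n: "n \<ge> 1" for n
  proof -
    have "real (card (reach n)) \<le> ((2 * real step_range + 1) * real n) ^ CARD('d)"
      using card_reach_le[of n] n by (rule_tac order_trans) (auto intro!: power_mono simp: algebra_simps)
    moreover have "real (Suc n) \<le> 2 * real n" using n by simp
    ultimately have "real (Suc n) * real (card (reach n)) \<le> 2 * real n * ((2 * real step_range + 1) * real n) ^ CARD('d)"
      by (intro mult_mono) auto
    also have "\<dots> = c * real n powr (real CARD('d) + 1)"
      using n by (simp add: c_def power_mult_distrib powr_add powr_realpow)
    finally show ?thesis .
  qed
  then show ?thesis using that[of c] by (simp add: c_def)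
qed

text \<open>The pathwise bound is integrated term by term as a nonnegative integral, and
  \<open>integral_real_bounded\<close> passes this on to the Bochner integral.\<close>

lemma integral_surface_le:
  assumes t: "t > 0" and \<kappa>: "\<kappa> > 0" and \<theta>: "\<theta> > 0" and H: "H \<ge> 0" and A: "A \<ge> 0" and K: "K \<ge> 0"
    and free: "\<And>m j. m \<le> n \<Longrightarrow> (\<integral>\<^sup>+\<omega>. ennreal (exp (t * \<bar>free_harness p (\<lambda>n j. eps n j \<omega>) m j\<bar>)) \<partial>M) \<le> ennreal (2 * exp D)"
    and wall: "\<And>j. (\<integral>\<^sup>+\<omega>. ennreal (exp (\<kappa> * real_of_ereal (max 0 (W j \<omega>)) powr \<theta>)) \<partial>M) \<le> ennreal K"
  shows "integral\<^sup>L M (harness_surface p eps W n 0) \<le>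
     2 * A + 4 * (real (Suc n) * real (card (reach n))) * exp (D - t * A) / t
     + 2 powr (1 / \<theta>) * H powr (1 / \<theta>)
     + (2 * (1 / \<theta>) / \<kappa>) powr (1 / \<theta>) * K * (real (card (reach n)) * exp (- \<kappa> * H))"
proof (rule integral_real_bounded)
  define a where "a = 2 * A + 2 powr (1 / \<theta>) * H powr (1 / \<theta>)"
  have a: "a \<ge> 0" using A by (simp add: a_def)
  define b where "b = 2 * exp (- t * A) / t"
  have b: "b \<ge> 0" using t by (simp add: b_def)
  define c where "c = (2 * (1 / \<theta>) / \<kappa>) powr (1 / \<theta>) * exp (- \<kappa> * H)"
  have c: "c \<ge> 0" by (simp add: c_def)
  let ?\<xi> = "\<lambda>m j \<omega>. exp (t * \<bar>free_harness p (\<lambda>n j. eps n j \<omega>) m j\<bar>)"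
  let ?w = "\<lambda>j \<omega>. exp (\<kappa> * real_of_ereal (max 0 (W j \<omega>)) powr \<theta>)"
  have "(\<integral>\<^sup>+\<omega>. ennreal (harness_surface p eps W n 0 \<omega>) \<partial>M) \<le>
    (\<integral>\<^sup>+\<omega>. ennreal a + (ennreal b * (\<Sum>m\<le>n. \<Sum>j\<in>reach n. ennreal (?\<xi> m j \<omega>)) + ennreal c * (\<Sum>j\<in>reach n. ennreal (?w j \<omega>))) \<partial>M)"
  proof (rule nn_integral_mono)
    fix \<omega> assume "\<omega> \<in> space M"
    note harness_surface_le[OF t \<kappa> \<theta> H this, of n A]
    also have "2 * (A + (\<Sum>m\<le>n. \<Sum>j\<in>reach n. exp (t * \<bar>free_harness p (\<lambda>n j. eps n j \<omega>) m j\<bar> - t * A) / t))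
    + (2 powr (1 / \<theta>) * H powr (1 / \<theta>) + (\<Sum>j\<in>reach n. (2 * (1 / \<theta>) / \<kappa>) powr (1 / \<theta>) *
         exp (\<kappa> * real_of_ereal (max 0 (W j \<omega>)) powr \<theta> - \<kappa> * H)))
      = a + (b * (\<Sum>m\<le>n. \<Sum>j\<in>reach n. ?\<xi> m j \<omega>) + c * (\<Sum>j\<in>reach n. ?w j \<omega>))"
      by (simp add: a_def b_def c_def sum_distrib_left sum_distrib_right exp_diff exp_minus divide_inverse mult_ac)
    finally have "ennreal (harness_surface p eps W n 0 \<omega>) \<le>
        ennreal (a + (b * (\<Sum>m\<le>n. \<Sum>j\<in>reach n. ?\<xi> m j \<omega>) + c * (\<Sum>j\<in>reach n. ?w j \<omega>)))"
      by (rule ennreal_leI)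
    also have "\<dots> = ennreal a + (ennreal b * (\<Sum>m\<le>n. \<Sum>j\<in>reach n. ennreal (?\<xi> m j \<omega>)) + ennreal c * (\<Sum>j\<in>reach n. ennreal (?w j \<omega>)))"
      using a b c by (simp add: ennreal_plus ennreal_mult sum_ennreal sum_nonneg)
    finally show "ennreal (harness_surface p eps W n 0 \<omega>) \<le> \<dots>" .
  qed
  also have "\<dots> = ennreal a + (ennreal b * (\<Sum>m\<le>n. \<Sum>j\<in>reach n. \<integral>\<^sup>+\<omega>. ennreal (?\<xi> m j \<omega>) \<partial>M)
      + ennreal c * (\<Sum>j\<in>reach n. \<integral>\<^sup>+\<omega>. ennreal (?w j \<omega>) \<partial>M))"
    by (simp add: nn_integral_add nn_integral_cmult nn_integral_sum emeasure_space_1 del: sum_ennreal)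
  also have "\<dots> \<le> ennreal a + (ennreal b * (\<Sum>m\<le>n. \<Sum>j\<in>reach n. ennreal (2 * exp D)) + ennreal c * (\<Sum>j\<in>reach n. ennreal K))"
    by (intro add_mono mult_left_mono sum_mono free wall) auto
  also have "\<dots> = ennreal (a + (b * (\<Sum>m\<le>n. \<Sum>j\<in>reach n. 2 * exp D) + c * (\<Sum>j\<in>reach n. K)))"
    using a b c K by (simp only: sum_ennreal ennreal_mult ennreal_plus sum_nonneg mult_nonneg_nonneg add_nonneg_nonneg
        exp_ge_zero zero_le_numeral flip: ennreal_plus ennreal_mult)
  also have "a + (b * (\<Sum>m\<le>n. \<Sum>j\<in>reach n. 2 * exp D) + c * (\<Sum>j\<in>reach n. K)) =
     2 * A + 4 * (real (Suc n) * real (card (reach n))) * exp (D - t * A) / t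
     + 2 powr (1 / \<theta>) * H powr (1 / \<theta>)
     + (2 * (1 / \<theta>) / \<kappa>) powr (1 / \<theta>) * K * (real (card (reach n)) * exp (- \<kappa> * H))"
    by (simp add: a_def b_def c_def exp_diff exp_minus divide_inverse mult_ac)
  finally show "(\<integral>\<^sup>+\<omega>. ennreal (harness_surface p eps W n 0 \<omega>) \<partial>M) \<le> ennreal
     (2 * A + 4 * (real (Suc n) * real (card (reach n))) * exp (D - t * A) / t
     + 2 powr (1 / \<theta>) * H powr (1 / \<theta>)
     + (2 * (1 / \<theta>) / \<kappa>) powr (1 / \<theta>) * K * (real (card (reach n)) * exp (- \<kappa> * H)))" .
qed (use t A K in \<open>auto intro!: add_nonneg_nonneg mult_nonneg_nonneg divide_nonneg_nonneg\<close>)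

lemma surface_upper_bound:
  assumes dim: "CARD('d) \<ge> 3" and \<alpha>: "\<alpha> > 1" and \<theta>: "\<theta> > 0"
    and noise_tail: "cdf \<mu> \<in> \<L>\<^sup>- \<alpha>" and wall_tail: "ecdf \<nu> \<in> \<L>\<^sup>- \<theta>"
  shows "\<exists>C. \<forall>n\<ge>3. integral\<^sup>L M (harness_surface p eps W n 0)
      \<le> C * (harness_rate CARD('d) \<alpha> n + ln (real n) powr (1 / \<theta>))"
proof -
  define d where "d = real CARD('d)"
  obtain C where C: "C \<ge> 0"
    "\<And>s. (\<integral>\<^sup>+x. ennreal (exp (s * x)) \<partial>\<mu>) \<le> ennreal (exp (C * mgf_exponent (\<alpha> / (\<alpha> - 1)) \<bar>s\<bar>))"
    using symmetric_mgf_bound[OF noise_prob_space sets_noise noise_symmetric noise_tail \<alpha>] by blast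
  obtain C' where C': "C' \<ge> 0"
    "\<And>n. n \<ge> 3 \<Longrightarrow> ln (real n) / harness_rate CARD('d) \<alpha> n \<ge> 1"
    "\<And>n m F. n \<ge> 3 \<Longrightarrow> (\<And>k. finite (F k)) \<Longrightarrow>
       (\<Sum>k<m. \<Sum>x\<in>F k. mgf_exponent (\<alpha> / (\<alpha> - 1)) (ln (real n) / harness_rate CARD('d) \<alpha> n * heat k x))
         \<le> C' * ln (real n)"
    using mgf_exponent_sum_le[OF dim \<alpha>] by blast
  obtain \<kappa> K where \<kappa>: "\<kappa> > 0" and K: "K \<ge> 0"
    "\<And>j. (\<integral>\<^sup>+\<omega>. ennreal (exp (\<kappa> * real_of_ereal (max 0 (W j \<omega>)) powr \<theta>)) \<partial>M) \<le> ennreal K"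
    using wall_mgf_bound[OF wall_tail \<theta>] by blast
  obtain c where c: "c \<ge> 0" "\<And>n. n \<ge> 1 \<Longrightarrow> real (Suc n) * real (card (reach n)) \<le> c * real n powr (d + 1)"
    using card_reach_poly unfolding d_def by blast
  define r where "r = 1 / \<theta>"
  define G where "G = (2 * (1 / \<theta>) / \<kappa>) powr (1 / \<theta>)"
  have G: "G \<ge> 0" by (simp add: G_def)
  define B where "B = 2 * (C * C' + d + 1) + 4 * c"
  define B' where "B' = 2 powr r * ((d + 1) / \<kappa>) powr r + G * K * c"
  have "integral\<^sup>L M (harness_surface p eps W n 0)
      \<le> (B + B') * (harness_rate CARD('d) \<alpha> n + ln (real n) powr (1 / \<theta>))" if n: "n \<ge> 3" for n
  proof -
    define l where "l = ln (real n)"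
    define R where "R = harness_rate CARD('d) \<alpha> n"
    define t where "t = l / R"
    have l: "l > 1" using ln_gt_1[OF n] by (simp add: l_def)
    have t: "t \<ge> 1" using C'(2)[OF n] by (simp add: t_def l_def R_def)
    \<comment> \<open>A nonpositive \<open>R\<close> would make \<open>t = l / R\<close>
      nonpositive, also for \<open>R = 0\<close>, where the quotient is 0.\<close>
    then have R: "R > 0" using l by (smt (verit) divide_nonneg_nonpos t_def zero_less_one)
    \<comment> \<open>In \<open>t * A\<close>, the part \<open>C * C' * l\<close> cancels the
      exponential moment of the free process and \<open>(d + 1) * l\<close> the number of space-time
      points.\<close>
    define A where "A = (C * C' + d + 1) * R"
    have tA: "t * A = (C * C' + d + 1) * l" using R by (simp add: t_def A_def)
    \<comment> \<open>Chosen so that \<open>\<kappa> * H = (d + 1) * l\<close> outweighs the number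
      of wall sites in the region.\<close>
    define H where "H = (d + 1) / \<kappa> * l"
    have kH: "\<kappa> * H = (d + 1) * l" using \<kappa> by (simp add: H_def)
    have np: "exp (- ((d + 1) * l)) * real n powr (d + 1) = 1"
      using n by (simp add: powr_def l_def exp_add[symmetric])
    have card: "real (Suc n) * real (card (reach n)) * exp (- ((d + 1) * l)) \<le> c"
    proof -
      have "real (Suc n) * real (card (reach n)) * exp (- ((d + 1) * l)) \<le> c * real n powr (d + 1) * exp (- ((d + 1) * l))"
        using c(2)[of n] n by (intro mult_right_mono) auto
      also have "\<dots> = c * (exp (- ((d + 1) * l)) * real n powr (d + 1))" by simp
      also have "\<dots> = c" by (simp only: np mult_1_right)
      finally show ?thesis .
    qed
    have "integral\<^sup>L M (harness_surface p eps W n 0) \<le>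
     2 * A + 4 * (real (Suc n) * real (card (reach n))) * exp (C * C' * l - t * A) / t
     + 2 powr (1 / \<theta>) * H powr (1 / \<theta>)
     + (2 * (1 / \<theta>) / \<kappa>) powr (1 / \<theta>) * K * (real (card (reach n)) * exp (- \<kappa> * H))"
    proof (rule integral_surface_le)
      fix m and j :: "int ^ 'd"
      show "(\<integral>\<^sup>+\<omega>. ennreal (exp (t * \<bar>free_harness p (\<lambda>n j. eps n j \<omega>) m j\<bar>)) \<partial>M) \<le> ennreal (2 * exp (C * C' * l))"
      proof (rule free_abs_mgf_le[OF C(2)])
        have "(\<Sum>k<m. \<Sum>z\<in>reach k. mgf_exponent (\<alpha> / (\<alpha> - 1)) (t * heat k z)) \<le> C' * l"
          unfolding t_def l_def R_def by (rule C'(3)[OF n]) simp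
        then show "C * (\<Sum>k<m. \<Sum>z\<in>reach k. mgf_exponent (\<alpha> / (\<alpha> - 1)) (t * heat k z)) \<le> C * C' * l"
          using C(1) by (simp add: mult.assoc mult_left_mono)
      qed (use t in simp)
    qed (use t \<kappa> \<theta> K C C' R l in \<open>auto simp: A_def H_def d_def\<close>)
    also have "4 * (real (Suc n) * real (card (reach n))) * exp (C * C' * l - t * A) / t \<le> 4 * c * R"
    proof -
      have e: "C * C' * l - t * A = - ((d + 1) * l)" unfolding tA by (simp add: algebra_simps)
      have "4 * (real (Suc n) * real (card (reach n))) * exp (C * C' * l - t * A) / t
          = 4 * (real (Suc n) * real (card (reach n)) * exp (- ((d + 1) * l))) * (1 / t)"
        unfolding e by simp
      also have "\<dots> \<le> 4 * c * R"
      proof (intro mult_mono card)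
        show "1 / t \<le> R" using l R by (simp add: t_def field_simps)
      qed (use c t in auto)
      finally show ?thesis .
    qed
    also have "2 powr (1 / \<theta>) * H powr (1 / \<theta>) = 2 powr r * ((d + 1) / \<kappa>) powr r * l powr r"
      using \<kappa> l unfolding H_def r_def by (subst powr_mult) (auto simp: d_def)
    also have "(2 * (1 / \<theta>) / \<kappa>) powr (1 / \<theta>) * K * (real (card (reach n)) * exp (- \<kappa> * H)) \<le> G * K * c * l powr r"
    proof -
      have "real (card (reach n)) * exp (- \<kappa> * H) \<le> real (Suc n) * (real (card (reach n)) * exp (- \<kappa> * H))"
        using mult_right_mono[of 1 "real (Suc n)" "real (card (reach n)) * exp (- \<kappa> * H)"] by simp
      also have "\<dots> \<le> c" using card kH by (simp only: mult.assoc mult_minus_left)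
      finally have "G * K * (real (card (reach n)) * exp (- \<kappa> * H)) \<le> G * K * c"
        using G K by (intro mult_left_mono) auto
      also have "\<dots> \<le> G * K * c * l powr r"
        using mult_left_mono[of 1 "l powr r" "G * K * c"] G K c l \<theta> ge_one_powr_ge_zero[of l r]
        by (simp add: r_def)
      finally show ?thesis by (simp add: G_def)
    qed
    finally have "integral\<^sup>L M (harness_surface p eps W n 0) \<le> B * R + B' * l powr r"
      by (simp add: A_def B_def B'_def algebra_simps)
    also have "\<dots> \<le> (B + B') * R + (B + B') * l powr r"
    proof -
      have "B \<ge> 0" "B' \<ge> 0" using C C' c G K by (auto simp: B_def B'_def d_def)
      then show ?thesis using R by (intro add_mono mult_right_mono) auto
    qed
    finally show ?thesis by (simp add: l_def R_def r_def distrib_left)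
  qed
  then show ?thesis by blast
qed

end

section \<open>The lower bounds\<close>

text \<open>The choice of the level, separated from the process: \<open>E\<close> is the mean height
  and \<open>b h\<close> the mean factor by which a fresh site reduces the deficit below
  \<open>h\<close>. In \<open>E2\<close> the first error is the probability that the walk stays near
  its start, the second that \<open>K\<close> sites all fail to help. \<open>E1\<close> covers the
  finitely many small \<open>n\<close>.\<close>

lemma lower_bound_asymptotics:
  fixes E :: "nat \<Rightarrow> real" and b :: "real \<Rightarrow> real" and v d :: nat
  assumes r: "r > 0" and c1: "c1 > 0" and c2: "c2 > 0" and C: "C \<ge> 0" and d: "d > 0"
    and b: "\<And>h. h > 0 \<Longrightarrow> 0 \<le> b h" "\<And>h. h > 0 \<Longrightarrow> b h \<le> 1 - c1 * exp (- c2 * h powr r)"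
    and E1: "\<And>n h. n \<ge> 1 \<Longrightarrow> h > 0 \<Longrightarrow> E n \<ge> h * (1 - b h)"
    and E2: "\<And>n h K. n \<ge> 1 \<Longrightarrow> h > 0 \<Longrightarrow>
      E n \<ge> h * (1 - (C * (2 * real v * real K + 1) ^ d * real n powr (- real d / 2) + b h ^ K))"
  shows "\<exists>c>0. \<forall>n\<ge>3. E n \<ge> c * ln (real n) powr (1 / r)"
proof -
  \<comment> \<open>Makes the gain at one site at least
    \<open>c1 * n powr (- 1 / 8)\<close>.\<close>
  define \<eta> where "\<eta> = 1 / (8 * c2)"
  have \<eta>: "\<eta> > 0" using c2 by (simp add: \<eta>_def)
  define h where "h n = (\<eta> * ln (real n)) powr (1 / r)" for n
  have h: "h n = \<eta> powr (1 / r) * ln (real n) powr (1 / r)" "h n > 0"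
    "exp (- c2 * h n powr r) = real n powr (- 1 / 8)" if "n \<ge> 3" for n
  proof -
    have l: "ln (real n) > 1" by (rule ln_gt_1[OF that])
    show "h n = \<eta> powr (1 / r) * ln (real n) powr (1 / r)" unfolding h_def
      using \<eta> l by (intro powr_mult)
    show "h n > 0" using \<eta> l by (simp add: h_def)
    have "h n powr r = \<eta> * ln (real n)" using \<eta> l r by (simp add: h_def powr_powr)
    then have "- c2 * h n powr r = (- 1 / 8) * ln (real n)" using c2 by (simp add: \<eta>_def)
    then show "exp (- c2 * h n powr r) = real n powr (- 1 / 8)" using that by (simp add: powr_def)
  qed
  define x where "x n = real n powr (1 / 4)" for n :: nat
  have lim: "((\<lambda>n. C * (4 * real v + 1) ^ d * real n powr (- (real d / 4)) + 1 / c1 * real n powr (- (1 / 8))) \<longlongrightarrow> 0) sequentially"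
  proof -
    have "((\<lambda>n. real n powr (- (real d / 4))) \<longlongrightarrow> 0) sequentially"
      using d by (intro tendsto_neg_powr filterlim_real_sequentially) auto
    moreover have "((\<lambda>n. real n powr (- (1 / 8))) \<longlongrightarrow> 0) sequentially"
      by (intro tendsto_neg_powr filterlim_real_sequentially) auto
    ultimately show ?thesis
      by (intro tendsto_add_zero tendsto_mult_right_zero)
  qed
  have "eventually (\<lambda>n. C * (4 * real v + 1) ^ d * real n powr (- (real d / 4)) + 1 / c1 * real n powr (- (1 / 8)) < 1 / 2) sequentially"
    by (rule order_tendstoD(2)[OF lim]) simp
  then obtain N where N: "\<And>n. n \<ge> N \<Longrightarrow>
      C * (4 * real v + 1) ^ d * real n powr (- (real d / 4)) + 1 / c1 * real n powr (- (1 / 8)) < 1 / 2"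
    unfolding eventually_sequentially by blast
  define c where "c = \<eta> powr (1 / r) * min (1 / 2) (c1 * real (max N 1) powr (- 1 / 8))"
  have "E n \<ge> c * ln (real n) powr (1 / r)" if n: "n \<ge> 3" for n
  proof (cases "n \<ge> N")
    case False
    \<comment> \<open>Below \<open>N\<close> the gain at the starting site alone is bounded away
      from zero.\<close>
    have "h n * (c1 * real (max N 1) powr (- 1 / 8)) \<le> h n * (1 - b (h n))"
    proof (intro mult_left_mono)
      have "c1 * real (max N 1) powr (- 1 / 8) \<le> c1 * real n powr (- 1 / 8)"
        using c1 n False by (intro mult_left_mono powr_mono2') auto
      also have "\<dots> \<le> 1 - b (h n)" using b(2)[OF h(2)[OF n]] unfolding h(3)[OF n] by simp
      finally show "c1 * real (max N 1) powr (- 1 / 8) \<le> 1 - b (h n)" .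
    qed (use h(2)[OF n] in simp)
    also have "\<dots> \<le> E n" by (rule E1) (use n h(2)[OF n] in auto)
    finally have "h n * (c1 * real (max N 1) powr (- 1 / 8)) \<le> E n" .
    moreover have "c * ln (real n) powr (1 / r) = h n * min (1 / 2) (c1 * real (max N 1) powr (- 1 / 8))"
      unfolding c_def h(1)[OF n] by (simp only: mult_ac)
    moreover have "\<dots> \<le> h n * (c1 * real (max N 1) powr (- 1 / 8))"
      using h(2)[OF n] by (intro mult_left_mono) auto
    ultimately show ?thesis by linarith
  next
    case True
    \<comment> \<open>About \<open>n powr (1 / 4)\<close> sites. The box term is then of order
      \<open>n powr (- d / 4)\<close>, and the failure term is at most
      \<open>exp (- c1 * n powr (1 / 8))\<close>.\<close>
    define K where "K = nat \<lceil>x n\<rceil>"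
    have x1: "x n \<ge> 1" using n unfolding x_def by (intro ge_one_powr_ge_zero) auto
    have K: "real K \<ge> x n" "real K \<le> 2 * x n" using x1 unfolding K_def by linarith+
    have "(2 * real v * real K + 1) ^ d \<le> ((4 * real v + 1) * x n) ^ d"
    proof (intro power_mono)
      have "2 * real v * real K \<le> 2 * real v * (2 * x n)" using K by (intro mult_left_mono) auto
      with x1 show "2 * real v * real K + 1 \<le> (4 * real v + 1) * x n" by (simp add: algebra_simps)
    qed simp
    also have "\<dots> = (4 * real v + 1) ^ d * real n powr (real d / 4)"
      using n by (simp add: power_mult_distrib x_def powr_powr flip: powr_realpow)
    finally have "C * (2 * real v * real K + 1) ^ d * real n powr (- real d / 2) \<le>
      C * ((4 * real v + 1) ^ d * real n powr (real d / 4)) * real n powr (- real d / 2)"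
      using C by (intro mult_right_mono mult_left_mono) auto
    also have "\<dots> = C * (4 * real v + 1) ^ d * real n powr (- (real d / 4))"
      by (simp add: powr_add[symmetric] mult.assoc)
    finally have 1: "C * (2 * real v * real K + 1) ^ d * real n powr (- real d / 2) \<le>
       C * (4 * real v + 1) ^ d * real n powr (- (real d / 4))" .
    have "b (h n) ^ K \<le> exp (- c1 * real n powr (- 1 / 8)) ^ K"
    proof (intro power_mono b(1) h(2)[OF n])
      have "b (h n) \<le> 1 + - c1 * real n powr (- 1 / 8)" using b(2)[OF h(2)[OF n]] unfolding h(3)[OF n] by simp
      also have "\<dots> \<le> exp (- c1 * real n powr (- 1 / 8))" by (rule exp_ge_add_one_self)
      finally show "b (h n) \<le> exp (- c1 * real n powr (- 1 / 8))" .
    qed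
    also have "\<dots> = exp (real K * (- c1 * real n powr (- 1 / 8)))" by (rule exp_of_nat_mult[symmetric])
    also have "\<dots> \<le> exp (x n * (- c1 * real n powr (- 1 / 8)))"
      using K(1) c1 by (simp add: mult_right_mono)
    also have "x n * (- c1 * real n powr (- 1 / 8)) = - c1 * real n powr (1 / 8)"
      by (simp add: x_def powr_add[symmetric])
    also have "exp (- c1 * real n powr (1 / 8)) \<le> 1 / c1 * real n powr (- (1 / 8))"
    proof -
      define y where "y = c1 * real n powr (1 / 8)"
      have y: "y > 0" using c1 n by (simp add: y_def)
      have "y \<le> exp y" using exp_ge_add_one_self[of y] by linarith
      then have "exp (- y) \<le> 1 / y" using y by (simp add: exp_minus field_simps)
      then show ?thesis by (simp add: y_def powr_minus field_simps)
    qed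
    finally have 2: "b (h n) ^ K \<le> 1 / c1 * real n powr (- (1 / 8))" .
    have "h n * (1 / 2) \<le> h n * (1 - (C * (2 * real v * real K + 1) ^ d * real n powr (- real d / 2) + b (h n) ^ K))"
    proof (rule mult_left_mono)
      show "1 / 2 \<le> 1 - (C * (2 * real v * real K + 1) ^ d * real n powr (- real d / 2) + b (h n) ^ K)"
        using 1 2 N[OF True] by linarith
    qed (use h(2)[OF n] in simp)
    also have "\<dots> \<le> E n" by (rule E2) (use n h(2)[OF n] in auto)
    finally have "h n * (1 / 2) \<le> E n" .
    moreover have "c * ln (real n) powr (1 / r) = h n * min (1 / 2) (c1 * real (max N 1) powr (- 1 / 8))"
      unfolding c_def h(1)[OF n] by (simp only: mult_ac)
    moreover have "\<dots> \<le> h n * (1 / 2)"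
      using h(2)[OF n] by (intro mult_left_mono) auto
    ultimately show ?thesis by linarith
  qed
  moreover have "c > 0" using \<eta> c1 by (simp add: c_def)
  ultimately show ?thesis by blast
qed

section \<open>Survival weights along the walk\<close>

context harness_matrix
begin

lemma matrix_apply_mono: "(\<And>j. x j \<le> y j) \<Longrightarrow> matrix_apply p x i \<le> matrix_apply p y i"
  unfolding matrix_apply_eq by (intro sum_mono mult_left_mono nonneg)

lemma matrix_apply_const: "matrix_apply p (\<lambda>_. c) i = c"
  unfolding matrix_apply_eq by (simp add: sum_distrib_right[symmetric] sum_steps)

lemma matrix_apply_cmult: "matrix_apply p (\<lambda>j. c * x j) i = c * matrix_apply p x i"
  unfolding matrix_apply_eq by (simp add: sum_distrib_left mult_ac)

lemma matrix_apply_diff: "matrix_apply p (\<lambda>j. x j - y j) i = matrix_apply p x i - matrix_apply p y i"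
  unfolding matrix_apply_eq by (simp add: right_diff_distrib sum_subtractf)

lemma matrix_apply_nonneg: "(\<And>j. 0 \<le> x j) \<Longrightarrow> 0 \<le> matrix_apply p x i"
  unfolding matrix_apply_eq by (intro sum_nonneg mult_nonneg_nonneg nonneg)

text \<open>Stated over an arbitrary space, and asking for the noise at times 1 to \<open>n\<close>
  only: it is applied to the product of wall and noise spaces and to the coordinates of past
  noise.\<close>

lemma harness_measurable:
  assumes [measurable]: "\<And>j. (\<lambda>x. wl j x) \<in> borel_measurable N"
    and "\<And>m j. 1 \<le> m \<Longrightarrow> m \<le> n \<Longrightarrow> (\<lambda>x. ef (int m) j x) \<in> borel_measurable N"
  shows "(\<lambda>x. harness p (\<lambda>j. wl j x) (\<lambda>n j. ef n j x) n i) \<in> borel_measurable N"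
  using assms(2)
proof (induction n arbitrary: i)
  case 0
  show ?case unfolding harness.simps(1) by measurable
next
  case (Suc n)
  have [measurable]: "(\<lambda>x. harness p (\<lambda>j. wl j x) (\<lambda>n j. ef n j x) n i) \<in> borel_measurable N" for i
    using Suc by simp
  have [measurable]: "(\<lambda>x. ef (int (Suc n)) i x) \<in> borel_measurable N"
    by (rule Suc.prems) auto
  show ?case unfolding harness.simps(2) Let_def matrix_apply_eq by measurable
qed

text \<open>Adaptedness, which later separates the surface at time \<open>m\<close> from the noise
  at time \<open>m + 1\<close>.\<close>

lemma harness_cong_noise:
  "(\<And>m j. 1 \<le> m \<Longrightarrow> m \<le> n \<Longrightarrow> e (int m) j = e' (int m) j) \<Longrightarrow> harness p w e n i = harness p w e' n i"
proof (induction n arbitrary: i)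
  case (Suc n)
  have "matrix_apply p (harness p w e n) i = matrix_apply p (harness p w e' n) i"
    unfolding matrix_apply_eq using Suc by (intro sum.cong) auto
  moreover have "e (int (Suc n)) i = e' (int (Suc n)) i" by (rule Suc.prems) auto
  ultimately show ?case by simp
qed simp

lemma harness_Suc_ge_average:
  "w i \<noteq> \<infinity> \<Longrightarrow> matrix_apply p (harness p w e n) i + e (int (Suc n)) i \<le> harness p w e (Suc n) i"
  by (auto simp: Let_def)

lemma harness_Suc_ge_wall:
  "w i \<noteq> \<infinity> \<Longrightarrow> ereal h \<le> w i \<Longrightarrow> h \<le> harness p w e (Suc n) i"
  by (cases "w i") (auto simp: Let_def)

text \<open>A Feynman-Kac weight: the expectation, over the walk from \<open>i\<close>, of the
  product of \<open>a (w x)\<close> over the sites \<open>x\<close> occupied at times 0 to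
  \<open>m - 1\<close>.\<close>

fun survival :: "(ereal \<Rightarrow> real) \<Rightarrow> (int ^ 'd \<Rightarrow> ereal) \<Rightarrow> nat \<Rightarrow> int ^ 'd \<Rightarrow> real" where
  "survival a w 0 i = 1"
| "survival a w (Suc m) i = a (w i) * matrix_apply p (survival a w m) i"

lemma survival_bounds:
  assumes "\<And>x. 0 \<le> a x" "\<And>x. a x \<le> 1"
  shows "0 \<le> survival a w m i" "survival a w m i \<le> 1"
proof -
  have "0 \<le> survival a w m i \<and> survival a w m i \<le> 1"
  proof (induction m arbitrary: i)
    case (Suc m)
    have "matrix_apply p (survival a w m) i \<le> matrix_apply p (\<lambda>_. 1) i"
      using Suc by (intro matrix_apply_mono) auto
    then have 1: "matrix_apply p (survival a w m) i \<le> 1" by (simp add: matrix_apply_const)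
    have 0: "0 \<le> matrix_apply p (survival a w m) i" using Suc by (intro matrix_apply_nonneg) auto
    show ?case using assms[of "w i"] 0 1 by (simp add: mult_le_one)
  qed simp
  then show "0 \<le> survival a w m i" "survival a w m i \<le> 1" by auto
qed

lemma survival_measurable:
  assumes [measurable]: "a \<in> borel_measurable borel" "\<And>j. (\<lambda>x. wl j x) \<in> borel_measurable N"
  shows "(\<lambda>x. survival a (\<lambda>j. wl j x) m i) \<in> borel_measurable N"
proof (induction m arbitrary: i)
  case (Suc m)
  note [measurable] = Suc
  show ?case unfolding survival.simps matrix_apply_eq by measurable
qed simp

text \<open>\<open>V\<close> stands for the mean height under a fixed wall. The deficit below
  \<open>h\<close> starts at no more than \<open>h\<close>, and each step averages its positive part
  and multiplies by \<open>a\<close>, which is the recursion of \<open>survival\<close>.\<close>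

lemma deficit_le_survival:
  assumes a: "\<And>x. 0 \<le> a x" "\<And>x. a x \<le> 1" and h: "h \<ge> 0"
    and V0: "\<And>i. 0 \<le> V 0 i"
    and step: "\<And>m i. h - V (Suc m) i \<le> a (w i) * matrix_apply p (\<lambda>j. max 0 (h - V m j)) i"
  shows "h - V m i \<le> h * survival a w m i"
proof -
  have "max 0 (h - V m i) \<le> h * survival a w m i"
  proof (induction m arbitrary: i)
    case 0
    then show ?case using V0[of i] h by simp
  next
    case (Suc m)
    have "h - V (Suc m) i \<le> a (w i) * matrix_apply p (\<lambda>j. max 0 (h - V m j)) i" by (rule step)
    also have "\<dots> \<le> a (w i) * matrix_apply p (\<lambda>j. h * survival a w m j) i"
      by (intro mult_left_mono matrix_apply_mono Suc a)
    also have "\<dots> = h * survival a w (Suc m) i" by (simp add: matrix_apply_cmult)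
    finally show ?case using h survival_bounds(1)[where w = w and m = "Suc m" and i = i, OF a] by (simp del: survival.simps)
  qed
  then show ?thesis by simp
qed

text \<open>Split at distance \<open>step_range * K\<close>: inside, bound each transition
  probability by \<open>C\<close> and count the points of the box; outside, the exponent of
  \<open>b\<close> is at least \<open>K\<close> and the total mass at most one.\<close>

lemma heat_power_sum_le:
  assumes C: "\<And>x. heat m x \<le> C" and b: "0 \<le> b" "b \<le> 1"
  shows "(\<Sum>z\<in>reach m. heat m z * b ^ (max_abs z div step_range)) \<le>
    C * (2 * real step_range * real K + 1) ^ CARD('d) + b ^ K"
proof -
  let ?B = "{z :: int ^ 'd. max_abs z \<le> step_range * K}"
  have C0: "C \<ge> 0" using C[of 0] heat_nonneg[of m 0] by linarith
  have "(\<Sum>z\<in>reach m. heat m z * b ^ (max_abs z div step_range)) \<le>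
     (\<Sum>z\<in>reach m. heat m z * indicator ?B z + b ^ K * heat m z)"
  proof (rule sum_mono)
    fix z
    show "heat m z * b ^ (max_abs z div step_range) \<le> heat m z * indicator ?B z + b ^ K * heat m z"
    proof (cases "z \<in> ?B")
      case True
      have "heat m z * b ^ (max_abs z div step_range) \<le> heat m z * 1"
        using b by (intro mult_left_mono power_le_one heat_nonneg) auto
      then show ?thesis using True heat_nonneg[of m z] b by (simp add: add_increasing2)
    next
      case False
      then have "K \<le> max_abs z div step_range"
        using step_range_pos by (simp add: less_eq_div_iff_mult_less_eq mult.commute)
      then have "b ^ (max_abs z div step_range) \<le> b ^ K" using b by (intro power_decreasing)
      then have "heat m z * b ^ (max_abs z div step_range) \<le> heat m z * b ^ K"
        by (intro mult_left_mono heat_nonneg)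
      with False show ?thesis by (simp add: mult.commute)
    qed
  qed
  also have "\<dots> = (\<Sum>z\<in>reach m. heat m z * indicator ?B z) + b ^ K * (\<Sum>z\<in>reach m. heat m z)"
    by (simp add: sum.distrib sum_distrib_left)
  also have "(\<Sum>z\<in>reach m. heat m z * indicator ?B z) = (\<Sum>z\<in>reach m \<inter> ?B. heat m z)"
    unfolding sum.inter_restrict[OF finite_reach] by (rule sum.cong) auto
  also have "\<dots> \<le> (\<Sum>z\<in>?B. C)"
  proof -
    have "(\<Sum>z\<in>reach m \<inter> ?B. heat m z) \<le> (\<Sum>z\<in>reach m \<inter> ?B. C)" by (intro sum_mono C)
    also have "\<dots> \<le> (\<Sum>z\<in>?B. C)" by (rule sum_mono2) (use C0 finite_box in auto)
    finally show ?thesis .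
  qed
  also have "\<dots> = C * (2 * real step_range * real K + 1) ^ CARD('d)"
    by (simp add: card_box mult_ac add.commute)
  also have "b ^ K * (\<Sum>z\<in>reach m. heat m z) \<le> b ^ K * 1"
    using b by (intro mult_left_mono heat_sum_le_1) auto
  finally show ?thesis by simp
qed

end

section \<open>Averaging over the noise with the wall fixed\<close>

context harness_process
begin

lemma eps_integrable: "integrable M (eps n i)"
proof -
  have "integrable (distr M borel (eps n i)) (\<lambda>x. x)" by (simp add: noise_law noise_integrable)
  then show ?thesis by (subst (asm) integrable_distr_eq) auto
qed

lemma eps_mean: "integral\<^sup>L M (eps n i) = 0"
proof -
  have "(\<integral>x. x \<partial>\<mu>) = (\<integral>x. x \<partial>distr \<mu> borel uminus)" by (simp only: noise_symmetric)
  also have "\<dots> = (\<integral>x. - x \<partial>\<mu>)" by (rule integral_distr) auto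
  also have "\<dots> = - (\<integral>x. x \<partial>\<mu>)" by (rule Bochner_Integration.integral_minus)
  finally have "(\<integral>x. x \<partial>\<mu>) = 0" by simp
  moreover have "integral\<^sup>L M (eps n i) = integral\<^sup>L (distr M borel (eps n i)) (\<lambda>x. x)"
    by (rule integral_distr[symmetric]) auto
  ultimately show ?thesis by (simp add: noise_law)
qed

text \<open>\<open>powr_le_add_exp\<close> at threshold 0 dominates the positive part by its
  stretched exponential, which has finite mean.\<close>

lemma wall_integrable:
  assumes tail: "ecdf \<nu> \<in> \<L>\<^sup>- \<theta>" and \<theta>: "\<theta> > 0"
  shows "integrable M (\<lambda>\<omega>. real_of_ereal (max 0 (W j \<omega>)))"
proof -
  let ?w = "\<lambda>\<omega>. real_of_ereal (max 0 (W j \<omega>))"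
  obtain \<kappa> K where \<kappa>: "\<kappa> > 0" and K: "K \<ge> 0"
    "\<And>j. (\<integral>\<^sup>+\<omega>. ennreal (exp (\<kappa> * real_of_ereal (max 0 (W j \<omega>)) powr \<theta>)) \<partial>M) \<le> ennreal K"
    using wall_mgf_bound[OF tail \<theta>] by blast
  have "integrable M (\<lambda>\<omega>. exp (\<kappa> * ?w \<omega> powr \<theta>))"
  proof (rule integrableI_bounded)
    show "(\<integral>\<^sup>+\<omega>. ennreal (norm (exp (\<kappa> * ?w \<omega> powr \<theta>))) \<partial>M) < \<infinity>"
      using K(2)[of j] by (simp add: le_less_trans)
  qed measurable
  then have int: "integrable M (\<lambda>\<omega>. (2 * (1 / \<theta>) / \<kappa>) powr (1 / \<theta>) * exp (\<kappa> * ?w \<omega> powr \<theta>))"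
    by simp
  show ?thesis
  proof (rule Bochner_Integration.integrable_bound[OF int])
    show "AE \<omega> in M. norm (?w \<omega>) \<le> norm ((2 * (1 / \<theta>) / \<kappa>) powr (1 / \<theta>) * exp (\<kappa> * ?w \<omega> powr \<theta>))"
    proof (rule AE_I2)
      fix \<omega>
      have w0: "?w \<omega> \<ge> 0" by (intro real_of_ereal_pos) simp
      have "?w \<omega> = (?w \<omega> powr \<theta>) powr (1 / \<theta>)" using \<theta> w0 by (simp add: powr_powr)
      also have "\<dots> \<le> 2 powr (1 / \<theta>) * 0 powr (1 / \<theta>) + (2 * (1 / \<theta>) / \<kappa>) powr (1 / \<theta>) * exp (\<kappa> * (?w \<omega> powr \<theta> - 0))"
        by (rule powr_le_add_exp) (use \<theta> \<kappa> in auto)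
      finally show "norm (?w \<omega>) \<le> norm ((2 * (1 / \<theta>) / \<kappa>) powr (1 / \<theta>) * exp (\<kappa> * ?w \<omega> powr \<theta>))"
        using w0 by simp
    qed
  qed measurable
qed

text \<open>The wall is a parameter \<open>wl\<close>, since both the random wall and a constant one
  occur. The new height is the larger of wall and averaged height plus noise, hence the dominating
  sum.\<close>

lemma harness_integrable:
  assumes wl [measurable]: "\<And>j. wl j \<in> borel_measurable M"
    and int: "\<And>j. integrable M (\<lambda>\<omega>. real_of_ereal (max 0 (wl j \<omega>)))"
    and fin: "\<And>j \<omega>. \<omega> \<in> space M \<Longrightarrow> wl j \<omega> \<noteq> \<infinity>"
  shows "integrable M (\<lambda>\<omega>. harness p (\<lambda>j. wl j \<omega>) (\<lambda>n j. eps n j \<omega>) n i)"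
proof (induction n arbitrary: i)
  case 0
  then show ?case using int by simp
next
  case (Suc n)
  let ?y = "\<lambda>\<omega>. matrix_apply p (harness p (\<lambda>j. wl j \<omega>) (\<lambda>n j. eps n j \<omega>) n) i"
  have y: "integrable M ?y" unfolding matrix_apply_eq using Suc by (intro Bochner_Integration.integrable_sum integrable_mult_right)
  have "integrable M (\<lambda>\<omega>. real_of_ereal (max 0 (wl i \<omega>)) + (\<bar>?y \<omega>\<bar> + \<bar>eps (int (Suc n)) i \<omega>\<bar>))"
    by (intro Bochner_Integration.integrable_add integrable_abs y int eps_integrable)
  then show ?case
  proof (rule Bochner_Integration.integrable_bound)
    show "(\<lambda>\<omega>. harness p (\<lambda>j. wl j \<omega>) (\<lambda>n j. eps n j \<omega>) (Suc n) i) \<in> borel_measurable M"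
      by (rule harness_measurable) auto
    show "AE \<omega> in M. norm (harness p (\<lambda>j. wl j \<omega>) (\<lambda>n j. eps n j \<omega>) (Suc n) i)
      \<le> norm (real_of_ereal (max 0 (wl i \<omega>)) + (\<bar>?y \<omega>\<bar> + \<bar>eps (int (Suc n)) i \<omega>\<bar>))"
    proof (rule AE_I2)
      fix \<omega> assume \<omega>: "\<omega> \<in> space M"
      show "norm (harness p (\<lambda>j. wl j \<omega>) (\<lambda>n j. eps n j \<omega>) (Suc n) i)
        \<le> norm (real_of_ereal (max 0 (wl i \<omega>)) + (\<bar>?y \<omega>\<bar> + \<bar>eps (int (Suc n)) i \<omega>\<bar>))"
      proof (cases "wl i \<omega>")
        case (real r)
        then show ?thesis by (simp add: Let_def max_def zero_ereal_def) linarith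
      qed (use fin[OF \<omega>, of i] in \<open>auto simp: Let_def max_def\<close>)
    qed
  qed
qed

definition quenched_mean :: "(int ^ 'd \<Rightarrow> ereal) \<Rightarrow> nat \<Rightarrow> int ^ 'd \<Rightarrow> real" where
  "quenched_mean w n i = (\<integral>\<omega>. harness p w (\<lambda>n j. eps n j \<omega>) n i \<partial>M)"

lemma wall_process_measurable:
  "(\<lambda>\<omega> i. W i \<omega>) \<in> measurable M (PiM UNIV (\<lambda>_. borel))"
  by (rule measurable_PiM_single') (simp_all add: space_PiM PiE_UNIV_domain)

lemma noise_process_measurable:
  "(\<lambda>\<omega> (n, i). eps n i \<omega>) \<in> measurable M (PiM UNIV (\<lambda>_. borel))"
proof (rule measurable_PiM_single')
  fix x :: "int \<times> (int ^ 'd)"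
  show "(\<lambda>\<omega>. (case x of (n, i) \<Rightarrow> eps n i \<omega>)) \<in> borel_measurable M" by (cases x) simp
qed (simp add: space_PiM PiE_UNIV_domain)

text \<open>Turns independence of the generated sigma-algebras into a product law, as Fubini's
  theorem requires.\<close>

lemma wall_noise_distr:
  "distr M (PiM UNIV (\<lambda>_. borel)) (\<lambda>\<omega> i. W i \<omega>) \<Otimes>\<^sub>M distr M (PiM UNIV (\<lambda>_. borel)) (\<lambda>\<omega> (n, i). eps n i \<omega>) =
   distr M (PiM UNIV (\<lambda>_. borel) \<Otimes>\<^sub>M PiM UNIV (\<lambda>_. borel)) (\<lambda>\<omega>. (\<lambda>i. W i \<omega>, \<lambda>(n, i). eps n i \<omega>))"
proof -
  let ?P1 = "PiM UNIV (\<lambda>_. borel) :: (int ^ 'd \<Rightarrow> ereal) measure"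
  let ?P2 = "PiM UNIV (\<lambda>_. borel) :: (int \<times> (int ^ 'd) \<Rightarrow> real) measure"
  let ?W = "\<lambda>\<omega> i. W i \<omega>" and ?E = "\<lambda>\<omega> (n, i). eps n i \<omega>"
  note [measurable] = wall_process_measurable noise_process_measurable
  interpret D1: prob_space "distr M ?P1 ?W" by (rule prob_space_distr[OF wall_process_measurable])
  interpret D2: prob_space "distr M ?P2 ?E" by (rule prob_space_distr[OF noise_process_measurable])
  show ?thesis
  proof (rule pair_measure_eqI)
    fix A B assume "A \<in> sets (distr M ?P1 ?W)" "B \<in> sets (distr M ?P2 ?E)"
    then have AB [measurable]: "A \<in> sets ?P1" "B \<in> sets ?P2" by auto
    have "prob ((?W -` A \<inter> space M) \<inter> (?E -` B \<inter> space M)) = prob (?W -` A \<inter> space M) * prob (?E -` B \<inter> space M)"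
      by (rule indep_setD[OF wall_noise_indep]) (use AB in \<open>auto intro!: in_vimage_algebra\<close>)
    moreover have "(?W -` A \<inter> space M) \<inter> (?E -` B \<inter> space M) = (\<lambda>\<omega>. (?W \<omega>, ?E \<omega>)) -` (A \<times> B) \<inter> space M"
      by auto
    ultimately have "prob ((\<lambda>\<omega>. (?W \<omega>, ?E \<omega>)) -` (A \<times> B) \<inter> space M) =
        prob (?W -` A \<inter> space M) * prob (?E -` B \<inter> space M)" by simp
    moreover have "A \<times> B \<in> sets (?P1 \<Otimes>\<^sub>M ?P2)" by measurable
    moreover have "(\<lambda>\<omega>. (?W \<omega>, ?E \<omega>)) \<in> measurable M (?P1 \<Otimes>\<^sub>M ?P2)" by measurable
    ultimately show "emeasure (distr M ?P1 ?W) A * emeasure (distr M ?P2 ?E) B =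
        emeasure (distr M (?P1 \<Otimes>\<^sub>M ?P2) (\<lambda>\<omega>. (?W \<omega>, ?E \<omega>))) (A \<times> B)"
      using AB wall_process_measurable noise_process_measurable
      by (simp only: emeasure_distr emeasure_eq_measure ennreal_mult[symmetric] measure_nonneg)
  next
    show "sets (distr M ?P1 ?W \<Otimes>\<^sub>M distr M ?P2 ?E) = sets (distr M (?P1 \<Otimes>\<^sub>M ?P2) (\<lambda>\<omega>. (?W \<omega>, ?E \<omega>)))"
      unfolding sets_distr by (rule sets_pair_measure_cong) (rule sets_distr)+
  qed (fact D1.sigma_finite_measure_axioms D2.sigma_finite_measure_axioms)+
qed

text \<open>Fubini for the product law: integrating the noise first, with the wall fixed, yields
  \<open>quenched_mean\<close>.\<close>

lemma
  assumes int: "\<And>j. integrable M (\<lambda>\<omega>. real_of_ereal (max 0 (W j \<omega>)))"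
  shows surface_integral: "integral\<^sup>L M (harness_surface p eps W n i) = (\<integral>\<omega>. quenched_mean (\<lambda>j. W j \<omega>) n i \<partial>M)"
    and quenched_mean_integrable: "integrable M (\<lambda>\<omega>. quenched_mean (\<lambda>j. W j \<omega>) n i)"
proof -
  let ?P1 = "PiM UNIV (\<lambda>_. borel) :: (int ^ 'd \<Rightarrow> ereal) measure"
  let ?P2 = "PiM UNIV (\<lambda>_. borel) :: (int \<times> (int ^ 'd) \<Rightarrow> real) measure"
  let ?W = "\<lambda>\<omega> i. W i \<omega>" and ?E = "\<lambda>\<omega> (n, i). eps n i \<omega>"
  define F where "F = (\<lambda>(w, e). harness p w (\<lambda>n j. e (n, j)) n i)"
  have F [measurable]: "F \<in> borel_measurable (?P1 \<Otimes>\<^sub>M ?P2)"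
    unfolding F_def split_beta by (rule harness_measurable) measurable
  note dist = wall_process_measurable noise_process_measurable wall_noise_distr
  note [measurable] = dist(1,2)
  interpret D1: prob_space "distr M ?P1 ?W" by (rule prob_space_distr[OF wall_process_measurable])
  interpret D2: prob_space "distr M ?P2 ?E" by (rule prob_space_distr[OF noise_process_measurable])
  interpret D: pair_sigma_finite "distr M ?P1 ?W" "distr M ?P2 ?E" ..
  have FF: "F (?W \<omega>, ?E \<omega>) = harness_surface p eps W n i \<omega>" for \<omega>
    by (simp add: F_def harness_surface_def)
  have "integrable M (harness_surface p eps W n i)"
    unfolding harness_surface_def
    by (rule harness_integrable) (use int wall_less_infty in \<open>auto simp: less_top[symmetric] top_ereal_def\<close>)
  then have "integrable (distr M (?P1 \<Otimes>\<^sub>M ?P2) (\<lambda>\<omega>. (?W \<omega>, ?E \<omega>))) F"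
    by (subst integrable_distr_eq) (simp_all add: FF)
  then have intF: "integrable (distr M ?P1 ?W \<Otimes>\<^sub>M distr M ?P2 ?E) F" by (simp add: dist(3))
  have q: "(\<integral>e. F (w, e) \<partial>distr M ?P2 ?E) = quenched_mean w n i" if "w \<in> space ?P1" for w
  proof -
    have "(\<lambda>e. F (w, e)) \<in> borel_measurable ?P2"
      by (rule measurable_compose[OF measurable_Pair1'[OF that] F])
    then have "(\<integral>e. F (w, e) \<partial>distr M ?P2 ?E) = (\<integral>\<omega>. F (w, ?E \<omega>) \<partial>M)"
      by (rule integral_distr[OF dist(2)])
    then show ?thesis by (simp add: F_def quenched_mean_def)
  qed
  have qm: "(\<lambda>w. quenched_mean w n i) \<in> borel_measurable ?P1"
  proof -
    have "(\<lambda>w. \<integral>e. F (w, e) \<partial>distr M ?P2 ?E) \<in> borel_measurable ?P1"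
    proof (rule D2.borel_measurable_lebesgue_integral)
      have "sets (?P1 \<Otimes>\<^sub>M distr M ?P2 ?E) = sets (?P1 \<Otimes>\<^sub>M ?P2)"
        by (rule sets_pair_measure_cong) auto
      then show "(\<lambda>(w, e). F (w, e)) \<in> borel_measurable (?P1 \<Otimes>\<^sub>M distr M ?P2 ?E)"
        using F by (simp cong: measurable_cong_sets)
    qed
    then show ?thesis by (rule measurable_cong[THEN iffD1, rotated]) (use q in auto)
  qed
  have "integral\<^sup>L M (harness_surface p eps W n i) = (\<integral>\<omega>. F (?W \<omega>, ?E \<omega>) \<partial>M)"
    by (simp add: FF)
  also have "\<dots> = integral\<^sup>L (distr M (?P1 \<Otimes>\<^sub>M ?P2) (\<lambda>\<omega>. (?W \<omega>, ?E \<omega>))) F"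
    by (rule integral_distr[symmetric]) measurable
  also have "\<dots> = (\<integral>w. (\<integral>e. F (w, e) \<partial>distr M ?P2 ?E) \<partial>distr M ?P1 ?W)"
    unfolding dist(3)[symmetric] by (rule D.integral_fst'[OF intF, symmetric])
  also have "\<dots> = (\<integral>w. quenched_mean w n i \<partial>distr M ?P1 ?W)"
    by (rule Bochner_Integration.integral_cong) (auto simp: q)
  also have "\<dots> = (\<integral>\<omega>. quenched_mean (?W \<omega>) n i \<partial>M)"
    by (rule integral_distr) (use qm in auto)
  finally show "integral\<^sup>L M (harness_surface p eps W n i) = (\<integral>\<omega>. quenched_mean (?W \<omega>) n i \<partial>M)" .
  have "integrable (distr M ?P1 ?W) (\<lambda>w. \<integral>e. F (w, e) \<partial>distr M ?P2 ?E)"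
    by (rule D.integrable_fst'[OF intF])
  then have "integrable (distr M ?P1 ?W) (\<lambda>w. quenched_mean w n i)"
    by (rule Bochner_Integration.integrable_cong[THEN iffD1, rotated -1]) (auto simp: q)
  then show "integrable M (\<lambda>\<omega>. quenched_mean (?W \<omega>) n i)"
    by (subst (asm) integrable_distr_eq) (use qm in auto)
qed

lemma fixed_harness_integrable:
  assumes "\<And>j. w j \<noteq> \<infinity>"
  shows "integrable M (\<lambda>\<omega>. harness p w (\<lambda>n j. eps n j \<omega>) n i)"
  using harness_integrable[of "\<lambda>j _. w j" n i] assms by simp

lemma average_integral:
  assumes "\<And>j. w j \<noteq> \<infinity>"
  shows "integrable M (\<lambda>\<omega>. matrix_apply p (harness p w (\<lambda>n j. eps n j \<omega>) n) i)"
    and "(\<integral>\<omega>. matrix_apply p (harness p w (\<lambda>n j. eps n j \<omega>) n) i \<partial>M) = matrix_apply p (quenched_mean w n) i"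
  unfolding matrix_apply_eq quenched_mean_def using fixed_harness_integrable[OF assms]
  by (simp_all add: Bochner_Integration.integral_sum)

lemma quenched_mean_0: "0 \<le> quenched_mean w 0 i"
  unfolding quenched_mean_def by (simp add: real_of_ereal_pos prob_space)

text \<open>The wall can only lift the surface, and the noise has mean zero.\<close>

lemma quenched_mean_ge_average:
  assumes "\<And>j. w j \<noteq> \<infinity>"
  shows "matrix_apply p (quenched_mean w n) i \<le> quenched_mean w (Suc n) i"
proof -
  have "matrix_apply p (quenched_mean w n) i =
     (\<integral>\<omega>. matrix_apply p (harness p w (\<lambda>n j. eps n j \<omega>) n) i + eps (int (Suc n)) i \<omega> \<partial>M)"
    using average_integral[OF assms, where n = n and i = i] eps_integrable eps_mean by simp
  also have "\<dots> \<le> quenched_mean w (Suc n) i" unfolding quenched_mean_def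
    by (intro integral_mono fixed_harness_integrable[OF assms] Bochner_Integration.integrable_add
        average_integral(1)[OF assms] eps_integrable harness_Suc_ge_average assms)
  finally show ?thesis .
qed

lemma quenched_mean_ge_wall:
  assumes "\<And>j. w j \<noteq> \<infinity>" "ereal h \<le> w i"
  shows "h \<le> quenched_mean w (Suc n) i"
proof -
  have "(\<integral>\<omega>. h \<partial>M) \<le> quenched_mean w (Suc n) i" unfolding quenched_mean_def
    using harness_Suc_ge_wall[of w i h] assms
    by (intro integral_mono fixed_harness_integrable[OF assms(1)]) auto
  then show ?thesis by (simp add: prob_space)
qed

text \<open>The two variables are functions of disjoint blocks of the noise: times 1 to
  \<open>m\<close>, and site \<open>i\<close> at time \<open>m + 1\<close>.\<close>

lemma average_noise_indep:
  "indep_var borel (\<lambda>\<omega>. matrix_apply p (harness p w (\<lambda>n j. eps n j \<omega>) m) i) borel (eps (int (Suc m)) i)"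
proof -
  define A where "A = {1..int m} \<times> (UNIV :: (int ^ 'd) set)"
  define B where "B = {(int (Suc m), i)}"
  let ?X = "\<lambda>(n, i). eps n i"
  define f where "f r = matrix_apply p (harness p w (\<lambda>n j. r (n, j)) m) i" for r :: "int \<times> (int ^ 'd) \<Rightarrow> real"
  have "indep_var (PiM A (\<lambda>_. borel)) (\<lambda>\<omega>. restrict (\<lambda>x. ?X x \<omega>) A) (PiM B (\<lambda>_. borel)) (\<lambda>\<omega>. restrict (\<lambda>x. ?X x \<omega>) B)"
    by (rule indep_var_restrict[OF noise_indep]) (auto simp: A_def B_def)
  moreover have "f \<in> borel_measurable (PiM A (\<lambda>_. borel))"
  proof -
    have "(\<lambda>r. harness p w (\<lambda>n j. r (n, j)) m j) \<in> borel_measurable (PiM A (\<lambda>_. borel))" for j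
      by (rule harness_measurable) (auto intro!: measurable_component_singleton simp: A_def)
    then show ?thesis unfolding f_def[abs_def] matrix_apply_eq by measurable
  qed
  moreover have "(\<lambda>r. r (int (Suc m), i)) \<in> borel_measurable (PiM B (\<lambda>_. borel))"
    by (rule measurable_component_singleton) (simp add: B_def)
  ultimately have "indep_var borel (f \<circ> (\<lambda>\<omega>. restrict (\<lambda>x. ?X x \<omega>) A))
      borel ((\<lambda>r. r (int (Suc m), i)) \<circ> (\<lambda>\<omega>. restrict (\<lambda>x. ?X x \<omega>) B))"
    by (rule indep_var_compose)
  moreover have "f \<circ> (\<lambda>\<omega>. restrict (\<lambda>x. ?X x \<omega>) A) =
      (\<lambda>\<omega>. matrix_apply p (harness p w (\<lambda>n j. eps n j \<omega>) m) i)"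
    unfolding f_def comp_def matrix_apply_eq
    by (intro ext sum.cong arg_cong2[of _ _ _ _ "(*)"] harness_cong_noise) (auto simp: A_def)
  moreover have "(\<lambda>r. r (int (Suc m), i)) \<circ> (\<lambda>\<omega>. restrict (\<lambda>x. ?X x \<omega>) B) = eps (int (Suc m)) i"
    by (auto simp: B_def)
  ultimately show ?thesis by simp
qed

text \<open>A jump of size at least \<open>h\<close> below a nonnegative wall site is cut off by the wall, which
  gains at least \<open>h\<close> over the mean-zero noise.\<close>

lemma quenched_mean_ge_jump:
  assumes w: "\<And>j. w j \<noteq> \<infinity>" and wi: "0 \<le> w i"
  shows "(1 - measure \<mu> {..-h}) * matrix_apply p (quenched_mean w m) i + h * measure \<mu> {..-h}
     \<le> quenched_mean w (Suc m) i"
proof -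
  define Z where "Z \<omega> = matrix_apply p (harness p w (\<lambda>n j. eps n j \<omega>) m) i" for \<omega>
  let ?e = "eps (int (Suc m)) i"
  \<comment> \<open>\<open>g\<close> vanishes exactly on the jump event. It is evaluated at the new
    noise, so it is independent of \<open>Z\<close> and the mean of the product factorises.\<close>
  define g :: "real \<Rightarrow> real" where "g = (\<lambda>x. indicator {-h<..} x)"
  have g [measurable]: "g \<in> borel_measurable borel" unfolding g_def by simp
  have Zint: "integrable M Z" "integral\<^sup>L M Z = matrix_apply p (quenched_mean w m) i"
    unfolding Z_def[abs_def] using average_integral[OF w] by auto
  have gint: "integrable M (\<lambda>\<omega>. g (?e \<omega>))"
    by (rule integrable_const_bound[of _ 1]) (auto simp: g_def indicator_def)
  have "indep_var borel (id \<circ> Z) borel (g \<circ> ?e)"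
    unfolding Z_def[abs_def] by (rule indep_var_compose[OF average_noise_indep]) auto
  then have ind: "indep_var borel Z borel (\<lambda>\<omega>. g (?e \<omega>))" by (simp add: comp_def)
  have prod: "integrable M (\<lambda>\<omega>. Z \<omega> * g (?e \<omega>))"
    "(\<integral>\<omega>. Z \<omega> * g (?e \<omega>) \<partial>M) = integral\<^sup>L M Z * (\<integral>\<omega>. g (?e \<omega>) \<partial>M)"
    using indep_var_integrable[OF ind Zint(1) gint] indep_var_lebesgue_integral[OF ind Zint(1) gint] by auto
  have gm: "(\<integral>\<omega>. g (?e \<omega>) \<partial>M) = 1 - measure \<mu> {..-h}"
  proof -
    interpret N: prob_space \<mu> by (rule noise_prob_space)
    have "(\<integral>\<omega>. g (?e \<omega>) \<partial>M) = (\<integral>x. g x \<partial>distr M borel ?e)"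
      by (rule integral_distr[symmetric]) auto
    also have "\<dots> = (\<integral>x. g x \<partial>\<mu>)" by (simp only: noise_law)
    also have "\<dots> = measure \<mu> {-h<..}" unfolding g_def by simp
    also have "{-h<..} = space \<mu> - {..-h}" using sets_eq_imp_space_eq[OF sets_noise] by auto
    also have "measure \<mu> \<dots> = 1 - measure \<mu> {..-h}" by (rule N.prob_compl) simp
    finally show ?thesis .
  qed
  have int1: "integrable M (\<lambda>\<omega>. Z \<omega> * g (?e \<omega>) + (?e \<omega> + (h - h * g (?e \<omega>))))"
    by (intro Bochner_Integration.integrable_add Bochner_Integration.integrable_diff prod eps_integrable
        integrable_const integrable_mult_right gint)
  have "(\<integral>\<omega>. Z \<omega> * g (?e \<omega>) + (?e \<omega> + (h - h * g (?e \<omega>))) \<partial>M) \<le> quenched_mean w (Suc m) i"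
    unfolding quenched_mean_def
  proof (rule integral_mono[OF int1 fixed_harness_integrable[OF w]])
    fix \<omega>
    have ge: "Z \<omega> + ?e \<omega> \<le> harness p w (\<lambda>n j. eps n j \<omega>) (Suc m) i"
      unfolding Z_def by (rule harness_Suc_ge_average) (rule w)
    have ge0: "0 \<le> harness p w (\<lambda>n j. eps n j \<omega>) (Suc m) i"
      by (rule harness_Suc_ge_wall) (use w wi in \<open>auto simp: zero_ereal_def[symmetric]\<close>)
    \<comment> \<open>Without the jump the left side is \<open>Z \<omega> + ?e \<omega>\<close>;
      with it, \<open>?e \<omega> + h \<le> 0\<close>, while the surface stays nonnegative.\<close>
    show "Z \<omega> * g (?e \<omega>) + (?e \<omega> + (h - h * g (?e \<omega>))) \<le> harness p w (\<lambda>n j. eps n j \<omega>) (Suc m) i"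
    proof (cases "?e \<omega> > - h")
      case True
      then show ?thesis using ge by (simp add: g_def)
    next
      case False
      then show ?thesis using ge0 by (simp add: g_def del: harness.simps)
    qed
  qed
  moreover have "(\<integral>\<omega>. Z \<omega> * g (?e \<omega>) + (?e \<omega> + (h - h * g (?e \<omega>))) \<partial>M) =
      integral\<^sup>L M Z * (1 - measure \<mu> {..-h}) + (0 + (h - h * (1 - measure \<mu> {..-h})))"
    using prod eps_integrable eps_mean gint gm prob_space by simp
  ultimately show ?thesis by (simp add: Zint algebra_simps)
qed

text \<open>\<open>A\<close> collects sites visited earlier. Counting each site once, independence
  of the wall gives one factor of the mean of \<open>a\<close> per distinct site. The invariant
  \<open>inv\<close> turns distance into such a count: to get far, a walk with bounded steps must
  visit many sites. Survival over \<open>Suc m\<close> times pairs with \<open>heat m\<close>,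
  because the start also contributes a factor.\<close>

lemma expected_survival_le:
  assumes a [measurable]: "a \<in> borel_measurable borel" and a01: "\<And>x. 0 \<le> a x" "\<And>x. a x \<le> 1"
    and fin: "finite A" and inv: "\<And>x. x \<in> insert i A \<Longrightarrow> max_abs x \<le> step_range * card (insert i A)"
  shows "(\<integral>\<omega>. (\<Prod>j\<in>A. a (W j \<omega>)) * survival a (\<lambda>j. W j \<omega>) (Suc m) i \<partial>M) \<le>
    (\<Sum>z\<in>reach m. heat m z * (\<integral>x. a x \<partial>\<nu>) ^ (max_abs (i + z) div step_range))"
  using fin inv
proof (induction m arbitrary: i A)
  case 0
  define b where "b = (\<integral>x. a x \<partial>\<nu>)"
  let ?A = "insert i A"
  have ai: "(\<integral>\<omega>. a (W j \<omega>) \<partial>M) = b" for j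
    unfolding b_def wall_law[of j, symmetric] by (rule integral_distr[symmetric]) auto
  have aint: "integrable M (\<lambda>\<omega>. a (W j \<omega>))" for j
    by (rule integrable_const_bound[of _ 1]) (auto simp: a01)
  have b0: "0 \<le> b" unfolding b_def using a01 by (intro integral_nonneg_AE) auto
  have b1: "b \<le> 1"
  proof -
    have "(\<integral>\<omega>. a (W i \<omega>) \<partial>M) \<le> (\<integral>\<omega>. 1 \<partial>M)" by (intro integral_mono aint a01) auto
    then show ?thesis using ai[of i] prob_space by simp
  qed
  have ind: "indep_vars (\<lambda>_. borel) (\<lambda>j \<omega>. a (W j \<omega>)) ?A"
    by (rule indep_vars_compose2[OF indep_vars_subset[OF wall_indep]]) auto
  have "(\<integral>\<omega>. (\<Prod>j\<in>A. a (W j \<omega>)) * survival a (\<lambda>j. W j \<omega>) (Suc 0) i \<partial>M) \<le> (\<integral>\<omega>. (\<Prod>j\<in>?A. a (W j \<omega>)) \<partial>M)"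
  proof (rule integral_mono)
    show "integrable M (\<lambda>\<omega>. \<Prod>j\<in>?A. a (W j \<omega>))"
      by (rule indep_vars_integrable[OF _ ind aint]) (use 0 in auto)
    show "integrable M (\<lambda>\<omega>. (\<Prod>j\<in>A. a (W j \<omega>)) * survival a (\<lambda>j. W j \<omega>) (Suc 0) i)"
    proof (rule integrable_const_bound[of _ 1])
      show "AE \<omega> in M. norm ((\<Prod>j\<in>A. a (W j \<omega>)) * survival a (\<lambda>j. W j \<omega>) (Suc 0) i) \<le> 1"
        using survival_bounds[OF a01] a01
        by (auto simp: norm_mult abs_of_nonneg prod_nonneg simp del: survival.simps intro!: AE_I2 mult_le_one prod_le_1)
      have [measurable]: "(\<lambda>\<omega>. survival a (\<lambda>j. W j \<omega>) (Suc 0) i) \<in> borel_measurable M"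
        by (rule survival_measurable) auto
      show "(\<lambda>\<omega>. (\<Prod>j\<in>A. a (W j \<omega>)) * survival a (\<lambda>j. W j \<omega>) (Suc 0) i) \<in> borel_measurable M"
        by measurable
    qed
    fix \<omega>
    have "survival a (\<lambda>j. W j \<omega>) 0 = (\<lambda>_. 1)" by (rule ext) simp
    then have 1: "survival a (\<lambda>j. W j \<omega>) (Suc 0) i = a (W i \<omega>)"
      by (simp add: matrix_apply_const)
    show "(\<Prod>j\<in>A. a (W j \<omega>)) * survival a (\<lambda>j. W j \<omega>) (Suc 0) i \<le> (\<Prod>j\<in>?A. a (W j \<omega>))"
    proof (cases "i \<in> A")
      case True
      have "(\<Prod>j\<in>A. a (W j \<omega>)) * a (W i \<omega>) \<le> (\<Prod>j\<in>A. a (W j \<omega>)) * 1"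
        using a01 by (intro mult_left_mono prod_nonneg) auto
      then show ?thesis using True unfolding 1 by (simp add: insert_absorb)
    qed (use 0 in \<open>simp add: 1 mult.commute del: survival.simps\<close>)
  qed
  also have "\<dots> = b ^ card ?A"
    using indep_vars_lebesgue_integral[OF _ ind aint] 0 ai by simp
  \<comment> \<open>The invariant at the final site \<open>i\<close> bounds the number of visited
    sites from below.\<close>
  also have "\<dots> \<le> b ^ (max_abs i div step_range)"
  proof (rule power_decreasing[OF _ b0 b1])
    have "max_abs i div step_range \<le> step_range * card ?A div step_range"
      by (intro div_le_mono 0) simp
    then show "max_abs i div step_range \<le> card ?A" using step_range_pos by simp
  qed
  finally show ?case using sum_heat_0[of "\<lambda>z. b ^ (max_abs (i + z) div step_range)"] by (simp add: b_def)
next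
  case (Suc m)
  define b where "b = (\<integral>x. a x \<partial>\<nu>)"
  let ?A = "insert i A"
  let ?P = "\<lambda>A \<omega>. \<Prod>j\<in>A. a (W j \<omega>)"
  let ?S = "\<lambda>i \<omega>. survival a (\<lambda>j. W j \<omega>) (Suc m) i"
  have S [measurable]: "?S i \<in> borel_measurable M" for i by (rule survival_measurable) auto
  have Sb: "0 \<le> ?S i \<omega>" "?S i \<omega> \<le> 1" for i \<omega> by (rule survival_bounds[OF a01])+
  have Pb: "0 \<le> ?P B \<omega>" "?P B \<omega> \<le> 1" for B \<omega> using a01 by (auto intro!: prod_nonneg prod_le_1)
  have PA: "0 \<le> ?P ?A \<omega>" "?P ?A \<omega> \<le> 1" for \<omega> by (rule Pb)+
  have int: "integrable M (\<lambda>\<omega>. ?P A \<omega> * a (W i \<omega>) * ?S k \<omega>)" for k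
  proof (rule integrable_const_bound[of _ 1])
    show "AE \<omega> in M. norm (?P A \<omega> * a (W i \<omega>) * ?S k \<omega>) \<le> 1"
      using Sb Pb a01 by (intro AE_I2) (simp add: norm_mult mult_le_one del: survival.simps)
  qed measurable
  have int': "integrable M (\<lambda>\<omega>. ?P ?A \<omega> * ?S k \<omega>)" for k
  proof (rule integrable_const_bound[of _ 1])
    show "AE \<omega> in M. norm (?P ?A \<omega> * ?S k \<omega>) \<le> 1"
      using Sb PA a01 by (intro AE_I2) (simp add: norm_mult mult_le_one del: survival.simps prod.insert_if)
  qed measurable
  have "(\<integral>\<omega>. ?P A \<omega> * survival a (\<lambda>j. W j \<omega>) (Suc (Suc m)) i \<partial>M) =
     (\<integral>\<omega>. (\<Sum>s\<in>steps. p 0 s * (?P A \<omega> * a (W i \<omega>) * ?S (i + s) \<omega>)) \<partial>M)"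
    unfolding survival.simps(2)[of a _ "Suc m"] matrix_apply_eq[of "survival a _ (Suc m)"]
    by (simp add: sum_distrib_left mult_ac del: survival.simps)
  also have "\<dots> = (\<Sum>s\<in>steps. p 0 s * (\<integral>\<omega>. ?P A \<omega> * a (W i \<omega>) * ?S (i + s) \<omega> \<partial>M))"
    by (subst Bochner_Integration.integral_sum) (use int in \<open>simp_all del: survival.simps\<close>)
  also have "\<dots> \<le> (\<Sum>s\<in>steps. p 0 s * (\<Sum>z\<in>reach m. heat m z * b ^ (max_abs (i + (s + z)) div step_range)))"
  proof (intro sum_mono mult_left_mono nonneg)
    fix s assume s: "s \<in> steps"
    have "(\<integral>\<omega>. ?P A \<omega> * a (W i \<omega>) * ?S (i + s) \<omega> \<partial>M) \<le> (\<integral>\<omega>. ?P ?A \<omega> * ?S (i + s) \<omega> \<partial>M)"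
    proof (rule integral_mono[OF int int'])
      fix \<omega>
      \<comment> \<open>At a repeated visit the extra factor is at most one and is dropped.\<close>
      have "?P A \<omega> * a (W i \<omega>) \<le> ?P ?A \<omega>"
      proof (cases "i \<in> A")
        case True
        have "?P A \<omega> * a (W i \<omega>) \<le> ?P A \<omega> * 1" using Pb a01 by (intro mult_left_mono) auto
        then show ?thesis using True by (simp add: insert_absorb)
      qed (use Suc.prems in \<open>simp add: mult.commute\<close>)
      then show "?P A \<omega> * a (W i \<omega>) * ?S (i + s) \<omega> \<le> ?P ?A \<omega> * ?S (i + s) \<omega>"
        by (intro mult_right_mono Sb)
    qed
    also have "\<dots> \<le> (\<Sum>z\<in>reach m. heat m z * b ^ (max_abs (i + s + z) div step_range))"
      unfolding b_def
    proof (rule Suc.IH)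
      show "finite ?A" using Suc.prems by simp
      fix x assume x: "x \<in> insert (i + s) ?A"
      show "max_abs x \<le> step_range * card (insert (i + s) ?A)"
      \<comment> \<open>An old site leaves the set unchanged; a new one adds 1 to its cardinality
        and at most \<open>step_range\<close> to the distance.\<close>
      proof (cases "i + s \<in> ?A")
        case True
        then show ?thesis using Suc.prems(2)[of x] x by (simp add: insert_absorb)
      next
        case False
        then have c: "card (insert (i + s) ?A) = Suc (card ?A)" using Suc.prems(1) by simp
        show ?thesis
        proof (cases "x = i + s")
          case True
          have "max_abs x \<le> max_abs i + max_abs s" unfolding True by (rule max_abs_add)
          also have "\<dots> \<le> step_range * card ?A + step_range"
            by (intro add_mono Suc.prems max_abs_step s) simp
          finally show ?thesis unfolding c by simp
        next
          case False
          with x have "max_abs x \<le> step_range * card ?A" by (intro Suc.prems) auto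
          then show ?thesis unfolding c by simp
        qed
      qed
    qed
    finally show "(\<integral>\<omega>. ?P A \<omega> * a (W i \<omega>) * ?S (i + s) \<omega> \<partial>M) \<le>
        (\<Sum>z\<in>reach m. heat m z * b ^ (max_abs (i + (s + z)) div step_range))" by (simp add: add.assoc)
  qed
  also have "\<dots> = (\<Sum>z\<in>reach (Suc m). heat (Suc m) z * b ^ (max_abs (i + z) div step_range))"
    by (rule heat_step)
  finally show ?case by (simp add: b_def del: heat.simps survival.simps)
qed

text \<open>Converts a one-step reduction of the deficit by \<open>a (w i)\<close> into the two
  inputs of \<open>lower_bound_asymptotics\<close>. The first keeps only the factor at the starting
  site; the second uses all distinct sites on the walk.\<close>

lemma surface_integral_ge:
  assumes int: "\<And>j. integrable M (\<lambda>\<omega>. real_of_ereal (max 0 (W j \<omega>)))"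
    and a [measurable]: "a \<in> borel_measurable borel" and a01: "\<And>x. 0 \<le> a x" "\<And>x. a x \<le> 1"
    and h: "h > 0"
    and step: "\<And>w m i. (\<And>j. w j \<noteq> \<infinity>) \<Longrightarrow>
      h - quenched_mean w (Suc m) i \<le> a (w i) * matrix_apply p (\<lambda>j. max 0 (h - quenched_mean w m j)) i"
    and heat: "\<And>k x. heat k x \<le> C * real (Suc k) powr (- real CARD('d) / 2)"
    and n: "n \<ge> 1"
  shows "h * (1 - (\<integral>x. a x \<partial>\<nu>)) \<le> integral\<^sup>L M (harness_surface p eps W n 0)"
    and "h * (1 - (C * (2 * real step_range * real K + 1) ^ CARD('d) * real n powr (- real CARD('d) / 2)
        + (\<integral>x. a x \<partial>\<nu>) ^ K)) \<le> integral\<^sup>L M (harness_surface p eps W n 0)"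
proof -
  define b where "b = (\<integral>x. a x \<partial>\<nu>)"
  obtain m where m: "n = Suc m" using n by (cases n) auto
  let ?S = "\<lambda>\<omega>. survival a (\<lambda>j. W j \<omega>) (Suc m) 0"
  have S [measurable]: "?S \<in> borel_measurable M" by (rule survival_measurable) auto
  have Sb: "0 \<le> ?S \<omega>" "?S \<omega> \<le> 1" for \<omega> by (rule survival_bounds[OF a01])+
  have Sint: "integrable M ?S"
    by (rule integrable_const_bound[of _ 1]) (use Sb in \<open>auto simp del: survival.simps\<close>)
  have aint: "integrable M (\<lambda>\<omega>. a (W 0 \<omega>))"
    by (rule integrable_const_bound[of _ 1]) (auto simp: a01)
  have ai: "(\<integral>\<omega>. a (W 0 \<omega>) \<partial>M) = b"
    unfolding b_def wall_law[of 0, symmetric] by (rule integral_distr[symmetric]) auto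
  have b0: "0 \<le> b" unfolding b_def using a01 by (intro integral_nonneg_AE) auto
  have b1: "b \<le> 1"
  proof -
    have "(\<integral>\<omega>. a (W 0 \<omega>) \<partial>M) \<le> (\<integral>\<omega>. 1 \<partial>M)" by (intro integral_mono aint a01) auto
    then show ?thesis using ai prob_space by simp
  qed
  have "h * (1 - integral\<^sup>L M ?S) = (\<integral>\<omega>. h - h * ?S \<omega> \<partial>M)"
    using Sint prob_space by (simp add: right_diff_distrib del: survival.simps)
  also have "\<dots> \<le> (\<integral>\<omega>. quenched_mean (\<lambda>j. W j \<omega>) (Suc m) 0 \<partial>M)"
  proof (rule integral_mono)
    show "integrable M (\<lambda>\<omega>. h - h * ?S \<omega>)"
      by (intro Bochner_Integration.integrable_diff integrable_const integrable_mult_right Sint)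
    show "integrable M (\<lambda>\<omega>. quenched_mean (\<lambda>j. W j \<omega>) (Suc m) 0)"
      by (rule quenched_mean_integrable[OF int])
    fix \<omega> assume \<omega>: "\<omega> \<in> space M"
    have "W j \<omega> \<noteq> \<infinity>" for j using wall_less_infty[OF \<omega>, of j] by auto
    then have "h - quenched_mean (\<lambda>j. W j \<omega>) (Suc m) 0 \<le> h * ?S \<omega>"
      using h by (intro deficit_le_survival[where V = "quenched_mean (\<lambda>j. W j \<omega>)"] a01 quenched_mean_0 step) auto
    then show "h - h * ?S \<omega> \<le> quenched_mean (\<lambda>j. W j \<omega>) (Suc m) 0" by linarith
  qed
  also have "\<dots> = integral\<^sup>L M (harness_surface p eps W n 0)"
    unfolding m by (rule surface_integral[OF int, symmetric])
  finally have main: "h * (1 - integral\<^sup>L M ?S) \<le> integral\<^sup>L M (harness_surface p eps W n 0)" .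
  have "integral\<^sup>L M ?S \<le> (\<integral>\<omega>. a (W 0 \<omega>) \<partial>M)"
  proof (rule integral_mono[OF Sint aint])
    fix \<omega>
    have "matrix_apply p (survival a (\<lambda>j. W j \<omega>) m) 0 \<le> matrix_apply p (\<lambda>_. 1) 0"
      by (intro matrix_apply_mono survival_bounds(2)[OF a01])
    then show "?S \<omega> \<le> a (W 0 \<omega>)"
      using mult_left_mono[of "matrix_apply p (survival a (\<lambda>j. W j \<omega>) m) 0" 1 "a (W 0 \<omega>)"] a01
      by (simp add: matrix_apply_const)
  qed
  then have "h * (1 - b) \<le> h * (1 - integral\<^sup>L M ?S)" using h ai by (intro mult_left_mono) auto
  with main show "h * (1 - (\<integral>x. a x \<partial>\<nu>)) \<le> integral\<^sup>L M (harness_surface p eps W n 0)"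
    by (simp add: b_def)
  have "integral\<^sup>L M ?S \<le> (\<Sum>z\<in>reach m. heat m z * b ^ (max_abs z div step_range))"
    using expected_survival_le[OF a a01, of "{}" 0 m] by (simp add: b_def del: survival.simps)
  also have "\<dots> \<le> C * real (Suc m) powr (- real CARD('d) / 2) * (2 * real step_range * real K + 1) ^ CARD('d) + b ^ K"
    by (rule heat_power_sum_le[OF heat b0 b1])
  finally have "integral\<^sup>L M ?S \<le> C * (2 * real step_range * real K + 1) ^ CARD('d) * real n powr (- real CARD('d) / 2) + b ^ K"
    by (simp add: m mult_ac del: survival.simps)
  then have "h * (1 - (C * (2 * real step_range * real K + 1) ^ CARD('d) * real n powr (- real CARD('d) / 2) + b ^ K))
      \<le> h * (1 - integral\<^sup>L M ?S)" using h by (intro mult_left_mono) auto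
  with main show "h * (1 - (C * (2 * real step_range * real K + 1) ^ CARD('d) * real n powr (- real CARD('d) / 2)
        + (\<integral>x. a x \<partial>\<nu>) ^ K)) \<le> integral\<^sup>L M (harness_surface p eps W n 0)"
    by (simp add: b_def)
qed

section \<open>The two lower bounds for the mean height\<close>

lemma wall_prob_space: "prob_space \<nu>"
  using prob_space_distr[OF W_measurable[of 0]] by (simp add: wall_law)

lemma deficit_le_average:
  assumes "\<And>j. w j \<noteq> \<infinity>"
  shows "h - matrix_apply p (quenched_mean w m) i \<le> matrix_apply p (\<lambda>j. max 0 (h - quenched_mean w m j)) i"
proof -
  have "h - matrix_apply p (quenched_mean w m) i = matrix_apply p (\<lambda>j. h - quenched_mean w m j) i"
    by (simp add: matrix_apply_diff matrix_apply_const)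
  also have "\<dots> \<le> matrix_apply p (\<lambda>j. max 0 (h - quenched_mean w m j)) i"
    by (rule matrix_apply_mono) simp
  finally show ?thesis .
qed

lemma surface_lower_bound_wall:
  assumes wall_tail: "ecdf \<nu> \<in> \<L> \<theta>" and \<theta>: "\<theta> > 0"
  shows "\<exists>c>0. \<forall>n\<ge>3. c * ln (real n) powr (1 / \<theta>) \<le> integral\<^sup>L M (harness_surface p eps W n 0)"
proof -
  interpret N: prob_space \<nu> by (rule wall_prob_space)
  have space: "space \<nu> = UNIV" using sets_eq_imp_space_eq[OF sets_wall] by simp
  have up: "ecdf \<nu> \<in> \<L>\<^sup>- \<theta>" using wall_tail by (simp add: tail_class_def)
  obtain c c' where c: "c > 0" "c' > 0" "\<And>x. x > 0 \<Longrightarrow> c * exp (- c' * x powr \<theta>) \<le> 1 - ecdf \<nu> x"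
    using wall_tail unfolding tail_class_def tail_class_lower_def by blast
  obtain C where C: "C \<ge> 1" "\<And>k x. heat k x \<le> C * real (Suc k) powr (- real CARD('d) / 2)"
    using heat_kernel_bound by blast
  \<comment> \<open>A visit to a site whose wall reaches \<open>h\<close> removes the deficit
    completely; other sites only average it.\<close>
  define a where "a h = (indicator {..<ereal h} :: ereal \<Rightarrow> real)" for h
  define b where "b h = measure \<nu> {..<ereal h}" for h
  have ab: "(\<integral>x. a h x \<partial>\<nu>) = b h" for h by (simp add: a_def b_def space)
  have a [measurable]: "a h \<in> borel_measurable borel" for h by (simp add: a_def)
  have step: "h - quenched_mean w (Suc m) i \<le> a h (w i) * matrix_apply p (\<lambda>j. max 0 (h - quenched_mean w m j)) i"
    if w: "\<And>j. w j \<noteq> \<infinity>" for h w m i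
  proof (cases "ereal h \<le> w i")
    case True
    then show ?thesis using quenched_mean_ge_wall[of w h i m] w by (simp add: a_def)
  next
    case False
    then show ?thesis
      using quenched_mean_ge_average[where w = w, OF w, where n = m and i = i]
        deficit_le_average[where w = w, OF w, where m = m and i = i and h = h]
      by (simp add: a_def)
  qed
  note ge = surface_integral_ge[OF wall_integrable[OF up \<theta>] a _ _ _ step C(2), unfolded ab]
  show ?thesis
  proof (rule lower_bound_asymptotics[OF \<theta> c(1,2), where b = b and d = "CARD('d)" and v = step_range and C = C])
    show "b h \<le> 1 - c * exp (- c' * h powr \<theta>)" if h: "h > 0" for h
    proof -
      have "b h \<le> ecdf \<nu> h" unfolding b_def ecdf_def by (rule N.finite_measure_mono) auto
      then show ?thesis using c(3)[OF h] by linarith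
    qed
    show "h * (1 - b h) \<le> integral\<^sup>L M (harness_surface p eps W n 0)" if "n \<ge> 1" "h > 0" for n h
      by (rule ge(1)) (use that in \<open>auto simp: a_def\<close>)
    show "h * (1 - (C * (2 * real step_range * real K + 1) ^ CARD('d) * real n powr (- real CARD('d) / 2) + b h ^ K))
      \<le> integral\<^sup>L M (harness_surface p eps W n 0)" if "n \<ge> 1" "h > 0" for n h K
      by (rule ge(2)) (use that in \<open>auto simp: a_def\<close>)
  qed (use C in \<open>auto simp: b_def\<close>)
qed

lemma surface_lower_bound_noise:
  assumes noise_tail: "cdf \<mu> \<in> \<L>\<^sup>+ \<alpha>" and \<alpha>: "\<alpha> > 0"
    and wall_tail: "ecdf \<nu> \<in> \<L> \<theta>" and \<theta>: "\<theta> > 0"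
  shows "\<exists>c>0. \<forall>n\<ge>3. c * ln (real n) powr (1 / \<alpha>) \<le> integral\<^sup>L M (harness_surface p eps W n 0)"
proof -
  interpret N: prob_space \<mu> by (rule noise_prob_space)
  interpret V: prob_space \<nu> by (rule wall_prob_space)
  have space: "space \<mu> = UNIV" "space \<nu> = UNIV"
    using sets_eq_imp_space_eq[OF sets_noise] sets_eq_imp_space_eq[OF sets_wall] by auto
  have up: "ecdf \<nu> \<in> \<L>\<^sup>- \<theta>" using wall_tail by (simp add: tail_class_def)
  obtain c c' where c: "c > 0" "c' > 0" "\<And>x. x > 0 \<Longrightarrow> c * exp (- c' * x powr \<alpha>) \<le> 1 - cdf \<mu> x"
    using noise_tail unfolding tail_class_lower_def by blast
  obtain k k' where k: "k > 0" "\<And>x. x > 0 \<Longrightarrow> k * exp (- k' * x powr \<theta>) \<le> 1 - ecdf \<nu> x"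
    using wall_tail unfolding tail_class_def tail_class_lower_def by blast
  obtain C where C: "C \<ge> 1" "\<And>k x. heat k x \<le> C * real (Suc k) powr (- real CARD('d) / 2)"
    using heat_kernel_bound by blast
  \<comment> \<open>The lower tail bound of the wall at height 1: a positive probability that the
    wall is nonnegative.\<close>
  define q where "q = k * exp (- k')"
  have q0: "q > 0" using k by (simp add: q_def)
  have q: "q \<le> measure \<nu> {0..}"
  proof -
    have "q \<le> 1 - ecdf \<nu> 1" using k(2)[of 1] by (simp add: q_def)
    also have "\<dots> = measure \<nu> (space \<nu> - {..ereal 1})" unfolding ecdf_def by (rule V.prob_compl[symmetric]) simp
    also have "\<dots> \<le> measure \<nu> {0..}"
    proof (rule V.finite_measure_mono)
      show "space \<nu> - {..ereal 1} \<subseteq> {0..}"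
      proof
        fix x assume "x \<in> space \<nu> - {..ereal 1}"
        then have "ereal 1 < x" by auto
        moreover have "(0 :: ereal) \<le> ereal 1" by simp
        ultimately show "x \<in> {0..}" by (metis atLeast_iff order.strict_implies_order order_trans)
      qed
    qed simp
    finally show ?thesis .
  qed
  define \<rho> where "\<rho> h = measure \<mu> {..-h}" for h
  have \<rho>: "0 \<le> \<rho> h" "\<rho> h \<le> 1" for h by (simp_all add: \<rho>_def)
  have \<rho>_ge: "c * exp (- c' * h powr \<alpha>) \<le> \<rho> h" if h: "h > 0" for h
  proof -
    have "c * exp (- c' * h powr \<alpha>) \<le> 1 - cdf \<mu> h" by (rule c(3)[OF h])
    also have "\<dots> = measure \<mu> (space \<mu> - {..h})" unfolding cdf_def by (rule N.prob_compl[symmetric]) simp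
    also have "\<dots> \<le> measure \<mu> (uminus -` {..-h} \<inter> space \<mu>)"
      by (rule N.finite_measure_mono) auto
    also have "\<dots> = measure (distr \<mu> borel uminus) {..-h}" by (rule measure_distr[symmetric]) auto
    also have "\<dots> = \<rho> h" by (simp add: noise_symmetric \<rho>_def)
    finally show ?thesis .
  qed
  \<comment> \<open>At a nonnegative wall site \<open>quenched_mean_ge_jump\<close> shrinks the
    deficit by the factor \<open>1 - \<rho> h\<close>; elsewhere it is only averaged.\<close>
  define a where "a h x = 1 - \<rho> h * indicator {0..} x" for h and x :: ereal
  define b where "b h = 1 - \<rho> h * measure \<nu> {0..}" for h
  have ab: "(\<integral>x. a h x \<partial>\<nu>) = b h" for h
  proof -
    have "(\<integral>x. a h x \<partial>\<nu>) = (\<integral>x. 1 \<partial>\<nu>) - (\<integral>x. \<rho> h * indicator {0..} x \<partial>\<nu>)"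
      unfolding a_def by (rule Bochner_Integration.integral_diff) (auto simp: V.emeasure_eq_measure)
    then show ?thesis using V.prob_space by (simp add: b_def space)
  qed
  have a [measurable]: "a h \<in> borel_measurable borel" for h unfolding a_def[abs_def] by measurable
  have a01: "0 \<le> a h x" "a h x \<le> 1" for h x
    using \<rho>[of h] by (auto simp: a_def indicator_def)
  have step: "h - quenched_mean w (Suc m) i \<le> a h (w i) * matrix_apply p (\<lambda>j. max 0 (h - quenched_mean w m j)) i"
    if w: "\<And>j. w j \<noteq> \<infinity>" for h w m i
  proof -
    let ?V = "matrix_apply p (quenched_mean w m) i"
    have av: "h - ?V \<le> matrix_apply p (\<lambda>j. max 0 (h - quenched_mean w m j)) i"
      by (rule deficit_le_average[OF w])
    show ?thesis
    proof (cases "0 \<le> w i")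
      case True
      have "h - quenched_mean w (Suc m) i \<le> h - ((1 - \<rho> h) * ?V + h * \<rho> h)"
        using quenched_mean_ge_jump[of w i h m, OF w True] by (simp add: \<rho>_def)
      also have "\<dots> = (1 - \<rho> h) * (h - ?V)" by (simp add: algebra_simps)
      also have "\<dots> \<le> (1 - \<rho> h) * matrix_apply p (\<lambda>j. max 0 (h - quenched_mean w m j)) i"
        by (intro mult_left_mono av) (use \<rho> in simp)
      finally show ?thesis using True by (simp add: a_def)
    next
      case False
      then show ?thesis using quenched_mean_ge_average[where w = w, OF w, where n = m and i = i] av by (simp add: a_def)
    qed
  qed
  note ge = surface_integral_ge[OF wall_integrable[OF up \<theta>] a a01 _ step C(2), unfolded ab]
  have cq: "c * q > 0" using c q0 by simp
  show ?thesis
  proof (rule lower_bound_asymptotics[OF \<alpha> cq c(2), where b = b and d = "CARD('d)" and v = step_range and C = C])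
    show "b h \<le> 1 - c * q * exp (- c' * h powr \<alpha>)" if h: "h > 0" for h
    proof -
      have "c * exp (- c' * h powr \<alpha>) * q \<le> \<rho> h * measure \<nu> {0..}"
        by (intro mult_mono \<rho>_ge h q \<rho>) (use q0 in simp)
      then show ?thesis by (simp add: b_def mult_ac)
    qed
    show "0 \<le> b h" for h
      using mult_le_one[of "\<rho> h" "measure \<nu> {0..}"] \<rho> by (simp add: b_def)
    show "h * (1 - b h) \<le> integral\<^sup>L M (harness_surface p eps W n 0)" if "n \<ge> 1" "h > 0" for n h
      by (rule ge(1)) (use that in auto)
    show "h * (1 - (C * (2 * real step_range * real K + 1) ^ CARD('d) * real n powr (- real CARD('d) / 2) + b h ^ K))
      \<le> integral\<^sup>L M (harness_surface p eps W n 0)" if "n \<ge> 1" "h > 0" for n h K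
      by (rule ge(2)) (use that in auto)
  qed (use C in auto)
qed

end

theorem theorem3p1:
  fixes M :: "'a measure"
    and p :: "int ^ 'd \<Rightarrow> int ^ 'd \<Rightarrow> real"
    and \<mu> :: "real measure" and \<nu> :: "ereal measure"
    and eps :: "int \<Rightarrow> int ^ 'd \<Rightarrow> 'a \<Rightarrow> real"
    and W :: "int ^ 'd \<Rightarrow> 'a \<Rightarrow> ereal"
    and \<alpha> \<theta> :: real
  assumes dim: "CARD('d) \<ge> 3"
    and process: "harness_process M p \<mu> \<nu> eps W"
    and noise_tail: "cdf \<mu> \<in> \<L> \<alpha>"
    and wall_tail: "ecdf \<nu> \<in> \<L> \<theta>"
  shows "(\<alpha> > 0 \<and> \<theta> > 0 \<longrightarrow>
           (\<exists>c>0. \<forall>n\<ge>3.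
              integral\<^sup>L M (harness_surface p eps W n 0)
                \<ge> c * ln (real n) powr max (1 / \<alpha>) (1 / \<theta>))) \<and>
         (\<alpha> > 1 \<and> \<theta> > 0 \<longrightarrow>
           (\<exists>C. \<forall>n\<ge>3.
              integral\<^sup>L M (harness_surface p eps W n 0)
                \<le> C * (harness_rate CARD('d) \<alpha> n + ln (real n) powr (1 / \<theta>))))"
proof -
  interpret harness_process M p \<mu> \<nu> eps W by (rule process)
  have tails: "cdf \<mu> \<in> \<L>\<^sup>- \<alpha>" "cdf \<mu> \<in> \<L>\<^sup>+ \<alpha>" "ecdf \<nu> \<in> \<L>\<^sup>- \<theta>"
    using noise_tail wall_tail by (auto simp: tail_class_def)
  show ?thesis
  proof (intro conjI impI)
    assume "\<alpha> > 0 \<and> \<theta> > 0"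
    \<comment> \<open>The larger exponent selects which of the two lower bounds is used.\<close>
    then show "\<exists>c>0. \<forall>n\<ge>3. integral\<^sup>L M (harness_surface p eps W n 0)
        \<ge> c * ln (real n) powr max (1 / \<alpha>) (1 / \<theta>)"
      using surface_lower_bound_noise[OF tails(2) _ wall_tail] surface_lower_bound_wall[OF wall_tail]
      by (cases "1 / \<alpha> \<le> 1 / \<theta>") (simp_all add: max_def)
  next
    assume "\<alpha> > 1 \<and> \<theta> > 0"
    then show "\<exists>C. \<forall>n\<ge>3. integral\<^sup>L M (harness_surface p eps W n 0)
        \<le> C * (harness_rate CARD('d) \<alpha> n + ln (real n) powr (1 / \<theta>))"
      using surface_upper_bound[OF dim _ _ tails(1,3)] by blast
  qed
qed

end
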